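(* Let $N\ge 1$, $p>1$, $\alpha,\mathsf{s}\in(0,1)$, $\sigma>-\alpha$, and set $p_c=\frac{N(p-1)}{2\mathsf{s}}$. Let $q\in(p_c,\infty]$ with $q\ge p$. Assume that the initial data $u_0$ and the forcing term $\mathbf{w}$ both belong to $L^q(\mathbb{R}^N)$. Then there exists a time $T>0$ such that the problem $$\partial_t^\alpha u+(-\Delta)^{\mathsf{s}}u=|u|^p+t^\sigma\mathbf{w}(x),\qquad u(0,x)=u_0(x),$$ admits a unique (mild) solution $u\in L^\infty(0,T;L^q(\mathbb{R}^N))$.
   Context: Standing setting: $u_0\ge 0$ on $\mathbb{R}^N$, $\mathbf{w}:\mathbb{R}^N\to\mathbb{R}$ is a given continuous function; $\partial_t^\alpha$ is the Caputo derivative of order $\alpha$ in time, and $(-\Delta)^{\mathsf{s}}u=\mathcal{F}^{-1}(|\xi|^{2\mathsf{s}}\mathcal{F}u)$ with $\mathcal{F}$ the Fourier transform. Kernels. $Z$ is the fundamental solution of $\partial_t^\alpha u+(-\Delta)^{\mathsf{s}}u=0$, and $Y$ is the kernel of the time-fractional Duhamel term. Explicitly, for $t>0$, with $\widehat f(\xi)=\int e^{-ix\cdot\xi}f(x)\,dx$ and the Mittag-Leffler function $E_{a,b}(z)=\sum_{k\ge 0}z^k/\Gamma(ak+b)$: $\widehat{Z}(t,\xi)=E_{\alpha,1}(-|\xi|^{2\mathsf{s}}t^\alpha)$ and $\widehat{Y}(t,\xi)=t^{\alpha-1}E_{\alpha,\alpha}(-|\xi|^{2\mathsf{s}}t^\alpha)$.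 Solutions are mild: $u$ is a solution on $(0,T)$ if, for a.e. $(t,x)\in(0,T)\times\mathbb{R}^N$ (integrals absolutely convergent), $$u(t,x)=\int_{\mathbb{R}^N}u_0(y)Z(t,x-y)\,dy+\int_0^t\!\int_{\mathbb{R}^N}|u(\tau,y)|^pY(t-\tau,x-y)\,dy\,d\tau+\int_0^t\!\int_{\mathbb{R}^N}\tau^\sigma\mathbf{w}(y)Y(t-\tau,x-y)\,dy\,d\tau.$$ *)

theory Defs
  imports "HOL-Analysis.Analysis" "HOL-Probability.Essential_Supremum"
begin

text \<open>
  The space $R^N$ is a type of class \<^class>\<open>euclidean_space\<close> with $N = DIM('a)$. All functions
  are Borel representatives of their a.e. equivalence classes, with respect to
  \<^const>\<open>lborel\<close>.
\<close>

definition Lq_norm :: "ereal \<Rightarrow> ('a::euclidean_space \<Rightarrow> real) \<Rightarrow> ereal" where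
  "Lq_norm q f =
    (if q = \<infinity> then esssup lborel (\<lambda>x. ereal \<bar>f x\<bar>)
     else if integrable lborel (\<lambda>x. \<bar>f x\<bar> powr real_of_ereal q)
     then ereal ((LINT x|lborel. \<bar>f x\<bar> powr real_of_ereal q) powr (1 / real_of_ereal q))
     else \<infinity>)"

definition in_Lq :: "ereal \<Rightarrow> ('a::euclidean_space \<Rightarrow> real) \<Rightarrow> bool" where
  "in_Lq q f \<longleftrightarrow> f \<in> borel_measurable lborel \<and> Lq_norm q f < \<infinity>"

text \<open>
  $L^\infty(0,T;L^q)$: jointly measurable functions of $(t,x)$ whose slices are essentially bounded
  in $L^q$. In particular, for $q = \infty$ this is $L^\infty((0,T) \times R^N)$.
\<close>

definition in_Linf_Lq :: "real \<Rightarrow> ereal \<Rightarrow> (real \<Rightarrow> 'a::euclidean_space \<Rightarrow> real) \<Rightarrow> bool" where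
  "in_Linf_Lq T q u \<longleftrightarrow>
     set_borel_measurable lborel ({0<..<T} \<times> UNIV) (\<lambda>(t, x). u t x) \<and>
     (\<exists>C::real. AE t in lborel. t \<in> {0<..<T} \<longrightarrow> in_Lq q (u t) \<and> Lq_norm q (u t) \<le> ereal C)"

definition mittag_leffler :: "real \<Rightarrow> real \<Rightarrow> real \<Rightarrow> real" where
  "mittag_leffler a b z = (\<Sum>k. z ^ k / Gamma (a * real k + b))"

definition fourier :: "('a::euclidean_space \<Rightarrow> real) \<Rightarrow> 'a \<Rightarrow> complex" where
  "fourier f \<xi> = (LINT x|lborel. exp (- (\<i> * complex_of_real (x \<bullet> \<xi>))) * complex_of_real (f x))"

text \<open>
  A kernel with symbol \<open>m\<close> is determined by the following conditions only up to a null set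
  in $x$, for each $t > 0$. The choice made in \<open>kernel_of\<close> is immaterial, because kernels occur only
  under integrals; joint measurability makes the space-time integrals below meaningful. (The
  inverse Fourier integral cannot serve as a definition: the symbols need not be integrable.)
\<close>

definition has_symbol ::
    "(real \<Rightarrow> 'a::euclidean_space \<Rightarrow> real) \<Rightarrow> (real \<Rightarrow> 'a \<Rightarrow> real) \<Rightarrow> bool" where
  "has_symbol K m \<longleftrightarrow>
     set_borel_measurable lborel ({0<..} \<times> UNIV) (\<lambda>(t, x). K t x) \<and>
     (\<forall>t>0. integrable lborel (K t) \<and> (\<forall>\<xi>. fourier (K t) \<xi> = complex_of_real (m t \<xi>)))"

definition kernel_of ::
    "(real \<Rightarrow> 'a::euclidean_space \<Rightarrow> real) \<Rightarrow> real \<Rightarrow> 'a \<Rightarrow> real" where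
  "kernel_of m = (SOME K. has_symbol K m)"

definition Z_kernel :: "real \<Rightarrow> real \<Rightarrow> real \<Rightarrow> 'a::euclidean_space \<Rightarrow> real" where
  "Z_kernel \<alpha> s =
     kernel_of (\<lambda>t \<xi>. mittag_leffler \<alpha> 1 (- (norm \<xi> powr (2 * s) * t powr \<alpha>)))"

definition Y_kernel :: "real \<Rightarrow> real \<Rightarrow> real \<Rightarrow> 'a::euclidean_space \<Rightarrow> real" where
  "Y_kernel \<alpha> s =
     kernel_of (\<lambda>t \<xi>. t powr (\<alpha> - 1) *
                  mittag_leffler \<alpha> \<alpha> (- (norm \<xi> powr (2 * s) * t powr \<alpha>)))"

definition mild_solution ::
    "real \<Rightarrow> real \<Rightarrow> real \<Rightarrow> real \<Rightarrow> ('a::euclidean_space \<Rightarrow> real) \<Rightarrow> ('a \<Rightarrow> real) \<Rightarrow>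
     real \<Rightarrow> (real \<Rightarrow> 'a \<Rightarrow> real) \<Rightarrow> bool" where
  "mild_solution \<alpha> s p \<sigma> u0 w T u \<longleftrightarrow>
     (AE (t, x) in lborel. t \<in> {0<..<T} \<longrightarrow>
        integrable lborel (\<lambda>y. u0 y * Z_kernel \<alpha> s t (x - y)) \<and>
        set_integrable lborel ({0<..<t} \<times> UNIV)
          (\<lambda>(\<tau>, y). \<bar>u \<tau> y\<bar> powr p * Y_kernel \<alpha> s (t - \<tau>) (x - y)) \<and>
        set_integrable lborel ({0<..<t} \<times> UNIV)
          (\<lambda>(\<tau>, y). \<tau> powr \<sigma> * w y * Y_kernel \<alpha> s (t - \<tau>) (x - y)) \<and>
        u t x =
          (LINT y|lborel. u0 y * Z_kernel \<alpha> s t (x - y))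
          + (LINT \<tau>:{0<..<t}|lborel. LINT y|lborel.
               \<bar>u \<tau> y\<bar> powr p * Y_kernel \<alpha> s (t - \<tau>) (x - y))
          + (LINT \<tau>:{0<..<t}|lborel. LINT y|lborel.
               \<tau> powr \<sigma> * w y * Y_kernel \<alpha> s (t - \<tau>) (x - y)))"

end

theory Submission
  imports Defs "HOL-Probability.Probability" "HOL-Real_Asymp.Real_Asymp"
begin

text \<open>
  Both kernels are mixtures of heat kernels. Let $S$ and $A$ be independent one-sided stable variables
  of index $s$ and $\alpha$, so that $E\,e^{-lS} = e^{-l^s}$. The variable $A^{-\alpha}$ has the moments
  $k!/\Gamma(\alpha k+1)$, hence $E\,e^{-zA^{-\alpha}} = E_{\alpha,1}(-z)$ and
  $E\,\alpha A^{-\alpha}e^{-zA^{-\alpha}} = E_{\alpha,\alpha}(-z)$. Evaluating the heat kernel at the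
  random time $(t/A)^{\alpha/s}S$ therefore gives kernels with the symbols of $Z$ and $Y$, up to the
  weight $\alpha A^{-\alpha}$ and a power of $t$. As all negative moments of $S$ and $A$ are finite,
  $\|Y(t)\|_r$ is at most a constant times $t^{\beta-1}$ with
  $\beta = \alpha - \frac{\alpha N}{2s}(1-\frac1r)$. For $1-\frac1r = \frac{p-1}q$, the exponent of
  Young's inequality from $L^{q/p}$ to $L^q$, the condition $\beta>0$ is $q>p_c$.

  Existence: for small $T$ a monotone iteration solves the equation in which all data and kernels are
  replaced by their absolute values. Its solution dominates the Picard iterates, and these converge
  almost everywhere because the oscillation $d_n$ of the iterates of index at least $n$ satisfies
  $d_{n+1} \le p\,|Y| * (U^{p-1}d_n)$, which is a contraction in $L^q$ norms weighted by
  $e^{-lt}$ with $l$ large. Applied to the difference of two solutions, the same estimate yields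
  uniqueness without any smallness condition.
\<close>

section \<open>One-sided stable laws\<close>

text \<open>The kernels are fixed only by their Fourier transforms, through a choice operator, and
  no inversion integral is at hand. Hence the detour: an explicit candidate is built first, its
  transform is computed by Fubini, and injectivity of the Fourier transform on integrable functions
  carries its norm bounds over to the chosen kernels. The stable laws in turn arise as weak limits
  of rescaled sums of Sibuya variables, whose generating function 1 - (1 - x)^s already contains the
  power s.

  The nonlinear estimates are stated for functions with values in [0,\<infinity>], so that monotone
  limits and suprema of differences can be formed before anything is known to be finite; finiteness
  almost everywhere is read off from the norm bounds afterwards. Since the Picard iterates are
  compared pointwise, no complete function space is needed, and constant factors lost in crude
  inequalities are absorbed by the choice of T or of the weight.\<close>

definition sibuya :: "real \<Rightarrow> nat \<Rightarrow> real" where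
  "sibuya s k = (if k = 0 then 0 else - (s gchoose k) * (-1) ^ k)"

lemma sibuya_Suc_Suc:
  "sibuya s (Suc (Suc n)) = sibuya s (Suc n) * ((real (Suc n) - s) / real (Suc (Suc n)))"
proof -
  have "(s gchoose Suc (Suc n)) * real (Suc (Suc n)) = (s - real (Suc n)) * (s gchoose Suc n)"
    using gbinomial_absorb_comp[of s "Suc n"] gbinomial_mult_1'[of s "Suc n"]
    by (simp add: algebra_simps)
  hence "s gchoose Suc (Suc n) = (s - real (Suc n)) * (s gchoose Suc n) / real (Suc (Suc n))"
    by (simp add: eq_divide_eq del: of_nat_Suc)
  hence "- (s gchoose Suc (Suc n)) * (-1) ^ Suc (Suc n) =
      - ((s - real (Suc n)) * (s gchoose Suc n) / real (Suc (Suc n))) * (-1) ^ Suc (Suc n)"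
    by (simp only:)
  also have "\<dots> = (- (s gchoose Suc n) * (-1) ^ Suc n) * ((real (Suc n) - s) / real (Suc (Suc n)))"
    by (simp add: divide_simps del: of_nat_Suc) (simp add: algebra_simps)
  finally show ?thesis by (simp only: sibuya_def nat.simps if_False)
qed

text \<open>The weight at 1 is s, and every further ratio has the numerator n + 1 - s > 0.\<close>

lemma sibuya_nonneg:
  assumes "0 < s" "s < 1"
  shows "0 \<le> sibuya s k"
proof (cases k)
  case (Suc n)
  have "0 \<le> sibuya s (Suc n)"
  proof (induction n)
    case 0 thus ?case using assms by (simp add: sibuya_def)
  next
    case (Suc n) thus ?case using assms unfolding sibuya_Suc_Suc
      by (intro mult_nonneg_nonneg divide_nonneg_nonneg) auto
  qed
  thus ?thesis by (simp add: Suc)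
qed (simp add: sibuya_def)

lemma sibuya_power_series:
  assumes "0 \<le> x" "x < 1"
  shows "(\<lambda>k. sibuya s k * x ^ k) sums (1 - (1 - x) powr s)"
proof -
  have "(\<lambda>k. (if k = 0 then 1 else 0) - (s gchoose k) * (- x) ^ k) sums (1 - (1 + - x) powr s)"
    using assms by (intro sums_diff gen_binomial_real) (use sums_single[of 0 "\<lambda>_. 1::real"] in simp_all)
  moreover have "(if k = 0 then 1 else 0) - (s gchoose k) * (- x) ^ k = sibuya s k * x ^ k" for k
    by (simp add: sibuya_def power_minus[of x k])
  ultimately show ?thesis by simp
qed

text \<open>Abel's argument at the boundary point x = 1. As the terms are nonnegative, partial sums
  at x < 1 stay below 1 - (1 - x)^s, which bounds the partial sums at 1; conversely the full series
  dominates the power series at each x < 1. Total mass 1 makes the weights a distribution.\<close>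

lemma sibuya_sums_1:
  assumes s: "0 < s" "s < 1"
  shows "sibuya s sums 1"
proof -
  have *: "((\<lambda>x. x) \<longlongrightarrow> (1::real)) (at_left 1)" by (rule tendsto_ident_at)
  have ev: "\<forall>\<^sub>F x in at_left (1::real). 0 \<le> x \<and> x < 1"
    unfolding eventually_at_left_field by (rule exI[of _ 0]) auto
  have le1: "sum (sibuya s) {..<n} \<le> 1" for n
  proof (rule tendsto_upperbound[of "\<lambda>x. \<Sum>k<n. sibuya s k * x ^ k" _ "at_left 1"])
    have "((\<lambda>x. \<Sum>k<n. sibuya s k * x ^ k) \<longlongrightarrow> (\<Sum>k<n. sibuya s k * 1 ^ k)) (at_left 1)"
      by (intro tendsto_intros *)
    thus "((\<lambda>x. \<Sum>k<n. sibuya s k * x ^ k) \<longlongrightarrow> sum (sibuya s) {..<n}) (at_left 1)" by simp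
    show "\<forall>\<^sub>F x in at_left 1. (\<Sum>k<n. sibuya s k * x ^ k) \<le> 1"
      using ev
    proof eventually_elim
      case (elim x)
      have "(\<Sum>k<n. sibuya s k * x ^ k) \<le> 1 - (1 - x) powr s"
        using sibuya_power_series[of x s] elim sibuya_nonneg[OF s]
        by (metis (no_types, lifting) finite_lessThan mult_nonneg_nonneg sum_le_suminf sums_iff zero_le_power)
      thus ?case by (smt (verit) powr_ge_zero)
    qed
  qed auto
  have sm: "summable (sibuya s)"
    by (rule summableI_nonneg_bounded[OF sibuya_nonneg[OF s] le1])
  have "suminf (sibuya s) \<le> 1" using sm le1 by (intro suminf_le_const)
  moreover have "1 \<le> suminf (sibuya s)"
  proof (rule tendsto_upperbound[of "\<lambda>x. 1 - (1 - x) powr s" _ "at_left 1"])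
    have "((\<lambda>x. 1 - (1 - x) powr s) \<longlongrightarrow> 1 - (1 - 1) powr s) (at_left 1)"
      using ev s by (intro tendsto_intros * tendsto_powr') (auto elim!: eventually_mono)
    thus "((\<lambda>x. 1 - (1 - x) powr s) \<longlongrightarrow> 1) (at_left 1)" by simp
    show "\<forall>\<^sub>F x in at_left 1. 1 - (1 - x) powr s \<le> suminf (sibuya s)"
      using ev
    proof eventually_elim
      case (elim x)
      have "sibuya s k * x ^ k \<le> sibuya s k" for k
        using elim sibuya_nonneg[OF s, of k] by (simp add: mult_left_le power_le_one)
      thus ?case using sibuya_power_series[of x s] elim sm
        by (metis (mono_tags, lifting) suminf_le sums_iff)
    qed
  qed auto
  ultimately show ?thesis using sm by (simp add: sums_iff)
qed

lemma ex_sibuya_pmf: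
  assumes s: "0 < s" "s < 1"
  shows "\<exists>P :: nat pmf. \<forall>x. 0 \<le> x \<and> x < 1 \<longrightarrow>
    (\<integral>\<^sup>+k. ennreal (x ^ k) \<partial>measure_pmf P) = ennreal (1 - (1 - x) powr s)"
proof -
  have int: "(\<integral>\<^sup>+k. ennreal (sibuya s k * x ^ k) \<partial>count_space UNIV) = ennreal S"
    if "(\<lambda>k. sibuya s k * x ^ k) sums S" "0 \<le> x" for x S
  proof -
    have "(\<Sum>k. ennreal (sibuya s k * x ^ k)) = ennreal (\<Sum>k. sibuya s k * x ^ k)"
      using that sibuya_nonneg[OF s] by (intro suminf_ennreal2) (auto simp: sums_iff)
    thus ?thesis using that by (simp add: nn_integral_count_space_nat sums_iff)
  qed
  define P where "P = embed_pmf (sibuya s)"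
  have P: "pmf P k = sibuya s k" for k
    unfolding P_def using sibuya_nonneg[OF s] int[of 1 1] sibuya_sums_1[OF s]
    by (intro pmf_embed_pmf) auto
  show ?thesis
    using int[OF sibuya_power_series] sibuya_nonneg[OF s]
    by (intro exI[of _ P]) (simp add: nn_integral_measure_pmf P ennreal_mult'[symmetric])
qed

text \<open>Adding an independent copy multiplies generating functions. The set \<open>X\<close> of
  arguments is a parameter because the Sibuya formula is only available below 1.\<close>

lemma ex_pmf_power:
  fixes P :: "nat pmf"
  assumes "\<forall>x\<in>X. (\<integral>\<^sup>+k. ennreal (x ^ k) \<partial>measure_pmf P) = ennreal (f x)"
    and "\<forall>x\<in>X. 0 \<le> x \<and> 0 \<le> f x"
  shows "\<exists>Q :: nat pmf. \<forall>x\<in>X. (\<integral>\<^sup>+k. ennreal (x ^ k) \<partial>measure_pmf Q) = ennreal (f x ^ n)"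
proof (induction n)
  case 0
  show ?case by (intro exI[of _ "return_pmf 0"]) (simp add: nn_integral_return_pmf)
next
  case (Suc n)
  then obtain Q :: "nat pmf"
    where Q: "\<forall>x\<in>X. (\<integral>\<^sup>+k. ennreal (x ^ k) \<partial>measure_pmf Q) = ennreal (f x ^ n)" by blast
  show ?case
  proof (intro exI[of _ "map_pmf (\<lambda>(a, b). a + b) (pair_pmf P Q)"] ballI)
    fix x assume x: "x \<in> X"
    show "(\<integral>\<^sup>+k. ennreal (x ^ k) \<partial>measure_pmf (map_pmf (\<lambda>(a, b). a + b) (pair_pmf P Q))) = ennreal (f x ^ Suc n)"
      using assms Q x
      by (simp add: nn_integral_pair_pmf' power_add ennreal_mult nn_integral_cmult nn_integral_multc)
  qed
qed

text \<open>The law of $n^{-1/s}$ times a sum of $n$ independent Sibuya variables (here with \<open>Suc n\<close> for $n$).\<close>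

lemma ex_stable_approximation:
  assumes s: "0 < s" "s < 1"
  shows "\<exists>M. real_distribution M \<and> (AE x in M. 0 \<le> x) \<and>
    (\<forall>l\<ge>0. (\<integral>x. exp (- (l * x)) \<partial>M) = (1 - (1 - exp (- (l * real (Suc n) powr (- 1 / s)))) powr s) ^ Suc n)"
proof -
  define h where "h = real (Suc n) powr (- 1 / s)"
  have h: "h > 0" by (simp add: h_def)
  obtain P :: "nat pmf" where P: "\<forall>x\<in>{0..<1}. (\<integral>\<^sup>+k. ennreal (x ^ k) \<partial>measure_pmf P) = ennreal (1 - (1 - x) powr s)"
    using ex_sibuya_pmf[OF s] by (metis atLeastLessThan_iff)
  have pos: "0 \<le> 1 - (1 - x) powr s" if "x \<in> {0..1}" for x
    using that s powr_le1[of s "1 - x"] by simp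
  obtain Q :: "nat pmf" where Q: "\<forall>x\<in>{0..<1}. (\<integral>\<^sup>+k. ennreal (x ^ k) \<partial>measure_pmf Q) = ennreal ((1 - (1 - x) powr s) ^ Suc n)"
    using ex_pmf_power[OF P, of "Suc n"] pos by auto
  define M where "M = distr (measure_pmf Q) borel (\<lambda>k. real k * h)"
  have "real_distribution M"
    unfolding M_def by (intro prob_space.real_distribution_distr[OF prob_space_measure_pmf]) simp
  moreover have "AE x in M. 0 \<le> x"
    unfolding M_def using h by (subst AE_distr_iff) auto
  moreover have "(\<integral>x. exp (- (l * x)) \<partial>M) = (1 - (1 - exp (- (l * h))) powr s) ^ Suc n" if "l \<ge> 0" for l
  proof (cases "l = 0")
    \<comment> \<open>At l = 0 the generating function would be evaluated at 1, outside its range;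
      there both sides are 1.\<close>
    case True
    interpret real_distribution M by fact
    show ?thesis using prob_space s by (simp add: True)
  next
    case False
    with that have l: "l > 0" by simp
    have "(\<integral>x. exp (- (l * x)) \<partial>M) = (\<integral>k. exp (- (l * h)) ^ k \<partial>measure_pmf Q)"
    proof -
      have "exp (- (l * (real k * h))) = exp (- (l * h)) ^ k" for k
        using exp_of_nat_mult[of k "- (l * h)"] by (simp add: mult_ac)
      thus ?thesis unfolding M_def by (subst integral_distr) auto
    qed
    also have "\<dots> = enn2real (\<integral>\<^sup>+k. ennreal (exp (- (l * h)) ^ k) \<partial>measure_pmf Q)"
      by (intro integral_eq_nn_integral) auto
    also have "\<dots> = (1 - (1 - exp (- (l * h))) powr s) ^ Suc n"
      using Q l h pos[of "exp (- (l * h))"] by (subst Q[rule_format]) (auto simp del: power_Suc)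
    finally show ?thesis .
  qed
  ultimately show ?thesis unfolding h_def by blast
qed

text \<open>The scale satisfies h^s = 1/(n + 1). With a_n = ((1 - exp(-l h))/h)^s the expression is
  therefore (1 - a_n/(n + 1))^(n + 1), and a_n tends to b = l^s because the quotient tends to the
  derivative l. Replacing a_n by b costs at most |a_n - b|, by the bound k |x - y| for the
  difference of k-th powers in the unit ball.\<close>

lemma stable_approximation_tendsto:
  fixes s l :: real
  assumes s: "0 < s" "s < 1" and l: "0 \<le> l"
  shows "(\<lambda>n. (1 - (1 - exp (- (l * real (Suc n) powr (- 1 / s)))) powr s) ^ Suc n) \<longlonglongrightarrow> exp (- (l powr s))"
proof -
  define h where "h n = real (Suc n) powr (- 1 / s)" for n
  have hpos: "h n > 0" for n by (simp add: h_def)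
  have hs: "h n powr s = 1 / real (Suc n)" for n
    proof -
    have "h n powr s = real (Suc n) powr (-1)" using s by (simp only: h_def powr_powr) simp
    thus ?thesis by (simp add: powr_minus_divide del: of_nat_Suc)
  qed
  have h0: "h \<longlonglongrightarrow> 0"
  proof -
    have "filterlim (\<lambda>n. real (Suc n)) at_top sequentially"
      by (rule filterlim_compose[OF filterlim_real_sequentially filterlim_Suc])
    thus ?thesis unfolding h_def using s by (intro tendsto_neg_powr) auto
  qed
  have "((\<lambda>x. (1 - exp (- (l * x))) / x) \<longlongrightarrow> l) (at_right 0)"
  proof -
    have "((\<lambda>x::real. 1 - exp (- (l * x))) has_real_derivative l) (at 0)"
      by (auto intro!: derivative_eq_intros)
    hence "((\<lambda>x::real. (1 - exp (- (l * x))) / x) \<longlongrightarrow> l) (at 0)"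
      by (simp add: has_field_derivative_iff)
    thus ?thesis by (rule filterlim_mono) (auto simp: at_le)
  qed
  moreover have "filterlim h (at_right 0) sequentially"
    using h0 hpos by (intro tendsto_imp_filterlim_at_right) auto
  ultimately have lim: "(\<lambda>n. (1 - exp (- (l * h n))) / h n) \<longlonglongrightarrow> l"
    by (rule filterlim_compose)
  have lim2: "(\<lambda>n. ((1 - exp (- (l * h n))) / h n) powr s) \<longlonglongrightarrow> l powr s"
    using s l hpos by (intro tendsto_powr' lim tendsto_const) (auto simp: less_eq_real_def)
  have eq: "real (Suc n) * (1 - exp (- (l * h n))) powr s = ((1 - exp (- (l * h n))) / h n) powr s" for n
    using l hpos[of n] by (simp add: powr_divide hs less_eq_real_def del: of_nat_Suc)
  define a where "a n = real (Suc n) * (1 - exp (- (l * h n))) powr s" for n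
  have a: "a \<longlonglongrightarrow> l powr s" unfolding a_def eq by (rule lim2)
  define b where "b = l powr s"
  have bn: "b \<ge> 0" by (simp add: b_def)
  have x: "norm (1 - a n / real (Suc n)) \<le> 1" for n
  proof -
    have "a n / real (Suc n) = (1 - exp (- (l * h n))) powr s" by (simp add: a_def del: of_nat_Suc)
    moreover have "l * h n \<ge> 0" using l hpos[of n] by simp
    hence "(1 - exp (- (l * h n))) powr s \<in> {0..1}" using s by (auto intro!: powr_le1)
    ultimately show ?thesis by auto
  qed
  have "(\<lambda>n. (1 + (- b) / real (Suc n)) ^ Suc n) \<longlonglongrightarrow> exp (- b)"
    using LIMSEQ_Suc[OF tendsto_exp_limit_sequentially[of "- b"]] .
  moreover have "(\<lambda>n. (1 - a n / real (Suc n)) ^ Suc n - (1 + (- b) / real (Suc n)) ^ Suc n) \<longlonglongrightarrow> 0"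
  proof (rule Lim_null_comparison)
    show "(\<lambda>n. \<bar>a n - b\<bar>) \<longlonglongrightarrow> 0"
      using a unfolding b_def by (simp add: LIM_zero_iff tendsto_rabs_zero)
    have "\<forall>\<^sub>F n in sequentially. b \<le> real (Suc n)"
      using eventually_ge_at_top[of "nat \<lceil>b\<rceil>"] by eventually_elim linarith
    thus "\<forall>\<^sub>F n in sequentially. norm ((1 - a n / real (Suc n)) ^ Suc n - (1 + (- b) / real (Suc n)) ^ Suc n) \<le> \<bar>a n - b\<bar>"
    proof eventually_elim
      case (elim n)
      have y: "norm (1 + (- b) / real (Suc n)) \<le> 1"
        using bn elim by (auto simp: field_simps simp del: of_nat_Suc)
      have "norm ((1 - a n / real (Suc n)) ^ Suc n - (1 + (- b) / real (Suc n)) ^ Suc n)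
          \<le> real (Suc n) * norm ((1 - a n / real (Suc n)) - (1 + (- b) / real (Suc n)))"
        by (rule norm_power_diff[OF x y])
      also have "\<dots> = \<bar>a n - b\<bar>"
      proof -
        have "(1 - a n / real (Suc n)) - (1 + (- b) / real (Suc n)) = (b - a n) / real (Suc n)"
          by (simp add: field_simps del: of_nat_Suc)
        thus ?thesis by (simp add: abs_minus_commute del: of_nat_Suc)
      qed
      finally show ?case .
    qed
  qed
  ultimately have "(\<lambda>n. (1 - a n / real (Suc n)) ^ Suc n) \<longlonglongrightarrow> exp (- b)"
    by (rule Lim_transform)
  thus ?thesis by (simp add: a_def h_def b_def del: power_Suc of_nat_Suc)
qed

text \<open>Bernoulli's inequality together with 1 - exp(-x) \<le> x. Uniformity in n is the point:
  it controls all Laplace transforms near l = 0 and thereby the tails of all approximations at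
  once.\<close>

lemma stable_approximation_lower:
  fixes s l :: real
  assumes s: "0 < s" "s < 1" and l: "0 \<le> l"
  shows "1 - l powr s \<le> (1 - (1 - exp (- (l * real (Suc n) powr (- 1 / s)))) powr s) ^ Suc n"
proof -
  define h where "h = real (Suc n) powr (- 1 / s)"
  define y where "y = (1 - exp (- (l * h))) powr s"
  have hs: "h powr s = 1 / real (Suc n)"
  proof -
    have "h powr s = real (Suc n) powr (-1)" using s by (simp only: h_def powr_powr) simp
    thus ?thesis by (simp add: powr_minus_divide del: of_nat_Suc)
  qed
  have h: "h > 0" by (simp add: h_def)
  have lh: "l * h \<ge> 0" using l h by simp
  have y1: "y \<le> 1" unfolding y_def using s lh by (intro powr_le1) auto
  have "1 - exp (- (l * h)) \<le> l * h" using exp_ge_add_one_self[of "- (l * h)"] by simp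
  hence "y \<le> (l * h) powr s"
    unfolding y_def using s l h by (intro powr_mono2) (auto simp: less_eq_real_def)
  also have "\<dots> = l powr s / real (Suc n)" using l h by (simp add: powr_mult hs del: of_nat_Suc)
  finally have "real (Suc n) * y \<le> l powr s" by (simp add: field_simps del: of_nat_Suc)
  moreover have "1 + real (Suc n) * (- y) \<le> (1 + (- y)) ^ Suc n"
    by (rule Bernoulli_inequality) (use y1 in simp)
  ultimately show ?thesis unfolding y_def h_def by (simp del: power_Suc of_nat_Suc)
qed

section \<open>Weak limit of the rescaled Sibuya sums\<close>

text \<open>The approximations are tight, a subsequence converges weakly, and the Laplace transforms
  pass to the limit. Mass at 0 is excluded because exp(-l^s) tends to 0 as l grows.\<close>

lemma ex_stable_measure:
  assumes s: "0 < s" "s < 1"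
  shows "\<exists>M. real_distribution M \<and> (AE x in M. 0 < x) \<and> (\<forall>l\<ge>0. (\<integral>x. exp (- (l * x)) \<partial>M) = exp (- (l powr s)))"
proof -
  define L where "L n l = (1 - (1 - exp (- (l * real (Suc n) powr (- 1 / s)))) powr s) ^ Suc n" for n l
  obtain \<nu> where \<nu>: "\<And>n. real_distribution (\<nu> n)" "\<And>n. AE x in \<nu> n. 0 \<le> x"
    "\<And>n l. l \<ge> 0 \<Longrightarrow> (\<integral>x. exp (- (l * x)) \<partial>\<nu> n) = L n l"
    using ex_stable_approximation[OF s] unfolding L_def by metis
  interpret \<nu>: real_distribution "\<nu> n" for n by (rule \<nu>)
  \<comment> \<open>Markov's inequality for 1 - exp(-x/b): beyond b it is at least 1 - exp(-1), and
    its mean is at most (1/b)^s.\<close>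
  have tail: "(1 - exp (- 1)) * (1 - measure (\<nu> n) {-1<..b}) \<le> b powr (- s)" if b: "b > 0" for n b
  proof -
    have int: "integrable (\<nu> n) (\<lambda>x. exp (- (1 / b * x)))"
      using \<nu>(2)[of n] b by (intro \<nu>.integrable_const_bound[of _ 1]) (auto elim!: eventually_mono)
    have "(1 - exp (- 1)) * (1 - measure (\<nu> n) {-1<..b}) = (1 - exp (- 1)) * measure (\<nu> n) (UNIV - {-1<..b})"
      using \<nu>.prob_compl[of "{-1<..b}" n] by simp
    also have "\<dots> = (\<integral>x. (1 - exp (- 1)) * indicator (UNIV - {-1<..b}) x \<partial>\<nu> n)" by simp
    also have "\<dots> \<le> (\<integral>x. 1 - exp (- (1 / b * x)) \<partial>\<nu> n)"
    proof (rule integral_mono_AE)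
      show "AE x in \<nu> n. (1 - exp (- 1)) * indicator (UNIV - {-1<..b}) x \<le> 1 - exp (- (1 / b * x))"
        using \<nu>(2)[of n] b by (auto elim!: eventually_mono split: split_indicator simp: field_simps)
    qed (use int in \<open>auto intro!: \<nu>.emeasure_finite simp: less_top[symmetric]\<close>)
    also have "\<dots> = 1 - L n (1 / b)" using int \<nu>(3)[of "1 / b" n] b \<nu>.prob_space[of n] by simp
    also have "\<dots> \<le> (1 / b) powr s"
      using stable_approximation_lower[OF s, of "1 / b" n] b unfolding L_def by simp
    also have "\<dots> = b powr (- s)" using b by (simp add: powr_divide powr_minus_divide)
    finally show ?thesis .
  qed
  have "tight \<nu>"
    unfolding tight_def
  proof (intro conjI allI impI \<nu>(1))
    fix \<epsilon> :: real assume \<epsilon>: "\<epsilon> > 0"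
    \<comment> \<open>Half of what is permitted, to make the final inequality strict; b is then
      chosen so that b^(-s) = c.\<close>
    define c where "c = \<epsilon> * (1 - exp (- 1)) / 2"
    have e1: "1 - exp (- 1 :: real) > 0" by simp
    have c: "c > 0" using \<epsilon> e1 by (simp add: c_def del: exp_less_one_iff)
    define b where "b = c powr (- 1 / s)"
    have b: "b > 0" using c by (simp add: b_def)
    have bc: "b powr (- s) = c" using c s by (simp add: b_def powr_powr)
    have "measure (\<nu> n) {-1<..b} > 1 - \<epsilon>" for n
    proof -
      have "(1 - exp (- 1)) * (1 - measure (\<nu> n) {-1<..b}) < (1 - exp (- 1)) * \<epsilon>"
        using tail[OF b, of n] c by (simp add: bc c_def field_simps)
      hence "1 - measure (\<nu> n) {-1<..b} < \<epsilon>" using mult_less_cancel_left_pos[OF e1] by blast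
      thus ?thesis by linarith
    qed
    thus "\<exists>a b. a < b \<and> (\<forall>n. 1 - \<epsilon> < measure (\<nu> n) {a<..b})"
      using b by (intro exI[of _ "-1"] exI[of _ b]) auto
  qed
  then obtain r M where r: "strict_mono r" "real_distribution M" "weak_conv_m (\<nu> \<circ> id \<circ> r) M"
    using tight_imp_convergent_subsubsequence[of \<nu> id] by (auto simp: strict_mono_def)
  interpret M: real_distribution M by fact
  \<comment> \<open>Weak convergence tests bounded continuous functions on the whole line, and
    exp(-l x) is unbounded to the left. The cut at 0 changes nothing for the approximations; that
    the limit also lives on the half line is only shown afterwards, from this very formula.\<close>
  have lim: "(\<integral>x. exp (- (l * max x 0)) \<partial>M) = exp (- (l powr s))" if l: "l \<ge> 0" for l
  proof (rule LIMSEQ_unique)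
    show "(\<lambda>n. \<integral>x. exp (- (l * max x 0)) \<partial>(\<nu> \<circ> id \<circ> r) n) \<longlonglongrightarrow> (\<integral>x. exp (- (l * max x 0)) \<partial>M)"
      by (rule weak_conv_imp_integral_bdd_continuous_conv[of _ _ _ 1])
         (use r \<nu>(1) l in \<open>auto intro!: continuous_intros simp: o_def\<close>)
    have "(\<integral>x. exp (- (l * max x 0)) \<partial>(\<nu> \<circ> id \<circ> r) n) = L (r n) l" for n
    proof -
      have "(\<integral>x. exp (- (l * max x 0)) \<partial>\<nu> (r n)) = (\<integral>x. exp (- (l * x)) \<partial>\<nu> (r n))"
      proof (rule integral_cong_AE)
        show "AE x in \<nu> (r n). exp (- (l * max x 0)) = exp (- (l * x))"
          using \<nu>(2)[of "r n"] by eventually_elim (simp add: max_def)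
      qed simp_all
      thus ?thesis using \<nu>(3) l by simp
    qed
    moreover have "(\<lambda>n. L n l) \<longlonglongrightarrow> exp (- (l powr s))"
      unfolding L_def by (rule stable_approximation_tendsto[OF s l])
    ultimately show "(\<lambda>n. \<integral>x. exp (- (l * max x 0)) \<partial>(\<nu> \<circ> id \<circ> r) n) \<longlonglongrightarrow> exp (- (l powr s))"
      using LIMSEQ_subseq_LIMSEQ[OF _ r(1)] by (simp add: o_def)
  qed
  have "measure M {..0} \<le> exp (- (l powr s))" if l: "l \<ge> 0" for l
  proof -
    have "measure M {..0} = (\<integral>x. indicator {..0} x \<partial>M)" by simp
    also have "\<dots> \<le> (\<integral>x. exp (- (l * max x 0)) \<partial>M)"
      using l by (intro integral_mono M.integrable_const_bound[of _ 1])
        (auto split: split_indicator simp: max_def)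
    finally show ?thesis using lim[OF l] by simp
  qed
  moreover have "((\<lambda>l. exp (- (l powr s))) \<longlongrightarrow> 0) at_top"
    using s by real_asymp
  ultimately have "measure M {..0} \<le> 0"
    by (intro tendsto_lowerbound[of "\<lambda>l. exp (- (l powr s))" 0 at_top])
       (auto intro!: eventually_mono[OF eventually_ge_at_top[of 0]])
  hence "emeasure M {..0} = 0" by (simp add: M.emeasure_eq_measure measure_le_0_iff)
  hence pos: "AE x in M. 0 < x"
    by (intro AE_I[of _ _ "{..0}"]) (auto simp: not_less)
  have "(\<integral>x. exp (- (l * x)) \<partial>M) = exp (- (l powr s))" if "l \<ge> 0" for l
  proof -
    have "(\<integral>x. exp (- (l * x)) \<partial>M) = (\<integral>x. exp (- (l * max x 0)) \<partial>M)"
    proof (rule integral_cong_AE)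
      show "AE x in M. exp (- (l * x)) = exp (- (l * max x 0))"
        using pos by eventually_elim (simp add: max_def)
    qed simp_all
    thus ?thesis using lim[OF that] by simp
  qed
  thus ?thesis using pos r(2) by blast
qed

definition stable_law :: "real \<Rightarrow> real measure" where
  "stable_law s = (SOME M. real_distribution M \<and> (AE x in M. 0 < x) \<and>
     (\<forall>l\<ge>0. (\<integral>x. exp (- (l * x)) \<partial>M) = exp (- (l powr s))))"

lemma
  assumes s: "0 < s" "s < 1"
  shows real_distribution_stable_law: "real_distribution (stable_law s)"
    and stable_law_pos: "AE x in stable_law s. 0 < x"
    and laplace_stable_law: "l \<ge> 0 \<Longrightarrow> (\<integral>x. exp (- (l * x)) \<partial>stable_law s) = exp (- (l powr s))"
  using someI_ex[OF ex_stable_measure[OF s]] unfolding stable_law_def[symmetric] by auto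

section \<open>Gamma integrals and negative moments of stable laws\<close>

lemma nn_integral_powr_from_0:
  assumes "a > 0" "b \<ge> (0::real)"
  shows "(\<integral>\<^sup>+l. ennreal (indicator {0..b} l * l powr (a - 1)) \<partial>lborel) = ennreal (b powr a / a)"
  using nn_integral_has_integral_lebesgue[OF _ has_integral_powr_from_0[of "a - 1" b]] assms
  by (simp add: indicator_def mult.commute)

lemma nn_integral_exp_tail:
  "(\<integral>\<^sup>+v. ennreal (indicator {c..} v * exp (- v)) \<partial>lborel) = ennreal (exp (- c :: real))"
proof -
  have "((\<lambda>x::real. exp (- x)) \<longlongrightarrow> 0) at_top"
    by (rule filterlim_compose[OF exp_at_bot filterlim_uminus_at_bot_at_top])
  from tendsto_minus[OF this] have "((\<lambda>x::real. - exp (- x)) \<longlongrightarrow> 0) at_top" by simp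
  hence "(\<integral>\<^sup>+v. ennreal (exp (- v)) * indicator {c..} v \<partial>lborel) = ennreal (0 - (- exp (- c)))"
    by (intro nn_integral_FTC_atLeast) (auto intro!: derivative_eq_intros)
  thus ?thesis by (simp add: ennreal_mult' mult.commute ennreal_indicator[symmetric] del: ennreal_indicator)
qed

lemma nn_integral_ennreal_cmult:
  assumes "0 \<le> k" "\<And>x. 0 \<le> f x" "f \<in> borel_measurable M"
  shows "(\<integral>\<^sup>+x. ennreal (k * f x) \<partial>M) = ennreal k * (\<integral>\<^sup>+x. ennreal (f x) \<partial>M)"
  using assms by (simp add: ennreal_mult nn_integral_cmult)

lemma nn_integral_cmult_exp_tail:
  assumes "0 \<le> k"
  shows "(\<integral>\<^sup>+v. ennreal (k * (indicator {c..} v * exp (- v))) \<partial>lborel) = ennreal (k * exp (- c :: real))"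
  using assms by (subst nn_integral_ennreal_cmult) (auto simp only: nn_integral_exp_tail ennreal_mult exp_ge_zero intro!: mult_nonneg_nonneg, simp_all)

lemma nn_integral_Gamma_scale:
  assumes a: "a > 0" and x: "x > (0::real)"
  shows "(\<integral>\<^sup>+l. ennreal (indicator {0..} l * l powr (a - 1) * exp (- (l * x))) \<partial>lborel) = ennreal (Gamma a * x powr (- a))"
proof -
  have "ennreal (Gamma a) = (\<integral>\<^sup>+t. ennreal (indicator {0..} t * t powr (a - 1) / exp t) \<partial>lborel)"
    by (rule Gamma_conv_nn_integral_real[OF a])
  also have "\<dots> = ennreal x * (\<integral>\<^sup>+l. ennreal (indicator {0..} (0 + x * l) * (0 + x * l) powr (a - 1) / exp (0 + x * l)) \<partial>lborel)"
    using x by (subst nn_integral_real_affine[where c = x and t = 0]) auto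
  also have "(\<integral>\<^sup>+l. ennreal (indicator {0..} (0 + x * l) * (0 + x * l) powr (a - 1) / exp (0 + x * l)) \<partial>lborel)
     = (\<integral>\<^sup>+l. ennreal (x powr (a - 1)) * ennreal (indicator {0..} l * l powr (a - 1) * exp (- (l * x))) \<partial>lborel)"
    using x by (intro nn_integral_cong)
      (auto simp: ennreal_mult'[symmetric] powr_mult exp_minus field_simps zero_le_mult_iff split: split_indicator)
  also have "\<dots> = ennreal (x powr (a - 1)) * (\<integral>\<^sup>+l. ennreal (indicator {0..} l * l powr (a - 1) * exp (- (l * x))) \<partial>lborel)"
    by (intro nn_integral_cmult) simp
  finally have "ennreal (x powr (- a)) * ennreal (Gamma a) = ennreal (x powr (- a)) * (ennreal x * (ennreal (x powr (a - 1)) *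
      (\<integral>\<^sup>+l. ennreal (indicator {0..} l * l powr (a - 1) * exp (- (l * x))) \<partial>lborel)))" by simp
  also have "\<dots> = ennreal (x powr (- a) * (x * x powr (a - 1))) * (\<integral>\<^sup>+l. ennreal (indicator {0..} l * l powr (a - 1) * exp (- (l * x))) \<partial>lborel)"
    using x by (simp add: ennreal_mult mult_ac)
  also have "x powr (- a) * (x * x powr (a - 1)) = 1"
    using x by (simp add: powr_diff powr_minus field_simps)
  finally show ?thesis using a by (simp add: ennreal_mult mult.commute less_imp_le)
qed

lemma Gamma_real_plus1: "x > (0::real) \<Longrightarrow> Gamma (x + 1) = x * Gamma x"
  by (rule Gamma_plus1) (auto dest: nonpos_Ints_nonpos)

text \<open>Integration against l^(a - 1) turns the Laplace transform into a moment: Gamma(a) x^(-a)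
  is the integral of l^(a - 1) exp(-l x), and after Tonelli the integrand is l^(a - 1) exp(-l^s),
  which leads to a Gamma integral again.\<close>

lemma stable_law_neg_moment:
  assumes s: "0 < s" "s < 1" and a: "a > 0"
  shows "(\<integral>\<^sup>+x. ennreal (x powr (- a)) \<partial>stable_law s) = ennreal (Gamma (a / s + 1) / Gamma (a + 1))"
proof -
  let ?M = "stable_law s"
  interpret M: real_distribution ?M by (rule real_distribution_stable_law[OF s])
  have [measurable_cong, simp]: "sets ?M = sets borel" by simp
  interpret P: pair_sigma_finite lborel ?M ..
  have Gpos: "Gamma a > 0" using a by simp
  have "ennreal (Gamma a) * (\<integral>\<^sup>+x. ennreal (x powr (- a)) \<partial>?M) = (\<integral>\<^sup>+x. ennreal (Gamma a * x powr (- a)) \<partial>?M)"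
    using Gpos by (subst nn_integral_cmult[symmetric]) (auto simp: ennreal_mult less_imp_le)
  also have "\<dots> = (\<integral>\<^sup>+x. \<integral>\<^sup>+l. ennreal (indicator {0..} l * l powr (a - 1) * exp (- (l * x))) \<partial>lborel \<partial>?M)"
    using stable_law_pos[OF s] by (intro nn_integral_cong_AE) (auto elim!: eventually_mono simp: nn_integral_Gamma_scale[OF a])
  also have "\<dots> = (\<integral>\<^sup>+l. \<integral>\<^sup>+x. ennreal (indicator {0..} l * l powr (a - 1) * exp (- (l * x))) \<partial>?M \<partial>lborel)"
    by (intro P.Fubini') measurable
  also have "\<dots> = (\<integral>\<^sup>+l. ennreal (indicator {0..} l * l powr (a - 1) * exp (- (l powr s))) \<partial>lborel)"
  proof (intro nn_integral_cong)
    fix l :: real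
    show "(\<integral>\<^sup>+x. ennreal (indicator {0..} l * l powr (a - 1) * exp (- (l * x))) \<partial>?M)
        = ennreal (indicator {0..} l * l powr (a - 1) * exp (- (l powr s)))"
    proof (cases "l \<ge> 0")
      case True
      have "(\<integral>\<^sup>+x. ennreal (exp (- (l * x))) \<partial>?M) = ennreal (\<integral>x. exp (- (l * x)) \<partial>?M)"
        using True stable_law_pos[OF s]
        by (intro nn_integral_eq_integral M.integrable_const_bound[of _ 1]) (auto elim!: eventually_mono)
      thus ?thesis using True by (simp add: laplace_stable_law[OF s] ennreal_mult nn_integral_cmult)
    qed simp
  qed
  \<comment> \<open>In place of the substitution v = l^s, exp(-l^s) is written as the integral of
    exp(-v) over v \<ge> l^s. After a second exchange the inner integral, over l \<le> v^(1/s), is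
    that of a pure power.\<close>
  also have "\<dots> = (\<integral>\<^sup>+l. \<integral>\<^sup>+v. ennreal (indicator {0..} l * l powr (a - 1) * (indicator {l powr s..} v * exp (- v))) \<partial>lborel \<partial>lborel)"
    by (intro nn_integral_cong nn_integral_cmult_exp_tail[symmetric]) simp
  also have "\<dots> = (\<integral>\<^sup>+v. \<integral>\<^sup>+l. ennreal (indicator {0..} l * l powr (a - 1) * (indicator {l powr s..} v * exp (- v))) \<partial>lborel \<partial>lborel)"
    by (intro lborel_pair.Fubini'[symmetric]) (simp add: indicator_def, measurable)
  also have "\<dots> = (\<integral>\<^sup>+v. ennreal (indicator {0..} v * v powr ((a / s + 1) - 1) / exp v) * ennreal (1 / a) \<partial>lborel)"
  proof (intro nn_integral_cong)
    fix v :: real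
    have eq: "indicator {0..} l * l powr (a - 1) * (indicator {l powr s..} v * exp (- v))
        = (indicator {0..} v * exp (- v)) * (indicator {0..v powr (1 / s)} l * l powr (a - 1))" for l :: real
    proof -
      have "l powr s \<le> v \<longleftrightarrow> l \<le> v powr (1 / s)" if "l \<ge> 0" "v \<ge> 0"
        using that s powr_mono2[of "1 / s" "l powr s" v] powr_mono2[of s l "v powr (1 / s)"]
        by (auto simp: powr_powr)
      moreover have "v \<ge> 0" if "l powr s \<le> v" using that powr_ge_zero[of l s] by linarith
      ultimately show ?thesis by (auto split: split_indicator)
    qed
    have "(\<integral>\<^sup>+l. ennreal (indicator {0..} l * l powr (a - 1) * (indicator {l powr s..} v * exp (- v))) \<partial>lborel)
        = ennreal (indicator {0..} v * exp (- v)) * ennreal ((v powr (1 / s)) powr a / a)"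
      unfolding eq using a
      by (subst nn_integral_ennreal_cmult) (simp_all add: nn_integral_powr_from_0)
    also have "\<dots> = ennreal (indicator {0..} v * v powr ((a / s + 1) - 1) / exp v) * ennreal (1 / a)"
      using a s by (auto simp: ennreal_mult'[symmetric] powr_powr exp_minus field_simps split: split_indicator)
    finally show "(\<integral>\<^sup>+l. ennreal (indicator {0..} l * l powr (a - 1) * (indicator {l powr s..} v * exp (- v))) \<partial>lborel) = \<dots>" .
  qed
  also have "\<dots> = ennreal (Gamma (a / s + 1)) * ennreal (1 / a)"
    using a s by (simp add: nn_integral_multc Gamma_conv_nn_integral_real add_pos_pos)
  finally have "ennreal (1 / Gamma a) * (ennreal (Gamma a) * (\<integral>\<^sup>+x. ennreal (x powr (- a)) \<partial>?M)) =
     ennreal (1 / Gamma a) * (ennreal (Gamma (a / s + 1)) * ennreal (1 / a))" by simp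
  moreover have "ennreal (1 / Gamma a) * (ennreal (Gamma a) * X) = X" for X
    using Gpos by (simp add: mult.assoc[symmetric] ennreal_mult[symmetric] less_imp_le)
  moreover have "ennreal (1 / Gamma a) * (ennreal (Gamma (a / s + 1)) * ennreal (1 / a)) = ennreal (Gamma (a / s + 1) / Gamma (a + 1))"
  proof -
    have "Gamma (a + 1) = a * Gamma a" by (rule Gamma_real_plus1[OF a])
    moreover have "Gamma (a / s + 1) > 0" using a s by (intro Gamma_real_pos add_pos_pos) auto
    ultimately show ?thesis using a Gpos by (simp add: ennreal_mult[symmetric] less_imp_le mult_ac)
  qed
  ultimately show ?thesis by simp
qed

section \<open>Mittag-Leffler functions as Laplace transforms\<close>

text \<open>Only the part of Euler's integral over [R, R + 1] is kept. Since R is free, Gamma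
  outgrows every geometric sequence.\<close>

lemma Gamma_lower_bound:
  assumes x: "x > 0" and R: "R > (0::real)"
  shows "R powr x / ((R + 1) * exp (R + 1)) \<le> Gamma x"
proof -
  let ?c = "R powr x / ((R + 1) * exp (R + 1))"
  have "ennreal ?c = (\<integral>\<^sup>+t. ennreal ?c * indicator {R..R + 1} t \<partial>lborel)"
    using R by (simp add: nn_integral_cmult)
  also have "\<dots> \<le> (\<integral>\<^sup>+t. ennreal (indicator {0..} t * t powr (x - 1) / exp t) \<partial>lborel)"
  proof (intro nn_integral_mono)
    fix t :: real
    show "ennreal ?c * indicator {R..R + 1} t \<le> ennreal (indicator {0..} t * t powr (x - 1) / exp t)"
    proof (cases "t \<in> {R..R + 1}")
      case True
      have "?c \<le> t powr x / (t * exp t)"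
        using True R x by (intro frac_le powr_mono2 mult_mono) auto
      also have "\<dots> = t powr (x - 1) / exp t" using True R by (simp add: powr_diff)
      finally show ?thesis using True R by (simp add: ennreal_leI)
    qed simp
  qed
  also have "\<dots> = ennreal (Gamma x)" by (rule Gamma_conv_nn_integral_real[OF x, symmetric])
  finally show ?thesis using x by (simp add: less_imp_le)
qed

lemma summable_mittag_leffler:
  assumes a: "a > 0" and b: "b > (0::real)"
  shows "summable (\<lambda>k. z ^ k / Gamma (a * real k + b))"
proof -
  \<comment> \<open>With R^a = 2|z| + 1 the denominators grow at least like (2|z| + 1)^k, which
    leaves a geometric series of ratio below 1/2.\<close>
  define R where "R = (2 * \<bar>z\<bar> + 1) powr (1 / a)"
  have R: "R > 0" and Ra: "R powr a = 2 * \<bar>z\<bar> + 1" using a by (simp_all add: R_def powr_powr add_nonneg_pos)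
  define C where "C = (R + 1) * exp (R + 1) / R powr b"
  define r where "r = \<bar>z\<bar> / (2 * \<bar>z\<bar> + 1)"
  have r: "0 \<le> r" "r < 1" by (auto simp: r_def divide_simps)
  show ?thesis
  proof (rule summable_comparison_test')
    show "summable (\<lambda>k. C * r ^ k)" using r by (intro summable_mult summable_geometric) auto
    fix k :: nat assume "k \<ge> 0"
    have ap: "a * real k + b > 0" using a b by (simp add: add_nonneg_pos)
    have "R powr (a * real k + b) = (2 * \<bar>z\<bar> + 1) ^ k * R powr b"
      using R by (simp add: powr_add powr_powr[symmetric] Ra powr_realpow)
    hence G: "(2 * \<bar>z\<bar> + 1) ^ k * R powr b / ((R + 1) * exp (R + 1)) \<le> Gamma (a * real k + b)"
      using Gamma_lower_bound[OF ap R] by simp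
    have "norm (z ^ k / Gamma (a * real k + b)) = \<bar>z\<bar> ^ k / Gamma (a * real k + b)"
      using ap by (simp add: power_abs less_imp_le)
    also have "\<dots> \<le> \<bar>z\<bar> ^ k / ((2 * \<bar>z\<bar> + 1) ^ k * R powr b / ((R + 1) * exp (R + 1)))"
      using R by (intro divide_left_mono[OF G] mult_pos_pos divide_pos_pos Gamma_real_pos ap) auto
    also have "\<dots> = C * r ^ k" by (simp add: C_def r_def power_divide mult_ac)
    finally show "norm (z ^ k / Gamma (a * real k + b)) \<le> C * r ^ k" .
  qed
qed

lemma stable_law_moment:
  assumes a: "0 < a" "a < 1"
  shows "has_bochner_integral (stable_law a) (\<lambda>x. x powr (- (a * real k))) (fact k / Gamma (a * real k + 1))"
proof -
  interpret M: real_distribution "stable_law a" by (rule real_distribution_stable_law[OF a])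
  show ?thesis
  proof (cases "k = 0")
    \<comment> \<open>The formula for negative moments needs a positive exponent. Moreover
      \<open>x powr 0\<close> is 1 only off x = 0, hence the equality almost everywhere.\<close>
    case True
    have "has_bochner_integral (stable_law a) (\<lambda>x. 1::real) 1"
      using M.prob_space by (simp add: has_bochner_integral_iff)
    moreover have "AE x in stable_law a. x powr 0 = (1::real)" using stable_law_pos[OF a] by eventually_elim simp
    ultimately show ?thesis using True
      by (subst has_bochner_integral_cong_AE[of _ _ "\<lambda>_. 1"]) (auto elim!: eventually_mono)
  next
    case False
    have "(\<integral>\<^sup>+x. ennreal (x powr (- (a * real k))) \<partial>stable_law a) = ennreal (fact k / Gamma (a * real k + 1))"
      using stable_law_neg_moment[OF a, of "a * real k"] a False by (simp add: Gamma_fact[symmetric] add.commute)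
    moreover have "a * real k + 1 > 0" using a by (simp add: add_nonneg_pos)
    ultimately show ?thesis
      by (intro has_bochner_integral_nn_integral) (auto simp: less_imp_le)
  qed
qed

text \<open>The exponential is expanded and integrated term by term against the known moments. The
  power j serves both Mittag-Leffler functions: j = 0 leads to the second index 1, j = 1 to the
  second index a.\<close>

lemma stable_law_powr_exp_series:
  fixes z :: real and j :: nat
  assumes a: "0 < a" "a < 1"
  defines "c \<equiv> (\<lambda>k. (- z) ^ k / fact k * (fact (k + j) / Gamma (a * real (k + j) + 1)))"
  assumes sm: "summable (\<lambda>k. \<bar>c k\<bar>)"
  shows "integrable (stable_law a) (\<lambda>x. x powr (- (a * real j)) * exp (- (z * x powr (- a))))"
    and "(\<integral>x. x powr (- (a * real j)) * exp (- (z * x powr (- a))) \<partial>stable_law a) = (\<Sum>k. c k)"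
proof -
  let ?M = "stable_law a"
  interpret M: real_distribution ?M by (rule real_distribution_stable_law[OF a])
  define f where "f k x = (- z) ^ k / fact k * x powr (- (a * real (k + j)))" for k x
  have hb: "has_bochner_integral ?M (f k) (c k)" for k
    unfolding f_def c_def by (intro has_bochner_integral_mult_right stable_law_moment[OF a])
  have "has_bochner_integral ?M (\<lambda>x. norm (f k x)) \<bar>c k\<bar>" for k
  proof -
    have "norm (f k x) = \<bar>(- z) ^ k / fact k\<bar> * x powr (- (a * real (k + j)))" for x
      by (simp add: f_def abs_mult)
    moreover have "\<bar>c k\<bar> = \<bar>(- z) ^ k / fact k\<bar> * (fact (k + j) / Gamma (a * real (k + j) + 1))"
      using a unfolding c_def abs_mult by (simp add: add_nonneg_pos Gamma_real_pos less_imp_le abs_of_pos del: of_nat_add)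
    ultimately show ?thesis
      by (simp only:) (intro has_bochner_integral_mult_right stable_law_moment[OF a])
  qed
  hence nrm: "(\<integral>x. norm (f k x) \<partial>?M) = \<bar>c k\<bar>" for k by (rule has_bochner_integral_integral_eq)
  have fs: "(\<lambda>k. f k x) sums (x powr (- (a * real j)) * exp (- (z * x powr (- a))))"
    and fn: "summable (\<lambda>k. norm (f k x))" if x: "x > 0" for x
  proof -
    have eq: "f k x = x powr (- (a * real j)) * ((- (z * x powr (- a))) ^ k /\<^sub>R fact k)" for k
    proof -
      have "x powr (- (a * real (k + j))) = x powr (- (a * real j)) * (x powr (- a)) ^ k"
        using x by (simp add: powr_realpow[symmetric] powr_powr powr_add[symmetric] algebra_simps)
      thus ?thesis by (simp add: f_def power_minus[of "z * _"] power_minus[of z] power_mult_distrib field_simps)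
    qed
    show "(\<lambda>k. f k x) sums (x powr (- (a * real j)) * exp (- (z * x powr (- a))))"
      unfolding eq by (intro sums_mult exp_converges)
    show "summable (\<lambda>k. norm (f k x))"
      unfolding eq norm_mult by (intro summable_mult summable_norm_exp)
  qed
  have i: "integrable ?M (f k)" for k using hb by (auto simp: has_bochner_integral_iff)
  have ae: "AE x in ?M. summable (\<lambda>k. norm (f k x))"
    using stable_law_pos[OF a] by eventually_elim (rule fn)
  have sn: "summable (\<lambda>k. \<integral>x. norm (f k x) \<partial>?M)" unfolding nrm by (rule sm)
  have AEeq: "AE x in ?M. (\<Sum>k. f k x) = x powr (- (a * real j)) * exp (- (z * x powr (- a)))"
    using stable_law_pos[OF a] by eventually_elim (use fs in \<open>simp add: sums_iff\<close>)
  have "integrable ?M (\<lambda>x. \<Sum>k. f k x)" by (rule integrable_suminf[OF i ae sn])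
  thus "integrable ?M (\<lambda>x. x powr (- (a * real j)) * exp (- (z * x powr (- a))))"
    by (rule integrable_cong_AE_imp) (use AEeq in \<open>auto elim!: eventually_mono\<close>)
  have "(\<integral>x. x powr (- (a * real j)) * exp (- (z * x powr (- a))) \<partial>?M) = (\<integral>x. (\<Sum>k. f k x) \<partial>?M)"
    using AEeq i by (intro integral_cong_AE) (auto elim!: eventually_mono)
  also have "\<dots> = (\<Sum>k. \<integral>x. f k x \<partial>?M)" by (rule integral_suminf[OF i ae sn])
  also have "\<dots> = (\<Sum>k. c k)" using hb by (simp add: has_bochner_integral_iff)
  finally show "(\<integral>x. x powr (- (a * real j)) * exp (- (z * x powr (- a))) \<partial>?M) = (\<Sum>k. c k)" .
qed

lemma stable_law_mittag_leffler_1: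
  assumes a: "0 < a" "a < 1"
  shows "integrable (stable_law a) (\<lambda>x. exp (- (z * x powr (- a))))" (is ?I)
    and "(\<integral>x. exp (- (z * x powr (- a))) \<partial>stable_law a) = mittag_leffler a 1 (- z)" (is ?E)
proof -
  interpret M: real_distribution "stable_law a" by (rule real_distribution_stable_law[OF a])
  have eq: "(- z) ^ k / fact k * (fact (k + 0) / Gamma (a * real (k + 0) + 1)) = (- z) ^ k / Gamma (a * real k + 1)" for k
    by simp
  have "summable (\<lambda>k. \<bar>(- z) ^ k / Gamma (a * real k + 1)\<bar>)"
  proof -
    have "\<bar>(- z) ^ k / Gamma (a * real k + 1)\<bar> = \<bar>z\<bar> ^ k / Gamma (a * real k + 1)" for k
      using a by (simp add: power_abs add_nonneg_pos Gamma_real_pos less_imp_le)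
    thus ?thesis using summable_mittag_leffler[of a 1 "\<bar>z\<bar>"] a by simp
  qed
  note * = stable_law_powr_exp_series[OF a, where j = 0 and z = z, unfolded eq, OF this]
  have ae: "AE x in stable_law a. x powr (- (a * real 0)) * exp (- (z * x powr (- a))) = exp (- (z * x powr (- a)))"
    using stable_law_pos[OF a] by eventually_elim simp
  show ?I by (rule integrable_cong_AE_imp[OF *(1)]) (use ae in \<open>auto elim!: eventually_mono\<close>)
  have "(\<integral>x. exp (- (z * x powr (- a))) \<partial>stable_law a) = (\<integral>x. x powr (- (a * real 0)) * exp (- (z * x powr (- a))) \<partial>stable_law a)"
    by (rule integral_cong_AE) (use ae in \<open>auto elim!: eventually_mono\<close>)
  thus ?E unfolding *(2) mittag_leffler_def by simp
qed

lemma stable_law_mittag_leffler_self: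
  assumes a: "0 < a" "a < 1"
  shows "integrable (stable_law a) (\<lambda>x. a * x powr (- a) * exp (- (z * x powr (- a))))" (is ?I)
    and "(\<integral>x. a * x powr (- a) * exp (- (z * x powr (- a))) \<partial>stable_law a) = mittag_leffler a a (- z)" (is ?E)
proof -
  interpret M: real_distribution "stable_law a" by (rule real_distribution_stable_law[OF a])
  \<comment> \<open>The factor k + 1 left by the factorials cancels against Gamma(a (k + 1) + 1) = a
    (k + 1) Gamma(a k + a). The remaining 1/a is compensated by the factor a in the weight a
    x^(-a).\<close>
  have eq: "(- z) ^ k / fact k * (fact (k + 1) / Gamma (a * real (k + 1) + 1)) = ((- z) ^ k / Gamma (a * real k + a)) / a" for k
  proof -
    have p: "a * real k + a > 0" using a by (simp add: add_nonneg_pos)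
    have "Gamma (a * real (k + 1) + 1) = (a * real k + a) * Gamma (a * real k + a)"
      using Gamma_real_plus1[OF p] by (simp add: algebra_simps)
    also have "a * real k + a = a * real (k + 1)" by (simp add: algebra_simps)
    finally show ?thesis using a by (simp add: divide_simps) (simp add: algebra_simps)
  qed
  have sm: "summable (\<lambda>k. \<bar>((- z) ^ k / Gamma (a * real k + a)) / a\<bar>)"
  proof -
    have "\<bar>((- z) ^ k / Gamma (a * real k + a)) / a\<bar> = (\<bar>z\<bar> ^ k / Gamma (a * real k + a)) / a" for k
      using a by (simp add: power_abs add_nonneg_pos Gamma_real_pos less_imp_le)
    thus ?thesis using summable_divide[OF summable_mittag_leffler[of a a "\<bar>z\<bar>"], of a] a by simp
  qed
  note * = stable_law_powr_exp_series[OF a, where j = 1 and z = z, unfolded eq, OF sm]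
  show ?I using integrable_mult_right[OF *(1), of a] by (simp add: mult_ac)
  have "(\<integral>x. a * x powr (- a) * exp (- (z * x powr (- a))) \<partial>stable_law a) = a * (\<Sum>k. ((- z) ^ k / Gamma (a * real k + a)) / a)"
    using *(2) integral_mult_right_zero[of "stable_law a" a "\<lambda>x. x powr (- (a * real 1)) * exp (- (z * x powr (- a)))"]
    by (simp add: mult_ac)
  also have "\<dots> = mittag_leffler a a (- z)"
    unfolding mittag_leffler_def using a summable_mittag_leffler[of a a "- z"] by (subst suminf_divide) auto
  finally show ?E .
qed

section \<open>The heat kernel and injectivity of the Fourier transform\<close>

definition heat_kernel :: "real \<Rightarrow> 'a::euclidean_space \<Rightarrow> real" where
  "heat_kernel \<tau> x = (4 * pi * \<tau>) powr (- (DIM('a) / 2)) * exp (- (norm x)\<^sup>2 / (4 * \<tau>))"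

lemma heat_kernel_nonneg [simp]: "0 \<le> heat_kernel \<tau> x"
  by (simp add: heat_kernel_def)

lemma heat_kernel_measurable [measurable]:
  "(\<lambda>z. heat_kernel (f z) (g z)) \<in> borel_measurable M"
  if "f \<in> borel_measurable M" "g \<in> M \<rightarrow>\<^sub>M borel"
  using that unfolding heat_kernel_def by measurable

lemma norm_square_Basis: "(norm x)\<^sup>2 = (\<Sum>b\<in>Basis. (x \<bullet> b)\<^sup>2)" for x :: "'a::euclidean_space"
  unfolding power2_norm_eq_inner by (subst euclidean_inner) (simp add: power2_eq_square)

lemma heat_kernel_prod:
  assumes "\<tau> > 0"
  shows "heat_kernel \<tau> x = (\<Prod>b\<in>Basis. normal_density 0 (sqrt (2 * \<tau>)) (x \<bullet> b))"
proof -
  have "(\<Prod>b\<in>Basis. normal_density 0 (sqrt (2 * \<tau>)) (x \<bullet> b)) =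
     (1 / sqrt (4 * pi * \<tau>)) ^ DIM('a) * exp (\<Sum>b\<in>Basis. - ((x \<bullet> b)\<^sup>2) / (4 * \<tau>))"
    using assms by (simp add: normal_density_def exp_sum prod.distrib mult_ac power_divide prod_dividef)
  also have "(\<Sum>b\<in>Basis. - ((x \<bullet> b)\<^sup>2) / (4 * \<tau>)) = - (norm x)\<^sup>2 / (4 * \<tau>)"
    by (simp only: sum_divide_distrib[symmetric] sum_negf norm_square_Basis)
  also have "(1 / sqrt (4 * pi * \<tau>)) ^ DIM('a) = (4 * pi * \<tau>) powr (- (DIM('a) / 2))"
  proof -
    have "1 / sqrt (4 * pi * \<tau>) = (4 * pi * \<tau>) powr (- (1 / 2))"
      using assms by (simp add: powr_minus powr_half_sqrt field_simps)
    hence "(1 / sqrt (4 * pi * \<tau>)) ^ DIM('a) = ((4 * pi * \<tau>) powr (- (1 / 2))) powr real DIM('a)"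
      using assms by (simp add: powr_realpow)
    thus ?thesis by (simp add: powr_powr)
  qed
  finally show ?thesis by (simp add: heat_kernel_def)
qed

lemma nn_integral_heat_kernel:
  assumes "\<tau> > 0"
  shows "(\<integral>\<^sup>+x. ennreal (heat_kernel \<tau> (x::'a::euclidean_space)) \<partial>lborel) = 1"
proof -
  have 1: "(\<integral>\<^sup>+y. ennreal (normal_density 0 (sqrt (2 * \<tau>)) y) \<partial>lborel) = 1"
    using prob_space.emeasure_space_1[OF prob_space_normal_density[of "sqrt (2 * \<tau>)" 0]] assms
    by (simp add: emeasure_density)
  have "(\<integral>\<^sup>+x. ennreal (heat_kernel \<tau> (x::'a)) \<partial>lborel) =
      (\<integral>\<^sup>+x. (\<Prod>b\<in>Basis. ennreal (normal_density 0 (sqrt (2 * \<tau>)) ((x::'a) \<bullet> b))) \<partial>lborel)"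
    using assms by (simp add: heat_kernel_prod prod_ennreal)
  also have "\<dots> = 1"
    using nn_integral_lborel_prod[of "\<lambda>_::'a. \<lambda>y. ennreal (normal_density 0 (sqrt (2 * \<tau>)) y)"]
    by (simp add: 1)
  finally show ?thesis .
qed

lemma integrable_heat_kernel: "\<tau> > 0 \<Longrightarrow> integrable lborel (heat_kernel \<tau>)"
  by (intro integrableI_nonneg) (auto simp: nn_integral_heat_kernel)

lemma integral_heat_kernel: "\<tau> > 0 \<Longrightarrow> (\<integral>x. heat_kernel \<tau> x \<partial>lborel) = 1"
  by (subst integral_eq_nn_integral) (auto simp: nn_integral_heat_kernel)

text \<open>The r-th power of the heat kernel at time \<tau> is a multiple of the heat kernel at
  time \<tau>/r, so the integral equals the factor \<open>c\<close>. A remaining r^(-N/2) \<le> 1 is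
  dropped.\<close>

lemma nn_integral_heat_kernel_powr:
  fixes r \<tau> :: real
  assumes "\<tau> > 0" "r \<ge> 1"
  shows "(\<integral>\<^sup>+x. ennreal (heat_kernel \<tau> (x::'a::euclidean_space) powr r) \<partial>lborel)
     \<le> ennreal (((4 * pi * \<tau>) powr (- (DIM('a) / 2 * (1 - 1 / r)))) powr r)"
proof -
  define N where "N = real DIM('a)"
  define c where "c = (4 * pi * \<tau>) powr (- (N / 2) * r) * (4 * pi * (\<tau> / r)) powr (N / 2)"
  have eq: "heat_kernel \<tau> x powr r = c * heat_kernel (\<tau> / r) x" for x :: 'a
  proof -
    have "c * (4 * pi * (\<tau> / r)) powr (- (N / 2)) = (4 * pi * \<tau>) powr (- (N / 2) * r)"
      using assms by (simp add: c_def mult.assoc powr_add[symmetric])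
    moreover have "heat_kernel \<tau> x powr r = (4 * pi * \<tau>) powr (- (N / 2) * r) * exp (- (norm x)\<^sup>2 / (4 * \<tau>) * r)"
      unfolding heat_kernel_def N_def[symmetric] using assms by (simp only: powr_mult powr_ge_zero exp_ge_zero powr_powr exp_powr_real)
    moreover have "- (norm x)\<^sup>2 / (4 * (\<tau> / r)) = - (norm x)\<^sup>2 / (4 * \<tau>) * r" using assms by simp
    ultimately show ?thesis
      unfolding heat_kernel_def N_def[symmetric] by (simp only: mult.assoc[symmetric])
  qed
  have "(\<integral>\<^sup>+x. ennreal (heat_kernel \<tau> (x::'a) powr r) \<partial>lborel) = ennreal c"
    unfolding eq using assms nn_integral_heat_kernel[of "\<tau> / r", where 'a = 'a]
    by (subst nn_integral_ennreal_cmult) (auto simp: c_def)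
  also have "c \<le> (4 * pi * \<tau>) powr (- (N / 2) * r) * (4 * pi * \<tau>) powr (N / 2)"
    using assms unfolding c_def N_def
    by (intro mult_left_mono powr_mono2) (auto simp: field_simps)
  also have "\<dots> = ((4 * pi * \<tau>) powr (- (N / 2 * (1 - 1 / r)))) powr r"
  proof -
    have "- (N / 2) * r + N / 2 = - (N / 2 * (1 - 1 / r)) * r" using assms by (simp add: field_simps)
    thus ?thesis by (simp only: powr_powr powr_add[symmetric])
  qed
  finally show ?thesis by (simp add: N_def ennreal_leI)
qed

section \<open>Fourier transform of the heat kernel\<close>

text \<open>Rescaling by the standard deviation reduces this to the characteristic function of the
  standard normal law.\<close>

lemma fourier_normal_density:
  fixes \<tau> t :: real
  assumes "\<tau> > 0"
  shows "(\<integral>y. exp (- (\<i> * complex_of_real (y * t))) * complex_of_real (normal_density 0 (sqrt (2 * \<tau>)) y) \<partial>lborel)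
      = complex_of_real (exp (- (\<tau> * t\<^sup>2)))"
proof -
  define c where "c = sqrt (2 * \<tau>)"
  have c: "c > 0" using assms by (simp add: c_def)
  have "(\<integral>y. exp (- (\<i> * complex_of_real (y * t))) * complex_of_real (normal_density 0 c y) \<partial>lborel)
     = \<bar>c\<bar> *\<^sub>R (\<integral>x. exp (- (\<i> * complex_of_real ((0 + c * x) * t))) * complex_of_real (normal_density 0 c (0 + c * x)) \<partial>lborel)"
    using c by (intro lborel_integral_real_affine) auto
  also have "\<dots> = (\<integral>x. c *\<^sub>R (exp (- (\<i> * complex_of_real ((0 + c * x) * t))) * complex_of_real (normal_density 0 c (0 + c * x))) \<partial>lborel)"
    using c by simp
  also have "\<dots> = (\<integral>x. std_normal_density x *\<^sub>R iexp (- (c * t) * x) \<partial>lborel)"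
  proof (intro Bochner_Integration.integral_cong refl)
    fix x :: real
    have "c * normal_density 0 c (c * x) = std_normal_density x"
      using c by (simp add: normal_density_def real_sqrt_mult power_mult_distrib)
    hence "complex_of_real c * complex_of_real (normal_density 0 c (c * x)) = complex_of_real (std_normal_density x)"
      by (metis of_real_mult)
    thus "c *\<^sub>R (exp (- (\<i> * complex_of_real ((0 + c * x) * t))) * complex_of_real (normal_density 0 c (0 + c * x)))
       = std_normal_density x *\<^sub>R iexp (- (c * t) * x)"
      by (simp add: scaleR_conv_of_real mult_ac)
  qed
  also have "\<dots> = char std_normal_distribution (- (c * t))"
    unfolding char_def by (subst integral_density) (auto simp: complex_eq_iff)
  also have "\<dots> = complex_of_real (exp (- (\<tau> * t\<^sup>2)))"
    using assms by (simp add: char_std_normal_distribution c_def power_mult_distrib)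
  finally show ?thesis by (simp add: c_def)
qed

lemma fourier_heat_kernel:
  fixes \<xi> :: "'a::euclidean_space"
  assumes "\<tau> > 0"
  shows "fourier (heat_kernel \<tau>) \<xi> = complex_of_real (exp (- (\<tau> * (norm \<xi>)\<^sup>2)))"
proof -
  interpret product_sigma_finite "\<lambda>_::'a. lborel :: real measure" ..
  define g where "g b y = exp (- (\<i> * complex_of_real (y * (b \<bullet> \<xi>)))) * complex_of_real (normal_density 0 (sqrt (2 * \<tau>)) y)" for b y
  have fg: "exp (- (\<i> * complex_of_real ((\<Sum>b\<in>Basis. f b *\<^sub>R b) \<bullet> \<xi>))) * complex_of_real (heat_kernel \<tau> (\<Sum>b\<in>Basis. f b *\<^sub>R b))
     = (\<Prod>b\<in>Basis. g b (f b))" for f :: "'a \<Rightarrow> real"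
  proof -
    have "(\<Sum>b\<in>Basis. f b *\<^sub>R b) \<bullet> b' = f b'" if "b' \<in> Basis" for b'
      using that by (simp add: inner_sum_left inner_Basis if_distrib cong: if_cong)
    hence "heat_kernel \<tau> (\<Sum>b\<in>Basis. f b *\<^sub>R b) = (\<Prod>b\<in>Basis. normal_density 0 (sqrt (2 * \<tau>)) (f b))"
      using assms by (simp add: heat_kernel_prod)
    moreover have "exp (- (\<i> * complex_of_real ((\<Sum>b\<in>Basis. f b *\<^sub>R b) \<bullet> \<xi>))) = (\<Prod>b\<in>Basis. exp (- (\<i> * complex_of_real (f b * (b \<bullet> \<xi>)))))"
      by (simp add: exp_sum[symmetric] inner_sum_left sum_negf sum_distrib_left)
    ultimately show ?thesis by (simp add: g_def prod.distrib)
  qed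
  have [measurable]: "g b \<in> borel_measurable borel" for b unfolding g_def[abs_def] by measurable
  have int: "integrable lborel (g b)" for b
  proof (rule Bochner_Integration.integrable_bound)
    show "integrable lborel (normal_density 0 (sqrt (2 * \<tau>)))" using assms by (intro integrable_normal_density) auto
    show "AE y in lborel. norm (g b y) \<le> norm (normal_density 0 (sqrt (2 * \<tau>)) y)"
      by (auto simp: g_def norm_mult)
  qed (auto simp: g_def)
  have "fourier (heat_kernel \<tau>) \<xi> = (\<integral>f. exp (- (\<i> * complex_of_real ((\<Sum>b\<in>Basis. f b *\<^sub>R b) \<bullet> \<xi>))) *
      complex_of_real (heat_kernel \<tau> (\<Sum>b\<in>Basis. f b *\<^sub>R b)) \<partial>(\<Pi>\<^sub>M b\<in>Basis. lborel))"
    unfolding fourier_def by (subst lborel_eq, subst integral_distr) auto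
  also have "\<dots> = (\<Prod>b\<in>Basis. \<integral>y. g b y \<partial>lborel)"
    unfolding fg by (intro product_integral_prod int) auto
  also have "\<dots> = (\<Prod>b\<in>Basis. complex_of_real (exp (- (\<tau> * (b \<bullet> \<xi>)\<^sup>2))))"
    unfolding g_def fourier_normal_density[OF assms] by simp
  also have "\<dots> = complex_of_real (exp (\<Sum>b\<in>Basis. - (\<tau> * (b \<bullet> \<xi>)\<^sup>2)))"
    by (simp add: exp_sum)
  also have "(\<Sum>b\<in>Basis. - (\<tau> * (b \<bullet> \<xi>)\<^sup>2)) = - (\<tau> * (norm \<xi>)\<^sup>2)"
    by (simp only: sum_distrib_left[symmetric] sum_negf norm_square_Basis inner_commute)
  finally show ?thesis .
qed

section \<open>Uniqueness theorem for the Fourier transform\<close>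

text \<open>Up to the constant \<open>c\<close>, the heat kernel is itself a Fourier transform,
  namely that of the heat kernel at time 1/(4 \<tau>). Fubini moves the transform onto h, where it
  vanishes.\<close>

lemma fourier_zero_heat_convolution:
  fixes h :: "'a::euclidean_space \<Rightarrow> real"
  assumes h: "integrable lborel h" and F: "\<And>\<xi>. fourier h \<xi> = 0" and \<tau>: "\<tau> > 0"
  shows "(\<integral>x. h x * heat_kernel \<tau> (y - x) \<partial>lborel) = 0"
proof -
  define k :: "'a \<Rightarrow> real" where "k = heat_kernel (1 / (4 * \<tau>))"
  have k: "integrable lborel k" unfolding k_def using \<tau> by (intro integrable_heat_kernel) auto
  have [measurable]: "h \<in> borel_measurable borel" "k \<in> borel_measurable borel" using h k by auto
  let ?F = "\<lambda>x \<xi>. complex_of_real (h x) * (exp (- (\<i> * complex_of_real (\<xi> \<bullet> (y - x)))) * complex_of_real (k \<xi>))"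
  define c where "c = (4 * pi * \<tau>) powr (- (DIM('a) / 2))"
  have hk: "complex_of_real (heat_kernel \<tau> z) = c * fourier k z" for z :: 'a
    unfolding k_def using \<tau> by (subst fourier_heat_kernel) (auto simp: heat_kernel_def c_def)
  have int: "integrable (lborel \<Otimes>\<^sub>M lborel) (\<lambda>(x, \<xi>). ?F x \<xi>)"
  proof (rule Bochner_Integration.integrable_bound)
    show "integrable (lborel \<Otimes>\<^sub>M lborel) (\<lambda>(x, \<xi>). h x * k \<xi>)"
      using h k by (intro lborel_pair.Fubini_integrable) (auto simp: abs_mult)
  qed (auto simp: norm_mult)
  have "complex_of_real (\<integral>x. h x * heat_kernel \<tau> (y - x) \<partial>lborel) = (\<integral>x. complex_of_real (h x) * (c * fourier k (y - x)) \<partial>lborel)"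
    by (simp add: integral_complex_of_real[symmetric] hk[symmetric] del: integral_complex_of_real)
  also have "\<dots> = c * (\<integral>x. \<integral>\<xi>. ?F x \<xi> \<partial>lborel \<partial>lborel)"
    by (simp add: fourier_def mult.left_commute)
  also have "(\<integral>x. \<integral>\<xi>. ?F x \<xi> \<partial>lborel \<partial>lborel)
     = (\<integral>\<xi>. \<integral>x. ?F x \<xi> \<partial>lborel \<partial>lborel)"
    using int by (rule lborel_pair.Fubini_integral[symmetric])
  also have "\<dots> = (\<integral>\<xi>. (exp (- (\<i> * complex_of_real (\<xi> \<bullet> y))) * complex_of_real (k \<xi>)) * fourier h (- \<xi>) \<partial>(lborel :: 'a measure))"
  proof (intro Bochner_Integration.integral_cong refl)
    fix \<xi> :: 'a
    have "?F x \<xi>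
        = (exp (- (\<i> * complex_of_real (\<xi> \<bullet> y))) * complex_of_real (k \<xi>)) * (exp (- (\<i> * complex_of_real (x \<bullet> (- \<xi>)))) * complex_of_real (h x))" for x
      by (simp add: inner_diff_right exp_add[symmetric] algebra_simps inner_commute)
    thus "(\<integral>x. ?F x \<xi> \<partial>lborel)
       = (exp (- (\<i> * complex_of_real (\<xi> \<bullet> y))) * complex_of_real (k \<xi>)) * fourier h (- \<xi>)"
      unfolding fourier_def by (simp only: integral_mult_right_zero)
  qed
  also have "\<dots> = 0" by (simp add: F)
  finally show ?thesis by simp
qed

lemma heat_kernel_scale:
  fixes x z :: "'a::euclidean_space"
  assumes e: "e > 0"
  shows "e ^ DIM('a) * heat_kernel (e\<^sup>2) (e *\<^sub>R z) = heat_kernel 1 z"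
proof -
  have "e ^ DIM('a) * (4 * pi * e\<^sup>2) powr (- (DIM('a) / 2)) = (4 * pi) powr (- (DIM('a) / 2))"
  proof -
    have "(e\<^sup>2) powr (- (DIM('a) / 2)) = e powr (- real DIM('a))"
      using e by (simp add: powr_powr flip: powr_numeral)
    thus ?thesis using e by (simp add: powr_mult powr_minus powr_realpow)
  qed
  moreover have "(norm (e *\<^sub>R z))\<^sup>2 / (4 * e\<^sup>2) = (norm z)\<^sup>2 / 4"
    using e by (simp add: power_mult_distrib)
  ultimately show ?thesis by (simp add: heat_kernel_def mult.assoc[symmetric])
qed

lemma integral_heat_kernel_shift:
  fixes \<phi> :: "'a::euclidean_space \<Rightarrow> real"
  assumes e: "e > 0" and [measurable]: "\<phi> \<in> borel_measurable borel"
  shows "(\<integral>y. heat_kernel (e\<^sup>2) (y - x) * \<phi> y \<partial>lborel) = (\<integral>z. heat_kernel 1 z * \<phi> (x + e *\<^sub>R z) \<partial>lborel)"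
proof -
  have "(\<integral>y. heat_kernel (e\<^sup>2) (y - x) * \<phi> y \<partial>lborel) =
     (\<integral>y. heat_kernel (e\<^sup>2) (y - x) * \<phi> y \<partial>(density (distr lborel borel (\<lambda>z. x + e *\<^sub>R z)) (\<lambda>_. ennreal (\<bar>e\<bar> ^ DIM('a)))))"
    using e by (subst lborel_affine[of e x]) auto
  also have "\<dots> = (\<integral>z. \<bar>e\<bar> ^ DIM('a) *\<^sub>R (heat_kernel (e\<^sup>2) (x + e *\<^sub>R z - x) * \<phi> (x + e *\<^sub>R z)) \<partial>lborel)"
    by (subst integral_density, simp, simp, simp, subst integral_distr) auto
  also have "\<dots> = (\<integral>z. heat_kernel 1 z * \<phi> (x + e *\<^sub>R z) \<partial>lborel)"
    using e by (intro Bochner_Integration.integral_cong refl) (simp add: heat_kernel_scale[symmetric])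
  finally show ?thesis .
qed

text \<open>Gaussian averages of \<phi> are orthogonal to h, by Fubini and the vanishing
  convolutions. They are bounded by B and tend to \<phi> pointwise, so dominated convergence gives
  the claim.\<close>

lemma fourier_zero_test_function:
  fixes h \<phi> :: "'a::euclidean_space \<Rightarrow> real"
  assumes h: "integrable lborel h" and F: "\<And>\<xi>. fourier h \<xi> = 0"
    and \<phi>: "continuous_on UNIV \<phi>" and B: "\<And>x. \<bar>\<phi> x\<bar> \<le> B"
  shows "(\<integral>x. h x * \<phi> x \<partial>lborel) = 0"
proof -
  have [measurable]: "h \<in> borel_measurable borel" using h by auto
  have [measurable]: "\<phi> \<in> borel_measurable borel" using \<phi> by (rule borel_measurable_continuous_onI)
  have B0: "B \<ge> 0" using B[of 0] by linarith
  define \<epsilon> where "\<epsilon> n = 1 / real (Suc n)" for n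
  have \<epsilon>: "\<epsilon> n > 0" for n by (simp add: \<epsilon>_def)
  have \<epsilon>0: "\<epsilon> \<longlonglongrightarrow> 0" unfolding \<epsilon>_def by (rule LIMSEQ_Suc) (rule lim_1_over_n)
  \<comment> \<open>This form keeps the Gaussian fixed and moves the small parameter into the
    continuous function \<phi>, which makes the pointwise limit a case of dominated
    convergence.\<close>
  define \<phi>n where "\<phi>n n x = (\<integral>z. heat_kernel 1 z * \<phi> (x + \<epsilon> n *\<^sub>R z) \<partial>lborel)" for n x
  have [measurable]: "\<phi>n n \<in> borel_measurable borel" for n
    unfolding \<phi>n_def by (intro lborel.borel_measurable_lebesgue_integral) measurable
  have bound: "\<bar>heat_kernel 1 z * \<phi> x\<bar> \<le> B * heat_kernel 1 z" for x z :: 'a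
    using B[of x] by (simp add: abs_mult mult.commute[of "heat_kernel 1 z"] mult_right_mono)
  have \<phi>n_lim: "(\<lambda>n. \<phi>n n x) \<longlonglongrightarrow> \<phi> x" for x
  proof -
    have "(\<lambda>n. \<phi>n n x) \<longlonglongrightarrow> (\<integral>z. heat_kernel 1 z * \<phi> x \<partial>(lborel :: 'a measure))"
      unfolding \<phi>n_def
    proof (rule integral_dominated_convergence[where w = "\<lambda>z::'a. B * heat_kernel 1 z"])
      show "AE z in lborel. (\<lambda>n. heat_kernel 1 z * \<phi> (x + \<epsilon> n *\<^sub>R z)) \<longlonglongrightarrow> heat_kernel 1 z * \<phi> x"
      proof (intro AE_I2 tendsto_intros)
        fix z :: 'a
        have "(\<lambda>n. x + \<epsilon> n *\<^sub>R z) \<longlonglongrightarrow> x + 0 *\<^sub>R z" by (intro tendsto_intros \<epsilon>0)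
        thus "(\<lambda>n. \<phi> (x + \<epsilon> n *\<^sub>R z)) \<longlonglongrightarrow> \<phi> x"
          by (intro continuous_on_tendsto_compose[OF \<phi>]) auto
      qed
    qed (use bound in \<open>auto simp: integrable_heat_kernel\<close>)
    thus ?thesis by (simp add: integral_heat_kernel)
  qed
  have \<phi>n_bound: "\<bar>\<phi>n n x\<bar> \<le> B" for n x
  proof -
    have Bh: "integrable lborel (\<lambda>z::'a. B * heat_kernel 1 z)" by (simp add: integrable_heat_kernel)
    have "integrable lborel (\<lambda>z. heat_kernel 1 z * \<phi> (x + \<epsilon> n *\<^sub>R z))"
      by (rule Bochner_Integration.integrable_bound[OF Bh]) (use bound B0 in \<open>auto simp: abs_mult\<close>)
    hence "norm (\<phi>n n x) \<le> (\<integral>z. B * heat_kernel 1 z \<partial>(lborel :: 'a measure))"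
      unfolding \<phi>n_def
      by (rule Bochner_Integration.integral_norm_bound_integral[OF _ Bh]) (use bound in simp)
    thus ?thesis by (simp add: integral_heat_kernel)
  qed
  have zero: "(\<integral>x. h x * \<phi>n n x \<partial>lborel) = 0" for n
  proof -
    have eq: "\<phi>n n x = (\<integral>y. heat_kernel ((\<epsilon> n)\<^sup>2) (y - x) * \<phi> y \<partial>lborel)" for x
      unfolding \<phi>n_def by (rule integral_heat_kernel_shift[OF \<epsilon>, symmetric]) simp
    have e2: "(\<epsilon> n)\<^sup>2 > 0" using \<epsilon>[of n] by simp
    have i1: "(\<integral>y. heat_kernel ((\<epsilon> n)\<^sup>2) (y - x) \<partial>lborel) = 1" for x :: 'a
      using integral_heat_kernel_shift[OF \<epsilon>, of "\<lambda>_. 1" n x] by (simp add: integral_heat_kernel)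
    \<comment> \<open>A function that is not integrable has the integral 0 by convention, so the
      value 1 already proves integrability.\<close>
    hence i2: "integrable lborel (\<lambda>y. heat_kernel ((\<epsilon> n)\<^sup>2) (y - x))" for x :: 'a
      using not_integrable_integral_eq by fastforce
    have int: "integrable (lborel \<Otimes>\<^sub>M lborel) (\<lambda>(x, y). h x * (heat_kernel ((\<epsilon> n)\<^sup>2) (y - x) * \<phi> y))"
    proof (rule Bochner_Integration.integrable_bound)
      show "integrable (lborel \<Otimes>\<^sub>M lborel) (\<lambda>(x, y). h x * (heat_kernel ((\<epsilon> n)\<^sup>2) (y - x) * B))"
        using h i1 i2 by (intro lborel_pair.Fubini_integrable) (auto simp: abs_mult)
      show "AE z in lborel \<Otimes>\<^sub>M lborel. norm (case z of (x, y) \<Rightarrow> h x * (heat_kernel ((\<epsilon> n)\<^sup>2) (y - x) * \<phi> y))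
          \<le> norm (case z of (x, y) \<Rightarrow> h x * (heat_kernel ((\<epsilon> n)\<^sup>2) (y - x) * B))"
        using B B0 by (intro AE_I2) (auto simp: abs_mult intro!: mult_left_mono)
    qed measurable
    have "(\<integral>x. h x * \<phi>n n x \<partial>lborel) = (\<integral>x. \<integral>y. h x * (heat_kernel ((\<epsilon> n)\<^sup>2) (y - x) * \<phi> y) \<partial>lborel \<partial>lborel)"
      by (simp add: eq)
    also have "\<dots> = (\<integral>y. \<integral>x. h x * (heat_kernel ((\<epsilon> n)\<^sup>2) (y - x) * \<phi> y) \<partial>lborel \<partial>lborel)"
      using int by (rule lborel_pair.Fubini_integral[symmetric])
    also have "\<dots> = (\<integral>y. \<phi> y * (\<integral>x. h x * heat_kernel ((\<epsilon> n)\<^sup>2) (y - x) \<partial>lborel) \<partial>lborel)"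
      by (simp add: mult_ac flip: integral_mult_right_zero)
    also have "\<dots> = 0" by (simp add: fourier_zero_heat_convolution[OF h F e2])
    finally show ?thesis .
  qed
  have "(\<lambda>n. \<integral>x. h x * \<phi>n n x \<partial>lborel) \<longlonglongrightarrow> (\<integral>x. h x * \<phi> x \<partial>lborel)"
  proof (rule integral_dominated_convergence[where w = "\<lambda>x. B * \<bar>h x\<bar>"])
    show "AE x in lborel. (\<lambda>n. h x * \<phi>n n x) \<longlonglongrightarrow> h x * \<phi> x"
      by (intro AE_I2 tendsto_intros \<phi>n_lim)
    show "AE x in lborel. norm (h x * \<phi>n n x) \<le> B * \<bar>h x\<bar>" for n
      using \<phi>n_bound[of n] by (intro AE_I2) (simp add: abs_mult mult.commute[of B] mult_left_mono)
  qed (use h in auto)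
  thus ?thesis unfolding zero by (simp add: LIMSEQ_const_iff)
qed

text \<open>Indicators of closed sets are pointwise limits of continuous cut-offs built from the
  distance. This is the passage from test functions to a generator of the Borel sets.\<close>

lemma fourier_zero_closed:
  fixes h :: "'a::euclidean_space \<Rightarrow> real"
  assumes h: "integrable lborel h" and F: "\<And>\<xi>. fourier h \<xi> = 0" and A: "closed A"
  shows "(\<integral>x. h x * indicator A x \<partial>lborel) = 0"
proof (cases "A = {}")
  \<comment> \<open>For the empty set \<open>infdist\<close> is 0 by convention, and the cut-offs
    would be constantly 1.\<close>
  case False
  have [measurable]: "h \<in> borel_measurable borel" using h by auto
  define \<phi> where "\<phi> n x = max 0 (1 - real n * infdist x A)" for n x
  have cont: "continuous_on UNIV (\<phi> n)" for n
    unfolding \<phi>_def by (intro continuous_intros)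
  have [measurable]: "\<phi> n \<in> borel_measurable borel" for n
    using cont by (rule borel_measurable_continuous_onI)
  have b: "\<bar>\<phi> n x\<bar> \<le> 1" for n x by (auto simp: \<phi>_def infdist_nonneg)
  have lim: "(\<lambda>n. \<phi> n x) \<longlonglongrightarrow> indicator A x" for x
  proof (cases "x \<in> A")
    case True
    thus ?thesis by (simp add: \<phi>_def)
  next
    case False
    hence d: "infdist x A > 0" using A \<open>A \<noteq> {}\<close> by (simp add: infdist_pos_not_in_closed)
    obtain m :: nat where m: "real m > 1 / infdist x A" using reals_Archimedean2 by blast
    have "\<phi> n x = 0" if "n \<ge> m" for n
    proof -
      have "1 / infdist x A < real n" using m that by linarith
      thus ?thesis using d by (simp add: \<phi>_def field_simps)
    qed
    thus ?thesis using False by (auto intro!: tendsto_eventually eventually_sequentiallyI[of m])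
  qed
  have "(\<lambda>n. \<integral>x. h x * \<phi> n x \<partial>lborel) \<longlonglongrightarrow> (\<integral>x. h x * indicator A x \<partial>lborel)"
  proof (rule integral_dominated_convergence[where w = "\<lambda>x. \<bar>h x\<bar>"])
    show "(\<lambda>x. h x * indicator A x) \<in> borel_measurable lborel" using A by simp
    show "AE x in lborel. (\<lambda>n. h x * \<phi> n x) \<longlonglongrightarrow> h x * indicator A x"
      by (intro AE_I2 tendsto_intros lim)
    show "AE x in lborel. norm (h x * \<phi> n x) \<le> \<bar>h x\<bar>" for n
      using b by (auto simp: abs_mult intro!: mult_left_le)
  qed (use h in auto)
  thus ?thesis unfolding fourier_zero_test_function[OF h F cont b] by (simp add: LIMSEQ_const_iff)
qed simp

text \<open>The positive and negative parts of f - g, read as densities of finite measures, agree on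
  closed sets. These are stable under intersection and generate the Borel sets, so the measures
  coincide, and with them the densities almost everywhere.\<close>

lemma fourier_inj:
  fixes f g :: "'a::euclidean_space \<Rightarrow> real"
  assumes f: "integrable lborel f" and g: "integrable lborel g" and F: "\<And>\<xi>. fourier f \<xi> = fourier g \<xi>"
  shows "AE x in lborel. f x = g x"
proof -
  define h where "h x = f x - g x" for x
  have h: "integrable lborel h" unfolding h_def using f g by simp
  have [measurable]: "h \<in> borel_measurable borel" using h by auto
  have "fourier h \<xi> = 0" for \<xi>
  proof -
    have i: "integrable lborel (\<lambda>x. exp (- (\<i> * complex_of_real (x \<bullet> \<xi>))) * complex_of_real (k x))"
      if "integrable lborel k" for k :: "'a \<Rightarrow> real"
      using that borel_measurable_integrable[OF that]
      by (intro Bochner_Integration.integrable_bound[OF that]) (auto simp: norm_mult)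
    have "fourier h \<xi> = fourier f \<xi> - fourier g \<xi>"
      unfolding fourier_def h_def by (subst Bochner_Integration.integral_diff[symmetric]) (use i f g in \<open>auto simp: algebra_simps\<close>)
    thus ?thesis using F by simp
  qed
  note z = fourier_zero_closed[OF h this]
  let ?D = "\<lambda>k::'a \<Rightarrow> real. density lborel (\<lambda>x. ennreal (k x))"
  have em: "emeasure (?D k) A = ennreal (\<integral>x. k x * indicator A x \<partial>lborel)"
    if "integrable lborel k" "\<And>x. k x \<ge> 0" "A \<in> sets borel" for k A
  proof -
    have [measurable]: "k \<in> borel_measurable borel" "A \<in> sets borel" using that by auto
    have "integrable lborel (\<lambda>x. k x * indicator A x)"
      using that by (intro Bochner_Integration.integrable_bound[OF that(1)]) (auto split: split_indicator)
    from nn_integral_eq_integral[OF this] that show ?thesis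
      by (simp add: emeasure_density ennreal_mult' ennreal_indicator)
  qed
  have ip: "integrable lborel (\<lambda>x. max (h x) 0)" "integrable lborel (\<lambda>x. max (- h x) 0)"
    using h by (auto intro!: integrable_max)
  have "?D (\<lambda>x. max (h x) 0) = ?D (\<lambda>x. max (- h x) 0)"
  proof (rule measure_eqI_generator_eq[where E = "Collect closed" and A = "\<lambda>_. UNIV"])
    show "Int_stable (Collect (closed :: 'a set \<Rightarrow> bool))" by (auto simp: Int_stable_def)
    fix A :: "'a set" assume "A \<in> Collect closed"
    hence A: "closed A" by simp
    hence [measurable]: "A \<in> sets borel" by simp
    have i: "integrable lborel (\<lambda>x. max (h x) 0 * indicator A x)" "integrable lborel (\<lambda>x. max (- h x) 0 * indicator A x)"
      using ip by (auto intro!: integrable_real_mult_indicator)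
    have "(\<integral>x. max (h x) 0 * indicator A x \<partial>lborel) - (\<integral>x. max (- h x) 0 * indicator A x \<partial>lborel) = (\<integral>x. h x * indicator A x \<partial>lborel)"
      by (subst Bochner_Integration.integral_diff[OF i, symmetric])
         (auto intro!: Bochner_Integration.integral_cong split: split_indicator simp: max_def)
    thus "emeasure (?D (\<lambda>x. max (h x) 0)) A = emeasure (?D (\<lambda>x. max (- h x) 0)) A"
      using z[OF A] ip by (subst (1 2) em) auto
  qed (use em[OF ip(1), of UNIV] in \<open>auto simp: borel_eq_closed\<close>)
  hence "AE x in lborel. ennreal (max (h x) 0) = ennreal (max (- h x) 0)"
    using em[OF ip(1), of UNIV] by (subst (asm) finite_density_unique) (auto simp: emeasure_density)
  thus ?thesis by eventually_elim (auto simp: h_def max_def ennreal_inj split: if_splits)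
qed

section \<open>Integral inequalities of Hoelder and Minkowski\<close>

text \<open>Powers of integrals are formed before the integrals are known to be finite. The value
  \<infinity> is kept for every exponent, even 0, and \<open>0 powr 0 = 0\<close> is inherited from
  \<open>powr\<close>; with these conventions exponents add without side conditions.\<close>

definition epow :: "ennreal \<Rightarrow> real \<Rightarrow> ennreal" where
  "epow x a = (if x = \<top> then \<top> else ennreal (enn2real x powr a))"

lemma epow_top [simp]: "epow \<top> a = \<top>"
  by (simp add: epow_def)

lemma epow_ennreal: "0 \<le> x \<Longrightarrow> epow (ennreal x) a = ennreal (x powr a)"
  by (simp add: epow_def)

lemma epow_0 [simp]: "epow 0 a = 0"
  by (simp add: epow_def)

lemma epow_1 [simp]: "epow x 1 = x"
  by (cases x) (auto simp: epow_def)

lemma epow_mono: "x \<le> y \<Longrightarrow> 0 \<le> a \<Longrightarrow> epow x a \<le> epow y a"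
  by (cases x; cases y) (auto simp: epow_def top_unique intro!: ennreal_leI powr_mono2)

lemma epow_eq_top_iff [simp]: "epow x a = \<top> \<longleftrightarrow> x = \<top>"
  by (simp add: epow_def)

lemma epow_eq_0_iff [simp]: "epow x a = 0 \<longleftrightarrow> x = 0"
  by (cases x) (auto simp: epow_def ennreal_eq_0_iff)

lemma epow_cmult: "0 \<le> c \<Longrightarrow> 0 < a \<Longrightarrow> epow (ennreal c * x) a = ennreal (c powr a) * epow x a"
  by (cases x; cases "c = 0") (auto simp: epow_def ennreal_mult_top ennreal_mult[symmetric] powr_mult)

lemma epow_add: "epow x a * epow x b = epow x (a + b)"
  by (cases x) (auto simp: epow_def ennreal_mult[symmetric] powr_add)

lemma epow_measurable [measurable]:
  "(\<lambda>x. epow (f x) a) \<in> borel_measurable M" if [measurable]: "f \<in> borel_measurable M"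
  unfolding epow_def by measurable

text \<open>Continuity from below. In the nontrivial direction a finite bound on the powers becomes
  a bound on the \<open>f n\<close> through the inverse power 1/a.\<close>

lemma SUP_epow:
  assumes f: "incseq f" and a: "0 < a"
  shows "(SUP n. epow (f n) a) = epow (SUP n. f n) a"
proof (rule antisym)
  show "(SUP n. epow (f n) a) \<le> epow (SUP n. f n) a"
    using a by (intro SUP_least epow_mono SUP_upper) auto
  show "epow (SUP n. f n) a \<le> (SUP n. epow (f n) a)" (is "_ \<le> ?S")
  proof (cases ?S)
    case (real c)
    have "f n \<le> ennreal (c powr (1 / a))" for n
    proof -
      have le: "epow (f n) a \<le> ennreal c" using real by (metis SUP_upper UNIV_I)
      then obtain x where x: "f n = ennreal x" "x \<ge> 0"
        by (cases "f n") (auto simp: top_unique)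
      hence "x powr a \<le> c" using le real by (simp add: epow_ennreal)
      hence "(x powr a) powr (1 / a) \<le> c powr (1 / a)" using a by (intro powr_mono2) auto
      thus ?thesis using x a by (auto simp: powr_powr intro!: ennreal_leI)
    qed
    hence "(SUP n. f n) \<le> ennreal (c powr (1 / a))" by (intro SUP_least)
    hence "epow (SUP n. f n) a \<le> epow (ennreal (c powr (1 / a))) a" using a by (intro epow_mono) auto
    also have "\<dots> = ennreal c" using a real by (simp add: epow_ennreal powr_powr)
    finally show ?thesis using real by simp
  next
    case top
    thus ?thesis by (metis top_greatest)
  qed
qed

text \<open>The inequality for two terms is used twice: y and z are merged into one mean with the
  relative weights b/d and c/d, which is then paired with x.\<close>

lemma weighted_am_gm3:
  fixes x y z a b c :: real
  assumes "0 \<le> x" "0 \<le> y" "0 \<le> z" and "0 < a" "0 \<le> b" "0 \<le> c" and s: "a + b + c = 1"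
  shows "x powr a * y powr b * z powr c \<le> a * x + b * y + c * z"
proof (cases "x = 0 \<or> y = 0 \<or> z = 0")
  case True
  thus ?thesis using assms by auto
next
  case False
  hence pos: "x > 0" "y > 0" "z > 0" using assms by auto
  define d where "d = b + c"
  show ?thesis
  proof (cases "d = 0")
    case True
    hence "b = 0" "c = 0" "a = 1" using assms d_def by auto
    thus ?thesis using pos by simp
  next
    case False
    hence d: "d > 0" using assms d_def by auto
    define w where "w = y powr (b / d) * z powr (c / d)"
    have w: "w > 0" using pos by (simp add: w_def)
    have "w powr d = y powr b * z powr c"
      using pos d by (simp add: w_def powr_mult powr_powr)
    hence "x powr a * y powr b * z powr c = x powr a * w powr d" by simp
    also have "\<dots> \<le> a * x + d * w"
      using assms d pos w by (intro Youngs_inequality_0) (auto simp: d_def)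
    also have "w \<le> b / d * y + c / d * z"
      unfolding w_def using assms d pos by (intro Youngs_inequality_0) (auto simp: d_def add_divide_distrib[symmetric])
    also have "a * x + d * (b / d * y + c / d * z) = a * x + b * y + c * z"
      using d by (simp add: field_simps)
    finally show ?thesis using d by (simp add: mult_left_mono)
  qed
qed

text \<open>
  The weighted arithmetic-geometric inequality applied to the integrand, with \<open>X\<close> rescaled to the
  mass \<open>W\<close>. Since \<open>0 powr a = 0\<close> even for \<open>a = 0\<close>, vanishing exponents need no special treatment
  as long as \<open>H\<close> vanishes with each factor.
\<close>

lemma holder3:
  fixes H X Y Z :: "'e \<Rightarrow> real"
  assumes [measurable]: "H \<in> borel_measurable M" "X \<in> borel_measurable M" "Y \<in> borel_measurable M" "Z \<in> borel_measurable M"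
    and nn: "\<And>e. 0 \<le> X e" "\<And>e. 0 \<le> Y e" "\<And>e. 0 \<le> Z e"
    and H: "AE e in M. H e \<le> X e powr (1 / q) * Y e powr b * Z e powr c"
    and q: "0 < q" "0 \<le> b" "0 \<le> c" "1 / q + b + c = 1"
    and W: "0 < W" "(\<integral>\<^sup>+e. ennreal (Y e) \<partial>M) \<le> ennreal W" "(\<integral>\<^sup>+e. ennreal (Z e) \<partial>M) \<le> ennreal W"
  shows "epow (\<integral>\<^sup>+e. ennreal (H e) \<partial>M) q \<le> ennreal (W powr (q - 1)) * (\<integral>\<^sup>+e. ennreal (X e) \<partial>M)"
proof (cases "(\<integral>\<^sup>+e. ennreal (X e) \<partial>M)")
  case top
  thus ?thesis using W by (simp add: ennreal_mult_top)
next
  case (real j)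
  show ?thesis
  proof (cases "j = 0")
    \<comment> \<open>Mass 0 cannot be rescaled to W. Here X vanishes almost everywhere, and the
      assumed bound forces H \<le> 0.\<close>
    case True
    with real have "AE e in M. ennreal (X e) = 0" by (subst nn_integral_0_iff_AE[symmetric]) auto
    with H have "AE e in M. ennreal (H e) = 0"
    proof eventually_elim
      case (elim e)
      hence "X e = 0" using nn(1)[of e] by (simp add: ennreal_eq_0_iff)
      with elim show ?case by (simp add: ennreal_neg)
    qed
    hence "(\<integral>\<^sup>+e. ennreal (H e) \<partial>M) = 0" by (subst nn_integral_0_iff_AE) auto
    thus ?thesis by simp
  next
    case False
    with real have j: "j > 0" by simp
    define k where "k = (j / W) powr (1 / q)"
    have k: "k > 0" using j W by (simp add: k_def)
    have le: "AE e in M. ennreal (H e) \<le> ennreal k * (ennreal (1 / q * (W / j)) * ennreal (X e) + ennreal b * ennreal (Y e) + ennreal c * ennreal (Z e))"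
      using H
    proof eventually_elim
      case (elim e)
      note elim
      also have "X e powr (1 / q) = k * ((W / j) * X e) powr (1 / q)"
      proof -
        have "k * ((W / j) * X e) powr (1 / q) = ((j / W) * ((W / j) * X e)) powr (1 / q)"
          unfolding k_def by (simp only: powr_mult[symmetric])
        thus ?thesis using j W by simp
      qed
      also have "k * ((W / j) * X e) powr (1 / q) * Y e powr b * Z e powr c = k * (((W / j) * X e) powr (1 / q) * Y e powr b * Z e powr c)"
        by simp
      also have "\<dots> \<le> k * (1 / q * ((W / j) * X e) + b * Y e + c * Z e)"
        using k q nn j W by (intro mult_left_mono weighted_am_gm3) auto
      finally have "ennreal (H e) \<le> ennreal (k * (1 / q * ((W / j) * X e) + b * Y e + c * Z e))" by (rule ennreal_leI)
      also have "\<dots> = ennreal k * ennreal (1 / q * (W / j) * X e + b * Y e + c * Z e)"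
        using k by (simp add: ennreal_mult' mult.assoc)
      also have "ennreal (1 / q * (W / j) * X e + b * Y e + c * Z e) = ennreal (1 / q * (W / j)) * ennreal (X e) + ennreal b * ennreal (Y e) + ennreal c * ennreal (Z e)"
        using q nn j W by (simp add: ennreal_mult[symmetric] ennreal_plus[symmetric] del: ennreal_plus)
      finally show ?case .
    qed
    have "(\<integral>\<^sup>+e. ennreal (H e) \<partial>M) \<le> (\<integral>\<^sup>+e. ennreal k * (ennreal (1 / q * (W / j)) * ennreal (X e) + ennreal b * ennreal (Y e) + ennreal c * ennreal (Z e)) \<partial>M)"
      using le by (rule nn_integral_mono_AE)
    also have "\<dots> = ennreal k * (ennreal (1 / q * (W / j)) * (\<integral>\<^sup>+e. ennreal (X e) \<partial>M) + ennreal b * (\<integral>\<^sup>+e. ennreal (Y e) \<partial>M) + ennreal c * (\<integral>\<^sup>+e. ennreal (Z e) \<partial>M))"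
      by (simp add: nn_integral_cmult nn_integral_add)
    also have "\<dots> \<le> ennreal k * (ennreal (1 / q * (W / j)) * ennreal j + ennreal b * ennreal W + ennreal c * ennreal W)"
      unfolding real(2) by (intro mult_left_mono add_mono W order_refl) auto
    also have "\<dots> = ennreal (k * (1 / q * (W / j) * j + b * W + c * W))"
      using k q j W by (simp add: ennreal_mult[symmetric] ennreal_plus[symmetric] del: ennreal_plus)
    also have "1 / q * (W / j) * j + b * W + c * W = (1 / q + b + c) * W" using j by (simp add: distrib_right)
    finally have "(\<integral>\<^sup>+e. ennreal (H e) \<partial>M) \<le> ennreal (k * W)" using q by simp
    hence "epow (\<integral>\<^sup>+e. ennreal (H e) \<partial>M) q \<le> epow (ennreal (k * W)) q" using q by (intro epow_mono) auto
    also have "\<dots> = ennreal ((k * W) powr q)" using k W by (simp add: epow_ennreal)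
    also have "(k * W) powr q = W powr (q - 1) * j"
      using k W j q by (simp add: powr_mult k_def powr_powr powr_diff)
    finally show ?thesis using real W by (simp add: ennreal_mult)
  qed
qed

text \<open>A proof without duality. As w e bounds the L^r norm of h e, the function X = w (h/w)^r
  has an integral over x of at most w. For each x, Hoelder's inequality in e writes h as the product
  of the powers 1/r of X and 1 - 1/r of w.\<close>

lemma minkowski_integral:
  fixes h :: "'e \<Rightarrow> 'x \<Rightarrow> real" and w :: "'e \<Rightarrow> real"
  assumes "sigma_finite_measure M" "sigma_finite_measure L"
    and [measurable]: "(\<lambda>(e, x). h e x) \<in> borel_measurable (M \<Otimes>\<^sub>M L)" "w \<in> borel_measurable M"
    and h: "\<And>e x. 0 \<le> h e x" and w: "\<And>e. 0 \<le> w e" and r: "1 \<le> r"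
    and hw: "AE e in M. (\<integral>\<^sup>+x. ennreal (h e x powr r) \<partial>L) \<le> ennreal (w e powr r)"
    and W: "0 < W" "(\<integral>\<^sup>+e. ennreal (w e) \<partial>M) \<le> ennreal W"
  shows "(\<integral>\<^sup>+x. epow (\<integral>\<^sup>+e. ennreal (h e x) \<partial>M) r \<partial>L) \<le> ennreal (W powr r)"
proof -
  interpret M: sigma_finite_measure M by fact
  interpret L: sigma_finite_measure L by fact
  interpret P: pair_sigma_finite M L ..
  define X where "X x e = (if w e = 0 then 0 else w e * (h e x / w e) powr r)" for x e
  have [measurable]: "(\<lambda>(e, x). X x e) \<in> borel_measurable (M \<Otimes>\<^sub>M L)"
    unfolding X_def by measurable
  \<comment> \<open>Where w vanishes, the normalisation would divide by 0. There h vanishes for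
    almost every x, and Tonelli exchanges the two quantifiers.\<close>
  have ae0: "AE x in L. AE e in M. w e = 0 \<longrightarrow> h e x = 0"
  proof -
    have "AE e in M. AE x in L. w e = 0 \<longrightarrow> h e x = 0"
      using hw AE_space
    proof eventually_elim
      case (elim e)
      note [measurable] = elim(2)
      show ?case
      proof (cases "w e = 0")
        case True
        with elim(1) have "(\<integral>\<^sup>+x. ennreal (h e x powr r) \<partial>L) = 0" by simp
        hence "AE x in L. ennreal (h e x powr r) = 0" by (subst (asm) nn_integral_0_iff_AE) auto
        thus ?thesis by eventually_elim (use h in \<open>auto simp: ennreal_eq_0_iff\<close>)
      qed simp
    qed
    thus ?thesis by (subst P.AE_commute[symmetric]) auto
  qed
  have pw: "AE x in L. epow (\<integral>\<^sup>+e. ennreal (h e x) \<partial>M) r \<le> ennreal (W powr (r - 1)) * (\<integral>\<^sup>+e. ennreal (X x e) \<partial>M)"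
    using ae0 AE_space
  proof eventually_elim
    case (elim x)
    note [measurable] = elim(2)
    show ?case
    \<comment> \<open>The third factor is idle, with exponent 0. As \<open>w e powr 0\<close> is 0
      where w vanishes, the pointwise bound relies on h = 0 there.\<close>
    proof (rule holder3[where Y = w and Z = w and b = "1 - 1 / r" and c = 0])
      show "AE e in M. h e x \<le> X x e powr (1 / r) * w e powr (1 - 1 / r) * w e powr 0"
        using elim(1)
      proof eventually_elim
        case (elim e)
        show ?case
        proof (cases "w e = 0")
          case False
          hence we: "w e > 0" using w[of e] by simp
          have "X x e powr (1 / r) * w e powr (1 - 1 / r) * w e powr 0 = w e powr (1 / r) * (h e x / w e) * w e powr (1 - 1 / r)"
            using we h r by (simp add: X_def powr_mult powr_powr)
          also have "\<dots> = (w e powr (1 / r) * w e powr (1 - 1 / r)) * (h e x / w e)" by (simp add: mult_ac)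
          also have "\<dots> = h e x" using we by (simp add: powr_add[symmetric])
          finally show ?thesis by simp
        qed (use elim in simp)
      qed
      show "(\<integral>\<^sup>+e. ennreal (w e) \<partial>M) \<le> ennreal W" "(\<integral>\<^sup>+e. ennreal (w e) \<partial>M) \<le> ennreal W" by (fact W)+
    qed (use r h w W in \<open>auto simp: X_def\<close>)
  qed
  have "(\<integral>\<^sup>+x. epow (\<integral>\<^sup>+e. ennreal (h e x) \<partial>M) r \<partial>L) \<le> (\<integral>\<^sup>+x. ennreal (W powr (r - 1)) * (\<integral>\<^sup>+e. ennreal (X x e) \<partial>M) \<partial>L)"
    using pw by (rule nn_integral_mono_AE)
  also have "\<dots> = ennreal (W powr (r - 1)) * (\<integral>\<^sup>+x. \<integral>\<^sup>+e. ennreal (X x e) \<partial>M \<partial>L)"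
    by (intro nn_integral_cmult) measurable
  also have "(\<integral>\<^sup>+x. \<integral>\<^sup>+e. ennreal (X x e) \<partial>M \<partial>L) = (\<integral>\<^sup>+e. \<integral>\<^sup>+x. ennreal (X x e) \<partial>L \<partial>M)"
    by (intro P.Fubini') measurable
  also have "\<dots> \<le> (\<integral>\<^sup>+e. ennreal (w e) \<partial>M)"
  proof (intro nn_integral_mono_AE)
    show "AE e in M. (\<integral>\<^sup>+x. ennreal (X x e) \<partial>L) \<le> ennreal (w e)"
      using hw AE_space
    proof eventually_elim
      case (elim e)
      note [measurable] = elim(2)
      show ?case
      proof (cases "w e = 0")
        case False
        hence we: "w e > 0" using w[of e] by simp
        have "X x e = (w e / w e powr r) * h e x powr r" for x
          using we h by (simp add: X_def powr_divide)
        hence "(\<integral>\<^sup>+x. ennreal (X x e) \<partial>L) = ennreal (w e / w e powr r) * (\<integral>\<^sup>+x. ennreal (h e x powr r) \<partial>L)"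
          using we by (simp only:) (intro nn_integral_ennreal_cmult, auto)
        also have "\<dots> \<le> ennreal (w e / w e powr r) * ennreal (w e powr r)"
          using elim(1) by (intro mult_left_mono) auto
        also have "\<dots> = ennreal (w e)" using we by (simp add: ennreal_mult[symmetric])
        finally show ?thesis .
      qed (simp add: X_def)
    qed
  qed
  also note W(2)
  also have "ennreal (W powr (r - 1)) * ennreal W = ennreal (W powr r)"
    using W(1) by (simp add: ennreal_mult[symmetric] powr_diff)
  finally show ?thesis by (simp add: mult_left_mono)
qed

section \<open>The kernels of the linear problem\<close>

text \<open>Without integrability the left side has the default value 0. Bochner integrals can thus
  be majorised before their existence is settled.\<close>

lemma ennreal_abs_integral_le: "ennreal \<bar>\<integral>x. f x \<partial>M\<bar> \<le> (\<integral>\<^sup>+x. ennreal \<bar>f x\<bar> \<partial>M)" for f :: "_ \<Rightarrow> real"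
proof (cases "integrable M f")
  case True
  thus ?thesis using integral_norm_bound_ennreal[of M f] by simp
qed (simp add: not_integrable_integral_eq)

lemma
  fixes f :: "'m \<Rightarrow> 'a::second_countable_topology \<times> 'b::second_countable_topology"
  assumes "f \<in> M \<rightarrow>\<^sub>M borel"
  shows measurable_fst_borel [measurable (raw)]: "(\<lambda>x. fst (f x)) \<in> M \<rightarrow>\<^sub>M borel"
    and measurable_snd_borel [measurable (raw)]: "(\<lambda>x. snd (f x)) \<in> M \<rightarrow>\<^sub>M borel"
  using assms by (auto intro!: measurable_compose[OF assms] borel_measurable_continuous_onI continuous_intros)

text \<open>The mean of \<open>\<omega> A\<close> times the heat kernel at the time $(t/A)^{\alpha/s}S$.\<close>

definition subordinate :: "real \<Rightarrow> real \<Rightarrow> (real \<Rightarrow> real) \<Rightarrow> real \<Rightarrow> 'a::euclidean_space \<Rightarrow> real" where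
  "subordinate \<alpha> s \<omega> t x =
     (\<integral>z. \<omega> (fst z) * heat_kernel ((t / fst z) powr (\<alpha> / s) * snd z) x \<partial>(stable_law \<alpha> \<Otimes>\<^sub>M stable_law s))"

lemma stable_law_neg_moment_finite:
  assumes s: "0 < s" "s < 1" and e: "e \<ge> 0"
  shows "\<exists>C>0. (\<integral>\<^sup>+x. ennreal (x powr (- e)) \<partial>stable_law s) \<le> ennreal C"
proof (cases "e = 0")
  case True
  interpret real_distribution "stable_law s" using s by (intro real_distribution_stable_law)
  have "(\<integral>\<^sup>+x. ennreal (x powr (- e)) \<partial>stable_law s) \<le> (\<integral>\<^sup>+x. 1 \<partial>stable_law s)"
    using True by (intro nn_integral_mono) (auto simp: powr_def)
  also have "\<dots> = ennreal 1" using emeasure_space_1 by simp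
  finally show ?thesis by (intro exI[of _ 1]) auto
next
  case False
  with e have e: "e > 0" by simp
  show ?thesis using stable_law_neg_moment[OF s e] s e
    by (intro exI[of _ "Gamma (e / s + 1) / Gamma (e + 1)"]) (auto intro!: divide_pos_pos Gamma_real_pos add_pos_pos)
qed

section \<open>Subordinated heat kernels\<close>

context
  fixes \<alpha> s :: real
  assumes \<alpha>: "0 < \<alpha>" "\<alpha> < 1" and s: "0 < s" "s < 1"
begin

interpretation A: real_distribution "stable_law \<alpha>" by (rule real_distribution_stable_law[OF \<alpha>])
interpretation S: real_distribution "stable_law s" by (rule real_distribution_stable_law[OF s])
interpretation P: pair_prob_space "stable_law \<alpha>" "stable_law s" ..

lemma sets_stable_law [measurable_cong]:
  "sets (stable_law \<alpha>) = sets borel" "sets (stable_law s) = sets borel"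
  by simp_all

lemma stable_law_pair_pos:
  "AE z in stable_law \<alpha> \<Otimes>\<^sub>M stable_law s. 0 < fst z \<and> 0 < snd z"
proof (rule P.AE_pair_measure)
  show "AE a in stable_law \<alpha>. AE b in stable_law s. 0 < fst (a, b) \<and> 0 < snd (a, b)"
    using stable_law_pos[OF \<alpha>] by eventually_elim (use stable_law_pos[OF s] in simp)
qed measurable

lemma subordinate_measurable:
  assumes [measurable]: "\<omega> \<in> borel_measurable borel"
  shows "(\<lambda>(t, x). subordinate \<alpha> s \<omega> t x) \<in> borel_measurable (borel \<Otimes>\<^sub>M borel)"
  unfolding subordinate_def by measurable

text \<open>By Fubini the Fourier transform acts on the heat kernel first and leaves exp(-\<rho>
  |\<xi>|^2). The mean over S is then the Laplace transform of its law at (t/a)^(\<alpha>/s)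
  |\<xi>|^2, a number whose s-th power is |\<xi>|^(2s) t^\<alpha> a^(-\<alpha>).\<close>

lemma
  fixes t :: real and \<omega> :: "real \<Rightarrow> real"
  assumes t: "0 < t" and \<omega>[measurable]: "\<omega> \<in> borel_measurable borel" and \<omega>0: "\<And>a. 0 \<le> \<omega> a" and \<omega>i: "integrable (stable_law \<alpha>) \<omega>"
  shows integrable_subordinate: "integrable lborel (subordinate \<alpha> s \<omega> t :: 'a::euclidean_space \<Rightarrow> real)"
    and fourier_subordinate: "fourier (subordinate \<alpha> s \<omega> t :: 'a \<Rightarrow> real) \<xi> =
      complex_of_real (\<integral>a. \<omega> a * exp (- (norm \<xi> powr (2 * s) * t powr \<alpha> * a powr (- \<alpha>))) \<partial>stable_law \<alpha>)"
proof -
  let ?P = "stable_law \<alpha> \<Otimes>\<^sub>M stable_law s"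
  interpret Q: pair_sigma_finite ?P "lborel :: 'a measure" ..
  define \<rho> where "\<rho> z = (t / fst z) powr (\<alpha> / s) * snd z" for z :: "real \<times> real"
  have [measurable]: "\<rho> \<in> borel_measurable ?P" unfolding \<rho>_def by measurable
  have \<rho>: "AE z in ?P. \<rho> z > 0"
    using stable_law_pair_pos by eventually_elim (use t in \<open>auto simp: \<rho>_def\<close>)
  define F where "F z x = \<omega> (fst z) * heat_kernel (\<rho> z) x" for z and x :: 'a
  have F0: "F z x \<ge> 0" for z x using \<omega>0 by (simp add: F_def)
  have [measurable]: "(\<lambda>(z, x). F z x) \<in> borel_measurable (?P \<Otimes>\<^sub>M lborel)" unfolding F_def by measurable
  have Fx: "AE z in ?P. integrable lborel (F z) \<and> (\<integral>x. F z x \<partial>lborel) = \<omega> (fst z)"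
    using \<rho>
  proof eventually_elim
    case (elim z)
    have "F z = (\<lambda>x. \<omega> (fst z) * heat_kernel (\<rho> z) x)" by (simp add: F_def fun_eq_iff)
    with elim show ?case by (simp add: integrable_heat_kernel integral_heat_kernel)
  qed
  have \<omega>P: "integrable ?P (\<lambda>z. \<omega> (fst z))"
    by (rule P.Fubini_integrable) (use \<omega>i S.prob_space in auto)
  have Fint: "integrable (?P \<Otimes>\<^sub>M lborel) (\<lambda>(z, x). F z x)"
  proof (rule Q.Fubini_integrable)
    have "AE z in ?P. (\<integral>x. norm (case (z, x) of (z, x) \<Rightarrow> F z x) \<partial>lborel) = \<omega> (fst z)"
      using Fx by eventually_elim (use F0 in simp)
    thus "integrable ?P (\<lambda>z. \<integral>x. norm (case (z, x) of (z, x) \<Rightarrow> F z x) \<partial>lborel)"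
      by (subst integrable_cong_AE[of _ _ "\<lambda>z. \<omega> (fst z)"]) (use \<omega>P in auto)
    show "AE z in ?P. integrable lborel (\<lambda>x. case (z, x) of (z, x) \<Rightarrow> F z x)"
      using Fx by eventually_elim simp
  qed measurable
  have sub: "subordinate \<alpha> s \<omega> t x = (\<integral>z. F z x \<partial>?P)" for x :: 'a
    by (simp add: subordinate_def F_def \<rho>_def)
  show "integrable lborel (subordinate \<alpha> s \<omega> t :: 'a \<Rightarrow> real)"
    using Q.integrable_snd[OF Fint] unfolding sub[abs_def] by simp
  define e where "e x = exp (- (\<i> * complex_of_real (x \<bullet> \<xi>)))" for x
  have [measurable]: "e \<in> borel_measurable borel" unfolding e_def by measurable
  have ne: "norm (e x) = 1" for x by (simp add: e_def)
  have eF: "integrable (?P \<Otimes>\<^sub>M lborel) (\<lambda>(z, x). e x * complex_of_real (F z x))"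
    by (rule Bochner_Integration.integrable_bound[OF Fint]) (auto simp: norm_mult ne)
  have "fourier (subordinate \<alpha> s \<omega> t) \<xi> = (\<integral>x. \<integral>z. e x * complex_of_real (F z x) \<partial>?P \<partial>lborel)"
    unfolding fourier_def sub e_def[symmetric] by simp
  also have "\<dots> = (\<integral>z. \<integral>x. e x * complex_of_real (F z x) \<partial>lborel \<partial>?P)"
    using eF by (rule Q.Fubini_integral)
  also have "\<dots> = (\<integral>z. complex_of_real (\<omega> (fst z) * exp (- (\<rho> z * (norm \<xi>)\<^sup>2))) \<partial>?P)"
  proof (rule integral_cong_AE)
    show "AE z in ?P. (\<integral>x. e x * complex_of_real (F z x) \<partial>lborel) = complex_of_real (\<omega> (fst z) * exp (- (\<rho> z * (norm \<xi>)\<^sup>2)))"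
      using \<rho>
    proof eventually_elim
      case (elim z)
      have "(\<integral>x. e x * complex_of_real (F z x) \<partial>lborel) = (\<integral>x. complex_of_real (\<omega> (fst z)) * (e x * complex_of_real (heat_kernel (\<rho> z) x)) \<partial>lborel)"
        by (simp add: F_def mult_ac)
      also have "\<dots> = complex_of_real (\<omega> (fst z)) * fourier (heat_kernel (\<rho> z)) \<xi>"
        unfolding fourier_def e_def[symmetric] by (rule integral_mult_right_zero)
      finally show ?case using elim by (simp add: fourier_heat_kernel)
    qed
  qed measurable
  also have "\<dots> = complex_of_real (\<integral>z. \<omega> (fst z) * exp (- (\<rho> z * (norm \<xi>)\<^sup>2)) \<partial>?P)"
    by (rule integral_complex_of_real)
  also have "(\<integral>z. \<omega> (fst z) * exp (- (\<rho> z * (norm \<xi>)\<^sup>2)) \<partial>?P) = (\<integral>a. \<integral>b. \<omega> a * exp (- (\<rho> (a, b) * (norm \<xi>)\<^sup>2)) \<partial>stable_law s \<partial>stable_law \<alpha>)"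
  proof -
    have "integrable ?P (\<lambda>z. \<omega> (fst z) * exp (- (\<rho> z * (norm \<xi>)\<^sup>2)))"
    proof (rule Bochner_Integration.integrable_bound[OF \<omega>P])
      show "AE z in ?P. norm (\<omega> (fst z) * exp (- (\<rho> z * (norm \<xi>)\<^sup>2))) \<le> norm (\<omega> (fst z))"
        using \<rho> by eventually_elim (auto simp: abs_mult intro!: mult_left_le)
    qed measurable
    from P.integral_fst'[OF this] show ?thesis by simp
  qed
  also have "\<dots> = (\<integral>a. \<omega> a * exp (- (norm \<xi> powr (2 * s) * t powr \<alpha> * a powr (- \<alpha>))) \<partial>stable_law \<alpha>)"
  proof (rule integral_cong_AE)
    show "AE a in stable_law \<alpha>. (\<integral>b. \<omega> a * exp (- (\<rho> (a, b) * (norm \<xi>)\<^sup>2)) \<partial>stable_law s) = \<omega> a * exp (- (norm \<xi> powr (2 * s) * t powr \<alpha> * a powr (- \<alpha>)))"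
      using stable_law_pos[OF \<alpha>]
    proof eventually_elim
      case (elim a)
      have "((t / a) powr (\<alpha> / s) * (norm \<xi>)\<^sup>2) powr s = norm \<xi> powr (2 * s) * t powr \<alpha> * a powr (- \<alpha>)"
      proof -
        have "((norm \<xi>)\<^sup>2) powr s = norm \<xi> powr (2 * s)"
          by (cases "norm \<xi> = 0") (auto simp: powr_powr simp flip: powr_numeral)
        thus ?thesis using t elim s by (simp add: powr_mult powr_powr powr_divide powr_minus_divide)
      qed
      moreover have "(\<integral>b. exp (- (\<rho> (a, b) * (norm \<xi>)\<^sup>2)) \<partial>stable_law s) = (\<integral>b. exp (- (((t / a) powr (\<alpha> / s) * (norm \<xi>)\<^sup>2) * b)) \<partial>stable_law s)"
        by (simp add: \<rho>_def mult_ac)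
      ultimately show ?case by (simp add: laplace_stable_law[OF s])
    qed
  qed measurable
  finally show "fourier (subordinate \<alpha> s \<omega> t :: 'a \<Rightarrow> real) \<xi> =
      complex_of_real (\<integral>a. \<omega> a * exp (- (norm \<xi> powr (2 * s) * t powr \<alpha> * a powr (- \<alpha>))) \<partial>stable_law \<alpha>)" .
qed

text \<open>Minkowski's inequality reduces the L^r norm to a mean of norms of heat kernels, which
  are at most (4 pi \<rho>)^(-e). Since \<rho> is a product of powers of t, A and S, independence
  splits this mean into a moment of A and a negative moment of S.\<close>

lemma nn_integral_subordinate_powr:
  fixes t r e :: real and \<omega> :: "real \<Rightarrow> real"
  assumes t: "0 < t" and r: "1 \<le> r"
    and \<omega>[measurable]: "\<omega> \<in> borel_measurable borel" and \<omega>0: "\<And>a. 0 \<le> \<omega> a"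
    and e: "e = DIM('a::euclidean_space) / 2 * (1 - 1 / r)"
    and C1: "(\<integral>\<^sup>+a. ennreal (\<omega> a * a powr (\<alpha> / s * e)) \<partial>stable_law \<alpha>) \<le> ennreal C1" "0 < C1"
    and C2: "(\<integral>\<^sup>+b. ennreal (b powr (- e)) \<partial>stable_law s) \<le> ennreal C2" "0 < C2"
  shows "(\<integral>\<^sup>+x. ennreal (\<bar>subordinate \<alpha> s \<omega> t (x::'a)\<bar> powr r) \<partial>lborel)
     \<le> ennreal (((4 * pi) powr (- e) * t powr (- (\<alpha> / s * e)) * C1 * C2) powr r)"
proof -
  let ?P = "stable_law \<alpha> \<Otimes>\<^sub>M stable_law s"
  define \<rho> where "\<rho> z = (t / fst z) powr (\<alpha> / s) * snd z" for z :: "real \<times> real"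
  have [measurable]: "\<rho> \<in> borel_measurable ?P" unfolding \<rho>_def by measurable
  have pos: "AE z in ?P. 0 < fst z \<and> 0 < snd z" by (rule stable_law_pair_pos)
  define c where "c = (4 * pi) powr (- e) * t powr (- (\<alpha> / s * e))"
  have c: "c > 0" using t by (simp add: c_def)
  define w where "w z = \<omega> (fst z) * (4 * pi * \<rho> z) powr (- e)" for z
  have [measurable]: "w \<in> borel_measurable ?P" unfolding w_def by measurable
  have "(\<integral>\<^sup>+z. ennreal (w z) \<partial>?P) = (\<integral>\<^sup>+z. ennreal (c * (\<omega> (fst z) * fst z powr (\<alpha> / s * e) * snd z powr (- e))) \<partial>?P)"
  proof (rule nn_integral_cong_AE)
    show "AE z in ?P. ennreal (w z) = ennreal (c * (\<omega> (fst z) * fst z powr (\<alpha> / s * e) * snd z powr (- e)))"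
      using pos
    proof eventually_elim
      case (elim z)
      have "(4 * pi * \<rho> z) powr (- e) = (4 * pi) powr (- e) * ((t / fst z) powr (\<alpha> / s)) powr (- e) * snd z powr (- e)"
        using elim t by (simp add: \<rho>_def powr_mult)
      also have "((t / fst z) powr (\<alpha> / s)) powr (- e) = t powr (- (\<alpha> / s * e)) * fst z powr (\<alpha> / s * e)"
        using elim t by (simp add: powr_powr powr_divide powr_minus_divide)
      finally show ?case by (simp add: w_def c_def mult_ac)
    qed
  qed
  also have "\<dots> = (\<integral>\<^sup>+a. \<integral>\<^sup>+b. ennreal (c * (\<omega> a * a powr (\<alpha> / s * e) * b powr (- e))) \<partial>stable_law s \<partial>stable_law \<alpha>)"
    by (subst S.nn_integral_fst[symmetric]) auto
  also have "\<dots> = (\<integral>\<^sup>+a. ennreal c * (ennreal (\<omega> a * a powr (\<alpha> / s * e)) * (\<integral>\<^sup>+b. ennreal (b powr (- e)) \<partial>stable_law s)) \<partial>stable_law \<alpha>)"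
  proof (intro nn_integral_cong)
    fix a :: real
    show "(\<integral>\<^sup>+b. ennreal (c * (\<omega> a * a powr (\<alpha> / s * e) * b powr (- e))) \<partial>stable_law s)
       = ennreal c * (ennreal (\<omega> a * a powr (\<alpha> / s * e)) * (\<integral>\<^sup>+b. ennreal (b powr (- e)) \<partial>stable_law s))"
      using \<omega>0[of a] c
      by (subst nn_integral_ennreal_cmult, simp, simp, simp, subst nn_integral_ennreal_cmult) auto
  qed
  also have "\<dots> = ennreal c * ((\<integral>\<^sup>+a. ennreal (\<omega> a * a powr (\<alpha> / s * e)) \<partial>stable_law \<alpha>) * (\<integral>\<^sup>+b. ennreal (b powr (- e)) \<partial>stable_law s))"
    by (subst nn_integral_cmult, simp, subst nn_integral_multc) auto
  also have "\<dots> \<le> ennreal c * (ennreal C1 * ennreal C2)"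
    by (intro mult_left_mono mult_mono C1 C2) auto
  also have "\<dots> = ennreal (c * C1 * C2)" using c C1(2) C2(2) by (simp add: ennreal_mult mult.assoc)
  finally have W: "(\<integral>\<^sup>+z. ennreal (w z) \<partial>?P) \<le> ennreal (c * C1 * C2)" .
  have "(\<integral>\<^sup>+x. ennreal (\<bar>subordinate \<alpha> s \<omega> t (x::'a)\<bar> powr r) \<partial>lborel)
     \<le> (\<integral>\<^sup>+x. epow (\<integral>\<^sup>+z. ennreal (\<omega> (fst z) * heat_kernel (\<rho> z) (x::'a)) \<partial>?P) r \<partial>lborel)"
  proof (intro nn_integral_mono)
    fix x :: 'a
    have "ennreal \<bar>subordinate \<alpha> s \<omega> t x\<bar> \<le> (\<integral>\<^sup>+z. ennreal \<bar>\<omega> (fst z) * heat_kernel (\<rho> z) x\<bar> \<partial>?P)"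
      unfolding subordinate_def \<rho>_def by (rule ennreal_abs_integral_le)
    hence "epow (ennreal \<bar>subordinate \<alpha> s \<omega> t x\<bar>) r \<le> epow (\<integral>\<^sup>+z. ennreal (\<omega> (fst z) * heat_kernel (\<rho> z) x) \<partial>?P) r"
      using r \<omega>0 by (intro epow_mono) (auto simp: abs_mult)
    thus "ennreal (\<bar>subordinate \<alpha> s \<omega> t x\<bar> powr r) \<le> epow (\<integral>\<^sup>+z. ennreal (\<omega> (fst z) * heat_kernel (\<rho> z) x) \<partial>?P) r"
      by (simp add: epow_ennreal)
  qed
  also have "\<dots> \<le> ennreal ((c * C1 * C2) powr r)"
  proof (rule minkowski_integral[where w = w])
    show "AE z in ?P. (\<integral>\<^sup>+x. ennreal ((\<omega> (fst z) * heat_kernel (\<rho> z) (x::'a)) powr r) \<partial>lborel) \<le> ennreal (w z powr r)"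
      using pos
    proof eventually_elim
      case (elim z)
      have \<rho>z: "\<rho> z > 0" using elim t by (simp add: \<rho>_def)
      have "(\<integral>\<^sup>+x. ennreal ((\<omega> (fst z) * heat_kernel (\<rho> z) (x::'a)) powr r) \<partial>lborel)
          = ennreal (\<omega> (fst z) powr r) * (\<integral>\<^sup>+x. ennreal (heat_kernel (\<rho> z) (x::'a) powr r) \<partial>lborel)"
        using \<omega>0 by (simp only: powr_mult heat_kernel_nonneg) (intro nn_integral_ennreal_cmult, auto)
      also have "\<dots> \<le> ennreal (\<omega> (fst z) powr r) * ennreal (((4 * pi * \<rho> z) powr (- e)) powr r)"
        unfolding e using \<rho>z r by (intro mult_left_mono nn_integral_heat_kernel_powr) auto
      also have "\<dots> = ennreal (w z powr r)"
        using \<omega>0 by (simp add: w_def powr_mult ennreal_mult[symmetric])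
      finally show ?case .
    qed
    show "sigma_finite_measure ?P" "sigma_finite_measure (lborel :: 'a measure)" by unfold_locales
    show "(\<integral>\<^sup>+z. ennreal (w z) \<partial>?P) \<le> ennreal (c * C1 * C2)" by fact
  qed (use \<omega>0 r c C1(2) C2(2) in \<open>auto simp: w_def\<close>)
  finally show ?thesis by (simp add: c_def)
qed

section \<open>Identification and norms of the kernels Z and Y\<close>

lemma subordinate_measurable' [measurable]:
  assumes "\<omega> \<in> borel_measurable borel"
  shows "(\<lambda>x. subordinate \<alpha> s \<omega> (fst x) (snd x)) \<in> borel_measurable (borel :: (real \<times> 'a::euclidean_space) measure)"
  using subordinate_measurable[OF assms, where 'a = 'a] by (simp add: borel_prod case_prod_beta')

lemma half_space_sets [measurable]: "({0<..} \<times> UNIV) \<in> sets (borel :: (real \<times> 'a::euclidean_space) measure)"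
  by (intro borel_open open_Times) auto

lemma has_symbol_Z:
  "has_symbol (subordinate \<alpha> s (\<lambda>_. 1)) (\<lambda>t (\<xi>::'a::euclidean_space). mittag_leffler \<alpha> 1 (- (norm \<xi> powr (2 * s) * t powr \<alpha>)))"
proof -
  have m: "(\<lambda>x. indicat_real ({0<..} \<times> UNIV) x * subordinate \<alpha> s (\<lambda>_. 1) (fst x) (snd x)) \<in> borel_measurable (borel :: (real \<times> 'a) measure)"
    by measurable
  show ?thesis
    unfolding has_symbol_def set_borel_measurable_def
    using \<alpha> s integrable_subordinate[of _ "\<lambda>_. 1", where 'a = 'a] fourier_subordinate[of _ "\<lambda>_. 1", where 'a = 'a]
      stable_law_mittag_leffler_1[OF \<alpha>] m
    by (auto simp: borel_prod case_prod_beta')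
qed

lemma has_symbol_Y:
  "has_symbol (\<lambda>t. \<lambda>x. t powr (\<alpha> - 1) * subordinate \<alpha> s (\<lambda>a. \<alpha> * a powr (- \<alpha>)) t x)
     (\<lambda>t (\<xi>::'a::euclidean_space). t powr (\<alpha> - 1) * mittag_leffler \<alpha> \<alpha> (- (norm \<xi> powr (2 * s) * t powr \<alpha>)))"
proof -
  let ?w = "\<lambda>a. \<alpha> * a powr (- \<alpha>)"
  have wi: "integrable (stable_law \<alpha>) ?w"
    using stable_law_moment[OF \<alpha>, of 1] by (auto simp: has_bochner_integral_iff)
  have m: "(\<lambda>x. indicat_real ({0<..} \<times> UNIV) x * (fst x powr (\<alpha> - 1) * subordinate \<alpha> s ?w (fst x) (snd x))) \<in> borel_measurable (borel :: (real \<times> 'a) measure)"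
    by measurable
  have F: "fourier (\<lambda>x::'a. t powr (\<alpha> - 1) * subordinate \<alpha> s ?w t x) \<xi> = complex_of_real (t powr (\<alpha> - 1)) * fourier (subordinate \<alpha> s ?w t) \<xi>" for t \<xi>
    unfolding fourier_def by (simp add: mult.left_commute)
  show ?thesis
    unfolding has_symbol_def set_borel_measurable_def
    using \<alpha> s integrable_subordinate[OF _ _ _ wi, where 'a = 'a] fourier_subordinate[OF _ _ _ wi, where 'a = 'a]
      stable_law_mittag_leffler_self[OF \<alpha>] m
    by (auto simp: borel_prod case_prod_beta' F)
qed

text \<open>The choice operator needs one witness \<open>K\<close>. Injectivity of the Fourier
  transform then identifies the chosen kernel with \<open>K\<close> almost everywhere at each t > 0,
  so that norms may be computed on \<open>K\<close>.\<close>

lemma has_symbol_kernel_of: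
  assumes "has_symbol K m"
  shows "has_symbol (kernel_of m) m" and "t > 0 \<Longrightarrow> AE x in lborel. kernel_of m t x = K t x"
proof -
  show *: "has_symbol (kernel_of m) m" unfolding kernel_of_def using assms by (rule someI[where P = "\<lambda>K. has_symbol K m"])
  show "AE x in lborel. kernel_of m t x = K t x" if "t > 0"
    using * assms that by (intro fourier_inj) (auto simp: has_symbol_def)
qed

lemma has_symbol_Z_kernel:
  "has_symbol (Z_kernel \<alpha> s) (\<lambda>t (\<xi>::'a::euclidean_space). mittag_leffler \<alpha> 1 (- (norm \<xi> powr (2 * s) * t powr \<alpha>)))"
  unfolding Z_kernel_def by (rule has_symbol_kernel_of(1)[OF has_symbol_Z])

lemma has_symbol_Y_kernel:
  "has_symbol (Y_kernel \<alpha> s) (\<lambda>t (\<xi>::'a::euclidean_space). t powr (\<alpha> - 1) * mittag_leffler \<alpha> \<alpha> (- (norm \<xi> powr (2 * s) * t powr \<alpha>)))"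
  unfolding Y_kernel_def by (rule has_symbol_kernel_of(1)[OF has_symbol_Y])

lemma nn_integral_Z_kernel:
  assumes "t > 0"
  shows "(\<integral>\<^sup>+x. ennreal \<bar>Z_kernel \<alpha> s t (x::'a::euclidean_space)\<bar> \<partial>lborel) \<le> 1"
proof -
  have "(\<integral>\<^sup>+x. ennreal \<bar>Z_kernel \<alpha> s t (x::'a)\<bar> \<partial>lborel) = (\<integral>\<^sup>+x. ennreal (\<bar>subordinate \<alpha> s (\<lambda>_. 1) t (x::'a)\<bar> powr 1) \<partial>lborel)"
    using has_symbol_kernel_of(2)[OF has_symbol_Z assms, where 'a = 'a] unfolding Z_kernel_def[symmetric]
    by (intro nn_integral_cong_AE) (auto elim!: eventually_mono)
  also have "\<dots> \<le> ennreal (((4 * pi) powr (- 0) * t powr (- (\<alpha> / s * 0)) * 1 * 1) powr 1)"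
  proof (rule nn_integral_subordinate_powr[OF assms])
    \<comment> \<open>An inequality instead of an equality, because \<open>0 powr 0\<close> is
      0.\<close>
    have "(\<integral>\<^sup>+a. ennreal (1 * a powr (\<alpha> / s * 0)) \<partial>stable_law \<alpha>) \<le> (\<integral>\<^sup>+a. 1 \<partial>stable_law \<alpha>)"
      by (intro nn_integral_mono) (auto simp: powr_def)
    thus "(\<integral>\<^sup>+a. ennreal (1 * a powr (\<alpha> / s * 0)) \<partial>stable_law \<alpha>) \<le> ennreal 1" using A.emeasure_space_1 by simp
    have "(\<integral>\<^sup>+a. ennreal (a powr (- 0)) \<partial>stable_law s) \<le> (\<integral>\<^sup>+a. 1 \<partial>stable_law s)"
      by (intro nn_integral_mono) (auto simp: powr_def)
    thus "(\<integral>\<^sup>+a. ennreal (a powr (- 0)) \<partial>stable_law s) \<le> ennreal 1" using S.emeasure_space_1 by simp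
  qed auto
  finally show ?thesis using assms by simp
qed

text \<open>For e < s the weight A^(-\<alpha>) of Y outweighs the factor A^(\<alpha> e/s) from the
  heat kernels. What remains is the negative moment of A of order d = \<alpha> - \<alpha> e/s, and
  the same d is the exponent \<beta>.\<close>

lemma nn_integral_Y_kernel:
  fixes r :: real
  assumes r: "1 \<le> r" and e: "DIM('a::euclidean_space) / 2 * (1 - 1 / r) < s"
  defines "\<beta> \<equiv> \<alpha> - \<alpha> / s * (DIM('a) / 2 * (1 - 1 / r))"
  shows "\<exists>C>0. \<forall>t>0. (\<integral>\<^sup>+x. ennreal (\<bar>Y_kernel \<alpha> s t (x::'a)\<bar> powr r) \<partial>lborel) \<le> ennreal ((C * t powr (\<beta> - 1)) powr r)"
proof -
  define e where "e = DIM('a) / 2 * (1 - 1 / r)"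
  have e0: "0 \<le> e" "e < s" using r e by (auto simp: e_def)
  define d where "d = \<alpha> - \<alpha> / s * e"
  have d: "d > 0" unfolding d_def using e0 \<alpha> s by (simp add: field_simps)
  obtain C1 where C1: "C1 > 0" "(\<integral>\<^sup>+x. ennreal (x powr (- d)) \<partial>stable_law \<alpha>) \<le> ennreal C1"
    using stable_law_neg_moment_finite[OF \<alpha>, of d] d by auto
  obtain C2 where C2: "C2 > 0" "(\<integral>\<^sup>+x. ennreal (x powr (- e)) \<partial>stable_law s) \<le> ennreal C2"
    using stable_law_neg_moment_finite[OF s, of e] e0 by auto
  let ?w = "\<lambda>a. \<alpha> * a powr (- \<alpha>)"
  have "(\<integral>\<^sup>+a. ennreal (?w a * a powr (\<alpha> / s * e)) \<partial>stable_law \<alpha>) = ennreal \<alpha> * (\<integral>\<^sup>+a. ennreal (a powr (- d)) \<partial>stable_law \<alpha>)"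
    using \<alpha> by (subst nn_integral_ennreal_cmult[symmetric]) (auto simp: mult.assoc powr_add[symmetric] d_def)
  also have "\<dots> \<le> ennreal \<alpha> * ennreal C1" using C1 by (intro mult_left_mono) auto
  also have "\<dots> = ennreal (\<alpha> * C1)" using \<alpha> C1 by (simp add: ennreal_mult)
  finally have W: "(\<integral>\<^sup>+a. ennreal (?w a * a powr (\<alpha> / s * e)) \<partial>stable_law \<alpha>) \<le> ennreal (\<alpha> * C1)" .
  define C where "C = (4 * pi) powr (- e) * (\<alpha> * C1) * C2"
  have C: "C > 0" using \<alpha> C1 C2 by (simp add: C_def)
  have "(\<integral>\<^sup>+x. ennreal (\<bar>Y_kernel \<alpha> s t (x::'a)\<bar> powr r) \<partial>lborel) \<le> ennreal ((C * t powr (\<beta> - 1)) powr r)" if t: "t > 0" for t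
  proof -
    have "(\<integral>\<^sup>+x. ennreal (\<bar>Y_kernel \<alpha> s t (x::'a)\<bar> powr r) \<partial>lborel) = (\<integral>\<^sup>+x. ennreal ((t powr (\<alpha> - 1)) powr r * \<bar>subordinate \<alpha> s ?w t (x::'a)\<bar> powr r) \<partial>lborel)"
      using has_symbol_kernel_of(2)[OF has_symbol_Y t, where 'a = 'a] unfolding Y_kernel_def[symmetric]
      by (intro nn_integral_cong_AE) (auto elim!: eventually_mono simp: abs_mult powr_mult)
    also have "\<dots> = ennreal ((t powr (\<alpha> - 1)) powr r) * (\<integral>\<^sup>+x. ennreal (\<bar>subordinate \<alpha> s ?w t (x::'a)\<bar> powr r) \<partial>lborel)"
    proof (rule nn_integral_ennreal_cmult)
      have [measurable]: "(\<lambda>(t, x). subordinate \<alpha> s ?w t (x::'a)) \<in> borel_measurable (borel \<Otimes>\<^sub>M borel)"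
        by (intro subordinate_measurable) auto
      show "(\<lambda>x. \<bar>subordinate \<alpha> s ?w t (x::'a)\<bar> powr r) \<in> borel_measurable lborel" by measurable
    qed auto
    also have "\<dots> \<le> ennreal ((t powr (\<alpha> - 1)) powr r) * ennreal (((4 * pi) powr (- e) * t powr (- (\<alpha> / s * e)) * (\<alpha> * C1) * C2) powr r)"
      using W C1 C2 \<alpha> by (intro mult_left_mono nn_integral_subordinate_powr[OF t r]) (auto simp: e_def)
    also have "\<dots> = ennreal ((t powr (\<alpha> - 1) * (t powr (- (\<alpha> / s * e)) * C)) powr r)"
      using \<alpha> C1 C2 by (simp add: ennreal_mult[symmetric] powr_mult C_def mult_ac)
    also have "t powr (\<alpha> - 1) * (t powr (- (\<alpha> / s * e)) * C) = C * t powr (\<beta> - 1)"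
      by (simp add: mult.assoc[symmetric] powr_add[symmetric] \<beta>_def e_def) (simp add: algebra_simps)
    finally show ?thesis .
  qed
  thus ?thesis using C by blast
qed

end

section \<open>Bounds in $L^q$\<close>

text \<open>A norm bound as a relation: no root is taken, f may take the value \<infinity>, and
  measurability is asked for only where it is used. Since \<infinity>/p is \<infinity>, bounds in
  L^q and in L^(q/p) have the same form for finite and infinite q.\<close>

definition Lq_le :: "ereal \<Rightarrow> real \<Rightarrow> ('a::euclidean_space \<Rightarrow> ennreal) \<Rightarrow> bool" where
  "Lq_le q M f \<longleftrightarrow> (if q = \<infinity> then AE x in lborel. f x \<le> ennreal M
     else (\<integral>\<^sup>+x. epow (f x) (real_of_ereal q) \<partial>lborel) \<le> ennreal (M powr real_of_ereal q))"

lemma Lq_le_infinity: "Lq_le \<infinity> M f \<longleftrightarrow> (AE x in lborel. f x \<le> ennreal M)"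
  by (simp add: Lq_le_def)

lemma Lq_le_ereal: "Lq_le (ereal q) M f \<longleftrightarrow> (\<integral>\<^sup>+x. epow (f x) q \<partial>lborel) \<le> ennreal (M powr q)"
  by (simp add: Lq_le_def)

lemma ereal_ge1_cases:
  assumes "1 \<le> q"
  obtains "q = \<infinity>" | r where "q = ereal r" "1 \<le> r"
  using assms by (cases q) auto

lemma Lq_le_mono:
  assumes "Lq_le q M g" "AE x in lborel. f x \<le> g x" "0 \<le> M" "M \<le> M'" "1 \<le> q"
  shows "Lq_le q M' f"
  using assms(5)
proof (cases rule: ereal_ge1_cases)
  case 1
  have "AE x in lborel. g x \<le> ennreal M" using assms(1) 1 by (simp add: Lq_le_infinity)
  with assms(2) have "AE x in lborel. f x \<le> ennreal M'"
    by eventually_elim (use assms(3,4) in \<open>meson ennreal_leI order_trans\<close>)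
  thus ?thesis using 1 by (simp add: Lq_le_infinity)
next
  case (2 r)
  have "(\<integral>\<^sup>+x. epow (f x) r \<partial>lborel) \<le> (\<integral>\<^sup>+x. epow (g x) r \<partial>lborel)"
    using assms(2) 2 by (intro nn_integral_mono_AE) (auto elim!: eventually_mono intro!: epow_mono)
  also have "\<dots> \<le> ennreal (M powr r)" using assms(1) 2 by (simp add: Lq_le_ereal)
  also have "\<dots> \<le> ennreal (M' powr r)" using assms(3,4) 2 by (intro ennreal_leI powr_mono2) auto
  finally show ?thesis using 2 by (simp add: Lq_le_ereal)
qed

lemma Lq_le_cmult:
  assumes [measurable]: "f \<in> borel_measurable borel" and "Lq_le q M f" "0 \<le> c" "0 \<le> M" "1 \<le> q"
  shows "Lq_le q (c * M) (\<lambda>x. ennreal c * f x)"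
  using assms(5)
proof (cases rule: ereal_ge1_cases)
  case 1
  thus ?thesis using assms by (auto simp: Lq_le_infinity ennreal_mult elim!: eventually_mono intro!: mult_left_mono)
next
  case (2 r)
  have "(\<integral>\<^sup>+x. epow (ennreal c * f x) r \<partial>lborel) = ennreal (c powr r) * (\<integral>\<^sup>+x. epow (f x) r \<partial>lborel)"
    using assms 2 by (subst nn_integral_cmult[symmetric]) (auto simp: epow_cmult)
  also have "\<dots> \<le> ennreal (c powr r) * ennreal (M powr r)"
    using assms(2) 2 by (intro mult_left_mono) (auto simp: Lq_le_ereal)
  also have "\<dots> = ennreal ((c * M) powr r)" by (simp add: ennreal_mult[symmetric] powr_mult)
  finally show ?thesis using 2 by (simp add: Lq_le_ereal)
qed

text \<open>In place of the triangle inequality: f + g \<le> 2 max(f, g), and the r-th power of the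
  maximum is at most the sum of the powers. The factor 4 is harmless in all later uses.\<close>

lemma Lq_le_add:
  assumes [measurable]: "f \<in> borel_measurable borel" "g \<in> borel_measurable borel"
    and "Lq_le q a f" "Lq_le q b g" "0 \<le> a" "0 \<le> b" "1 \<le> q"
  shows "Lq_le q (4 * (a + b)) (\<lambda>x. f x + g x)"
  using assms(7)
proof (cases rule: ereal_ge1_cases)
  case 1
  have "AE x in lborel. f x \<le> ennreal a" "AE x in lborel. g x \<le> ennreal b"
    using assms 1 by (auto simp: Lq_le_infinity)
  hence "AE x in lborel. f x + g x \<le> ennreal (4 * (a + b))"
  proof eventually_elim
    case (elim x)
    hence "f x + g x \<le> ennreal a + ennreal b" by (rule add_mono)
    also have "\<dots> \<le> ennreal (4 * (a + b))" using assms by (simp add: ennreal_plus[symmetric] ennreal_leI del: ennreal_plus)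
    finally show ?case .
  qed
  thus ?thesis using 1 by (simp add: Lq_le_infinity)
next
  case (2 r)
  have pw: "epow (f x + g x) r \<le> ennreal (2 powr r) * (epow (f x) r + epow (g x) r)" for x
  proof -
    have "f x + g x \<le> ennreal 2 * max (f x) (g x)"
    proof -
      have "f x + g x \<le> max (f x) (g x) + max (f x) (g x)" by (intro add_mono) auto
      thus ?thesis by (simp add: mult_2)
    qed
    hence "epow (f x + g x) r \<le> epow (ennreal 2 * max (f x) (g x)) r" using 2 by (intro epow_mono) auto
    also have "\<dots> = ennreal (2 powr r) * epow (max (f x) (g x)) r" using 2 by (intro epow_cmult) auto
    also have "epow (max (f x) (g x)) r \<le> epow (f x) r + epow (g x) r"
      by (cases "f x \<le> g x") (auto simp: max_def)
    finally show ?thesis by (simp add: mult_left_mono)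
  qed
  have "(\<integral>\<^sup>+x. epow (f x + g x) r \<partial>lborel) \<le> (\<integral>\<^sup>+x. ennreal (2 powr r) * (epow (f x) r + epow (g x) r) \<partial>lborel)"
    by (intro nn_integral_mono pw)
  also have "\<dots> = ennreal (2 powr r) * ((\<integral>\<^sup>+x. epow (f x) r \<partial>lborel) + (\<integral>\<^sup>+x. epow (g x) r \<partial>lborel))"
    by (simp add: nn_integral_cmult nn_integral_add)
  also have "\<dots> \<le> ennreal (2 powr r) * (ennreal ((a + b) powr r) + ennreal ((a + b) powr r))"
  proof (intro mult_left_mono add_mono)
    have "(\<integral>\<^sup>+x. epow (f x) r \<partial>lborel) \<le> ennreal (a powr r)" using assms 2 by (simp add: Lq_le_ereal)
    also have "\<dots> \<le> ennreal ((a + b) powr r)" using assms 2 by (intro ennreal_leI powr_mono2) auto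
    finally show "(\<integral>\<^sup>+x. epow (f x) r \<partial>lborel) \<le> ennreal ((a + b) powr r)" .
    have "(\<integral>\<^sup>+x. epow (g x) r \<partial>lborel) \<le> ennreal (b powr r)" using assms 2 by (simp add: Lq_le_ereal)
    also have "\<dots> \<le> ennreal ((a + b) powr r)" using assms 2 by (intro ennreal_leI powr_mono2) auto
    finally show "(\<integral>\<^sup>+x. epow (g x) r \<partial>lborel) \<le> ennreal ((a + b) powr r)" .
  qed simp
  also have "\<dots> = ennreal (2 powr r * (2 * (a + b) powr r))"
    by (simp add: ennreal_mult[symmetric] ennreal_plus[symmetric] del: ennreal_plus)
  also have "2 powr r * (2 * (a + b) powr r) \<le> (4 * (a + b)) powr r"
  proof -
    have "2 powr 1 \<le> 2 powr r" using 2 by (intro powr_mono) auto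
    hence "2 powr r * (2 * (a + b) powr r) \<le> 2 powr r * (2 powr r * (a + b) powr r)"
      by (intro mult_left_mono mult_right_mono) auto
    also have "\<dots> = (2 * 2 * (a + b)) powr r" by (simp only: powr_mult mult.assoc)
    finally show ?thesis by simp
  qed
  finally show ?thesis using 2 by (simp add: Lq_le_ereal ennreal_leI)
qed

lemma Lq_le_SUP:
  assumes [measurable]: "\<And>n. f n \<in> borel_measurable borel" and f: "incseq f" "\<And>n. Lq_le q M (f n)" and q: "1 \<le> q"
  shows "Lq_le q M (\<lambda>x. SUP n. f n x)"
  using q
proof (cases rule: ereal_ge1_cases)
  case 1
  have "AE x in lborel. \<forall>n. f n x \<le> ennreal M" using f(2) 1 by (simp add: Lq_le_infinity AE_all_countable)
  thus ?thesis using 1 by (auto simp: Lq_le_infinity elim!: eventually_mono intro!: SUP_least)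
next
  case (2 r)
  have inc: "incseq (\<lambda>n. f n x)" for x using f(1) by (auto simp: incseq_def le_fun_def)
  have "(\<integral>\<^sup>+x. epow (SUP n. f n x) r \<partial>lborel) = (\<integral>\<^sup>+x. (SUP n. epow (f n x) r) \<partial>lborel)"
    using 2 by (intro nn_integral_cong) (simp add: SUP_epow[OF inc])
  also have "\<dots> = (SUP n. \<integral>\<^sup>+x. epow (f n x) r \<partial>lborel)"
    using f(1) 2 by (intro nn_integral_monotone_convergence_SUP) (auto simp: incseq_def le_fun_def intro!: epow_mono)
  also have "\<dots> \<le> ennreal (M powr r)" using f(2) 2 by (intro SUP_least) (simp add: Lq_le_ereal)
  finally show ?thesis using 2 by (simp add: Lq_le_ereal)
qed

lemma Lq_le_finite:
  assumes [measurable]: "f \<in> borel_measurable borel" and "Lq_le q M f" and q: "1 \<le> q"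
  shows "AE x in lborel. f x < \<top>"
  using q
proof (cases rule: ereal_ge1_cases)
  case 1
  thus ?thesis using assms by (auto simp: Lq_le_infinity elim!: eventually_mono intro: le_less_trans)
next
  case (2 r)
  have "(\<integral>\<^sup>+x. epow (f x) r \<partial>lborel) \<noteq> \<infinity>" using assms 2 by (auto simp: Lq_le_ereal top_unique)
  hence "AE x in lborel. epow (f x) r \<noteq> \<infinity>" by (intro nn_integral_PInf_AE) auto
  thus ?thesis by (auto simp: less_top)
qed

text \<open>Norms tending to 0 need not force pointwise convergence of the \<open>f n\<close>, but
  their infimum lies below each of them and so has norm 0. This is what the later Cauchy argument
  uses.\<close>

lemma Lq_le_null_seq:
  assumes [measurable]: "\<And>n. f n \<in> borel_measurable borel" and f: "\<And>n. Lq_le q (c n) (f n)" and c: "c \<longlonglongrightarrow> 0" "\<And>n. 0 \<le> c n" and q: "1 \<le> q"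
  shows "AE x in lborel. (INF n. f n x) = 0"
  using q
proof (cases rule: ereal_ge1_cases)
  case 1
  have "AE x in lborel. \<forall>n. f n x \<le> ennreal (c n)" using f 1 by (simp add: Lq_le_infinity AE_all_countable)
  thus ?thesis
  proof eventually_elim
    case (elim x)
    have "(\<lambda>n. ennreal (c n)) \<longlonglongrightarrow> ennreal 0" using c by (intro tendsto_ennrealI)
    hence "(INF n. f n x) \<le> ennreal 0"
      by (rule tendsto_lowerbound) (use elim in \<open>auto intro!: always_eventually INF_lower2\<close>)
    thus ?case by simp
  qed
next
  case (2 r)
  have "(\<lambda>n. ennreal (c n powr r)) \<longlonglongrightarrow> ennreal (0 powr r)"
    using c 2 by (intro tendsto_ennrealI tendsto_powr') auto
  hence "(\<integral>\<^sup>+x. epow (INF n. f n x) r \<partial>lborel) \<le> ennreal (0 powr r)"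
  proof (rule tendsto_lowerbound)
    show "\<forall>\<^sub>F n in sequentially. (\<integral>\<^sup>+x. epow (INF n. f n x) r \<partial>lborel) \<le> ennreal (c n powr r)"
    proof (intro always_eventually allI)
      fix n
      have "(\<integral>\<^sup>+x. epow (INF n. f n x) r \<partial>lborel) \<le> (\<integral>\<^sup>+x. epow (f n x) r \<partial>lborel)"
        using 2 by (intro nn_integral_mono epow_mono INF_lower) auto
      also have "\<dots> \<le> ennreal (c n powr r)" using f 2 by (simp add: Lq_le_ereal)
      finally show "(\<integral>\<^sup>+x. epow (INF n. f n x) r \<partial>lborel) \<le> ennreal (c n powr r)" .
    qed
  qed simp
  hence "AE x in lborel. epow (INF n. f n x) r = 0"
    by (subst nn_integral_0_iff_AE[symmetric]) auto
  thus ?thesis by simp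
qed

text \<open>The link to the norms of the statement. If the power is not integrable, both sides fail:
  \<open>Lq_norm\<close> is then infinite, and so is the nonnegative integral.\<close>

lemma Lq_le_norm_iff:
  fixes f :: "'a::euclidean_space \<Rightarrow> real"
  assumes [measurable]: "f \<in> borel_measurable borel" and C: "0 \<le> C" and q: "1 \<le> q"
  shows "Lq_norm q f \<le> ereal C \<longleftrightarrow> Lq_le q C (\<lambda>x. ennreal \<bar>f x\<bar>)"
  using q
proof (cases rule: ereal_ge1_cases)
  case 1
  have "esssup lborel (\<lambda>x. ereal \<bar>f x\<bar>) \<le> ereal C \<longleftrightarrow> (AE x in lborel. ereal \<bar>f x\<bar> \<le> ereal C)"
  proof
    assume a: "esssup lborel (\<lambda>x. ereal \<bar>f x\<bar>) \<le> ereal C"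
    show "AE x in lborel. ereal \<bar>f x\<bar> \<le> ereal C"
      using esssup_AE[of "\<lambda>x. ereal \<bar>f x\<bar>" lborel] by (rule eventually_mono) (rule order_trans[OF _ a])
  qed (auto intro!: esssup_I)
  thus ?thesis using 1 C by (simp add: Lq_norm_def Lq_le_infinity ennreal_le_iff)
next
  case (2 r)
  have eq: "(\<integral>\<^sup>+x. epow (ennreal \<bar>f x\<bar>) r \<partial>lborel) = (\<integral>\<^sup>+x. ennreal (\<bar>f x\<bar> powr r) \<partial>lborel)"
    by (simp add: epow_ennreal)
  show ?thesis
  proof (cases "integrable lborel (\<lambda>x. \<bar>f x\<bar> powr r)")
    case True
    have I0: "0 \<le> (\<integral>x. \<bar>f x\<bar> powr r \<partial>lborel)" by simp
    have "(\<integral>\<^sup>+x. ennreal (\<bar>f x\<bar> powr r) \<partial>lborel) = ennreal (\<integral>x. \<bar>f x\<bar> powr r \<partial>lborel)"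
      using True by (intro nn_integral_eq_integral) auto
    moreover have "(\<integral>x. \<bar>f x\<bar> powr r \<partial>lborel) powr (1 / r) \<le> C \<longleftrightarrow> (\<integral>x. \<bar>f x\<bar> powr r \<partial>lborel) \<le> C powr r" (is "?I powr _ \<le> C \<longleftrightarrow> _")
    proof
      assume "?I powr (1 / r) \<le> C"
      hence "(?I powr (1 / r)) powr r \<le> C powr r" using 2 by (intro powr_mono2) auto
      thus "?I \<le> C powr r" using 2 I0 by (simp add: powr_powr)
    next
      assume "?I \<le> C powr r"
      hence "?I powr (1 / r) \<le> (C powr r) powr (1 / r)" using 2 I0 by (intro powr_mono2) auto
      thus "?I powr (1 / r) \<le> C" using 2 C by (simp add: powr_powr)
    qed
    ultimately show ?thesis using True 2 by (simp add: Lq_norm_def Lq_le_ereal eq ennreal_le_iff)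
  next
    case False
    have "(\<integral>\<^sup>+x. ennreal (\<bar>f x\<bar> powr r) \<partial>lborel) = \<top>"
      using False by (intro ccontr[of "_ = \<top>"]) (auto simp: less_top intro!: integrableI_nonneg)
    thus ?thesis using False 2 by (simp add: Lq_norm_def Lq_le_ereal eq top_unique)
  qed
qed

text \<open>Hoelder's inequality with the exponents p/(p - 1) and p. U is normalised by M and d by
  b, and the weighted mean inequality is applied to the r-th powers of the quotients; its third term
  is the idle \<open>1 powr 0\<close>.\<close>

lemma Lq_le_power_mult:
  fixes U d :: "'a::euclidean_space \<Rightarrow> ennreal"
  assumes [measurable]: "U \<in> borel_measurable borel" "d \<in> borel_measurable borel"
    and U: "Lq_le q M U" and d: "Lq_le q b d" and M: "0 < M" and b: "0 < b" and p: "1 < p" "ereal p \<le> q"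
  shows "Lq_le (q / ereal p) (M powr (p - 1) * b) (\<lambda>x. epow (U x) (p - 1) * d x)"
proof (cases q)
  case PInf
  have "AE x in lborel. U x \<le> ennreal M" "AE x in lborel. d x \<le> ennreal b"
    using U d PInf by (auto simp: Lq_le_infinity)
  hence "AE x in lborel. epow (U x) (p - 1) * d x \<le> ennreal (M powr (p - 1) * b)"
  proof eventually_elim
    case (elim x)
    have "epow (U x) (p - 1) \<le> epow (ennreal M) (p - 1)" using elim p by (intro epow_mono) auto
    also have "\<dots> = ennreal (M powr (p - 1))" using M by (simp add: epow_ennreal)
    finally have "epow (U x) (p - 1) * d x \<le> ennreal (M powr (p - 1)) * ennreal b" using elim by (intro mult_mono) auto
    thus ?case using b by (simp add: ennreal_mult)
  qed
  thus ?thesis using PInf p by (simp add: Lq_le_infinity)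
next
  case (real r)
  define m where "m = r / p"
  have rp: "r \<ge> p" "r > 1" using p real by auto
  hence m: "m \<ge> 1" using p by (simp add: m_def)
  have fin: "AE x in lborel. U x < \<top>" "AE x in lborel. d x < \<top>"
    using Lq_le_finite[OF _ U] Lq_le_finite[OF _ d] rp real by (auto simp: one_ereal_def)
  let ?c = "M powr (p - 1) * b"
  have c: "?c > 0" using M b by simp
  have "(\<integral>\<^sup>+x. epow (epow (U x) (p - 1) * d x) m \<partial>lborel) \<le>
      (\<integral>\<^sup>+x. ennreal (?c powr m) * (ennreal ((1 - 1 / p) / M powr r) * epow (U x) r + ennreal ((1 / p) / b powr r) * epow (d x) r) \<partial>lborel)"
  proof (intro nn_integral_mono_AE)
    show "AE x in lborel. epow (epow (U x) (p - 1) * d x) m \<le> ennreal (?c powr m) * (ennreal ((1 - 1 / p) / M powr r) * epow (U x) r + ennreal ((1 / p) / b powr r) * epow (d x) r)"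
      using fin
    proof eventually_elim
      case (elim x)
      then obtain u v where uv: "U x = ennreal u" "u \<ge> 0" "d x = ennreal v" "v \<ge> 0"
        by (metis less_top ennreal_cases)
      have "(u powr (p - 1) * v) powr m = ?c powr m * ((u / M) powr r) powr (1 - 1 / p) * ((v / b) powr r) powr (1 / p)"
      proof -
        have e: "r * (1 - 1 / p) = (p - 1) * m" using p by (simp add: m_def field_simps)
        have "((u / M) powr r) powr (1 - 1 / p) = (u / M) powr ((p - 1) * m)"
          by (simp only: powr_powr e)
        moreover have "((v / b) powr r) powr (1 / p) = (v / b) powr m" by (simp add: powr_powr m_def)
        ultimately show ?thesis
          using M b by (simp add: powr_mult powr_powr powr_divide)
      qed
      also have "\<dots> = ?c powr m * (((u / M) powr r) powr (1 - 1 / p) * ((v / b) powr r) powr (1 / p) * 1 powr 0)" by simp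
      also have "\<dots> \<le> ?c powr m * ((1 - 1 / p) * (u / M) powr r + (1 / p) * (v / b) powr r + 0 * 1)"
        using p by (intro mult_left_mono weighted_am_gm3) auto
      also have "\<dots> = ?c powr m * ((1 - 1 / p) / M powr r * u powr r + (1 / p) / b powr r * v powr r)"
        using M b by (simp add: powr_divide)
      finally have "ennreal ((u powr (p - 1) * v) powr m) \<le> ennreal (?c powr m * ((1 - 1 / p) / M powr r * u powr r + (1 / p) / b powr r * v powr r))"
        by (rule ennreal_leI)
      also have "\<dots> = ennreal (?c powr m) * (ennreal ((1 - 1 / p) / M powr r) * ennreal (u powr r) + ennreal ((1 / p) / b powr r) * ennreal (v powr r))"
        using p by (simp add: ennreal_mult[symmetric] ennreal_plus[symmetric] del: ennreal_plus)
      finally show ?case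
        using uv by (simp add: epow_ennreal ennreal_mult[symmetric])
    qed
  qed
  also have "\<dots> = ennreal (?c powr m) * (ennreal ((1 - 1 / p) / M powr r) * (\<integral>\<^sup>+x. epow (U x) r \<partial>lborel) + ennreal ((1 / p) / b powr r) * (\<integral>\<^sup>+x. epow (d x) r \<partial>lborel))"
    by (simp add: nn_integral_cmult nn_integral_add)
  also have "\<dots> \<le> ennreal (?c powr m) * (ennreal ((1 - 1 / p) / M powr r) * ennreal (M powr r) + ennreal ((1 / p) / b powr r) * ennreal (b powr r))"
    using U d real by (intro mult_left_mono add_mono) (auto simp: Lq_le_ereal)
  also have "\<dots> = ennreal (?c powr m * ((1 - 1 / p) / M powr r * M powr r + (1 / p) / b powr r * b powr r))"
    using p by (simp add: ennreal_mult[symmetric] ennreal_plus[symmetric] del: ennreal_plus)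
  also have "(1 - 1 / p) / M powr r * M powr r + (1 / p) / b powr r * b powr r = 1"
    using M b by simp
  finally show ?thesis using real p by (simp add: Lq_le_ereal m_def)
qed (use p in auto)

section \<open>Reflections and slices of space-time integrals\<close>

lemma nn_integral_reflect:
  fixes h :: "'a::euclidean_space \<Rightarrow> ennreal"
  assumes [measurable]: "h \<in> borel_measurable borel"
  shows "(\<integral>\<^sup>+y. h (x - y) \<partial>lborel) = (\<integral>\<^sup>+y. h y \<partial>lborel)"
proof -
  have "(\<integral>\<^sup>+y. h y \<partial>lborel) = (\<integral>\<^sup>+y. h y \<partial>(density (distr lborel borel (\<lambda>z. x + (- 1) *\<^sub>R z)) (\<lambda>_. ennreal (\<bar>- 1\<bar> ^ DIM('a)))))"
    by (subst lborel_affine[of "- 1" x]) auto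
  also have "\<dots> = (\<integral>\<^sup>+y. h (x - y) \<partial>lborel)"
    by (simp add: nn_integral_density nn_integral_distr)
  finally show ?thesis by simp
qed

lemma nn_integral_lborel_pair:
  fixes f :: "'a::euclidean_space \<times> 'b::euclidean_space \<Rightarrow> ennreal"
  assumes "f \<in> borel_measurable borel"
  shows "(\<integral>\<^sup>+z. f z \<partial>lborel) = (\<integral>\<^sup>+x. \<integral>\<^sup>+y. f (x, y) \<partial>lborel \<partial>lborel)"
proof -
  have "(\<integral>\<^sup>+x. \<integral>\<^sup>+y. f (x, y) \<partial>lborel \<partial>lborel) = (\<integral>\<^sup>+z. f z \<partial>(lborel \<Otimes>\<^sub>M lborel))"
    using assms by (intro lborel.nn_integral_fst) (simp add: lborel_prod)
  thus ?thesis by (simp add: lborel_prod)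
qed

lemma AE_lborel_pairD:
  fixes P :: "'a::euclidean_space \<times> 'b::euclidean_space \<Rightarrow> bool"
  assumes "AE z in lborel. P z"
  shows "AE x in lborel. AE y in lborel. P (x, y)"
proof -
  have "AE z in lborel \<Otimes>\<^sub>M lborel. P z" using assms by (simp only: lborel_prod)
  thus ?thesis by (rule lborel_pair.AE_pair)
qed

lemma AE_lborel_pairI:
  fixes P :: "'a::euclidean_space \<times> 'b::euclidean_space \<Rightarrow> bool"
  assumes "{z. P z} \<in> sets borel" "AE x in lborel. AE y in lborel. P (x, y)"
  shows "AE z in lborel. P z"
proof -
  have "sets (lborel \<Otimes>\<^sub>M lborel) = sets (borel :: ('a \<times> 'b) measure)"
    by (simp only: lborel_prod sets_lborel)
  hence "AE z in lborel \<Otimes>\<^sub>M lborel. P z"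
    using assms by (intro lborel_pair.AE_pair_measure) (simp_all only: space_pair_measure, simp_all)
  thus ?thesis by (simp only: lborel_prod)
qed

section \<open>Young's inequality in space-time\<close>

text \<open>A convolution over all of space-time. Only the lower limit of the time integral is
  written out; the upper one is supplied by kernels that vanish at nonpositive times.\<close>

definition duhamel :: "(real \<times> 'a::euclidean_space \<Rightarrow> real) \<Rightarrow> (real \<times> 'a \<Rightarrow> ennreal) \<Rightarrow> real \<times> 'a \<Rightarrow> ennreal" where
  "duhamel G f w = (\<integral>\<^sup>+z. indicator {0<..} (fst z) * (ennreal \<bar>G (w - z)\<bar> * f z) \<partial>lborel)"

definition causal_kernel :: "(real \<times> 'a::euclidean_space \<Rightarrow> real) \<Rightarrow> bool" where
  "causal_kernel G \<longleftrightarrow> G \<in> borel_measurable borel \<and> (\<forall>z. fst z \<le> 0 \<longrightarrow> G z = 0)"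

lemma duhamel_measurable [measurable]:
  assumes "causal_kernel G" and [measurable]: "f \<in> borel_measurable borel"
  shows "duhamel G f \<in> borel_measurable borel"
proof -
  have [measurable]: "G \<in> borel_measurable borel" using assms by (simp add: causal_kernel_def)
  show ?thesis unfolding duhamel_def[abs_def] by measurable
qed

text \<open>Causality of G makes f irrelevant at times not before that of w, so bounds known only up
  to a final time suffice.\<close>

lemma duhamel_mono_AE:
  assumes G: "causal_kernel G" and "AE z in lborel. 0 < fst z \<and> fst z < fst w \<longrightarrow> f z \<le> g z"
  shows "duhamel G f w \<le> duhamel G g w"
  unfolding duhamel_def
proof (rule nn_integral_mono_AE)
  show "AE z in lborel. indicator {0<..} (fst z) * (ennreal \<bar>G (w - z)\<bar> * f z) \<le> indicator {0<..} (fst z) * (ennreal \<bar>G (w - z)\<bar> * g z)"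
    using assms(2)
  proof eventually_elim
    case (elim z)
    show ?case
    proof (cases "0 < fst z \<and> fst z < fst w")
      case False
      hence "fst z \<le> 0 \<or> G (w - z) = 0"
        using G unfolding causal_kernel_def by (metis fst_diff diff_le_0_iff_le not_less)
      thus ?thesis by (auto split: split_indicator)
    qed (use elim in \<open>auto intro!: mult_left_mono\<close>)
  qed
qed

text \<open>\<open>r\<close> is the exponent of Young's inequality from $L^{q/p}$ to $L^q$: $1 + 1/q = p/q + 1/r$.\<close>

definition kernel_bound :: "real \<Rightarrow> ereal \<Rightarrow> (real \<times> 'a::euclidean_space \<Rightarrow> real) \<Rightarrow> (real \<Rightarrow> real) \<Rightarrow> bool" where
  "kernel_bound p q G \<kappa> \<longleftrightarrow> (\<forall>t>0. 0 < \<kappa> t \<and>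
     (let r = (if q = \<infinity> then 1 else 1 / (1 - (p - 1) / real_of_ereal q))
      in (\<integral>\<^sup>+x. ennreal (\<bar>G (t, x)\<bar> powr r) \<partial>lborel) \<le> ennreal (\<kappa> t powr r)))"

text \<open>For finite q, Young's inequality in space and the integration in time are one
  application of Hoelder's inequality over space-time. With g = |G|/\<kappa> and h = f/\<phi>
  normalised at each time and c = \<kappa> \<phi>, the integrand c g h is the product of the powers
  1/Q, 1 - 1/m and 1 - 1/r of c g^r h^m, c g^r and c h^m. The weight c depends on time only and has
  integral at most W.\<close>

lemma duhamel_Lq_le:
  fixes f :: "real \<times> 'a::euclidean_space \<Rightarrow> ennreal" and \<kappa> \<phi> :: "real \<Rightarrow> real"
  assumes G: "causal_kernel G" and [measurable]: "f \<in> borel_measurable borel" "\<kappa> \<in> borel_measurable borel" "\<phi> \<in> borel_measurable borel"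
    and K: "kernel_bound p q G \<kappa>" and p: "1 \<le> p" "ereal p \<le> q"
    and \<phi>: "\<And>\<tau>. 0 < \<tau> \<Longrightarrow> 0 < \<phi> \<tau>"
    and f: "AE \<tau> in lborel. 0 < \<tau> \<and> \<tau> < t \<longrightarrow> Lq_le (q / ereal p) (\<phi> \<tau>) (\<lambda>y. f (\<tau>, y))"
    and W: "(\<integral>\<^sup>+\<tau>. ennreal (indicator {0<..<t} \<tau> * (\<kappa> (t - \<tau>) * \<phi> \<tau>)) \<partial>lborel) \<le> ennreal W" "0 < W"
  shows "Lq_le q W (\<lambda>x. duhamel G f (t, x))"
proof (cases q)
  case MInf
  thus ?thesis using p by simp
next
  case PInf
  have [measurable]: "G \<in> borel_measurable borel" using G by (simp add: causal_kernel_def)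
  have f\<tau>: "AE \<tau> in lborel. 0 < \<tau> \<and> \<tau> < t \<longrightarrow> (AE y in lborel. f (\<tau>, y) \<le> ennreal (\<phi> \<tau>))"
    using f p PInf by (simp add: Lq_le_infinity)
  have Kt: "(\<integral>\<^sup>+y. ennreal \<bar>G (\<tau>, y)\<bar> \<partial>lborel) \<le> ennreal (\<kappa> \<tau>)" "0 < \<kappa> \<tau>" if "\<tau> > 0" for \<tau>
    using K PInf that by (auto simp: kernel_bound_def)
  have "duhamel G f (t, x) \<le> ennreal W" for x
  proof -
    have "duhamel G f (t, x) = (\<integral>\<^sup>+\<tau>. \<integral>\<^sup>+y. indicator {0<..} \<tau> * (ennreal \<bar>G (t - \<tau>, x - y)\<bar> * f (\<tau>, y)) \<partial>lborel \<partial>lborel)"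
      unfolding duhamel_def by (subst nn_integral_lborel_pair) auto
    also have "\<dots> \<le> (\<integral>\<^sup>+\<tau>. ennreal (indicator {0<..<t} \<tau> * (\<kappa> (t - \<tau>) * \<phi> \<tau>)) \<partial>lborel)"
    proof (rule nn_integral_mono_AE)
      show "AE \<tau> in lborel. (\<integral>\<^sup>+y. indicator {0<..} \<tau> * (ennreal \<bar>G (t - \<tau>, x - y)\<bar> * f (\<tau>, y)) \<partial>lborel)
          \<le> ennreal (indicator {0<..<t} \<tau> * (\<kappa> (t - \<tau>) * \<phi> \<tau>))"
        using f\<tau>
      proof eventually_elim
        case (elim \<tau>)
        show ?case
        proof (cases "0 < \<tau> \<and> \<tau> < t")
          case True
          hence "(\<integral>\<^sup>+y. indicator {0<..} \<tau> * (ennreal \<bar>G (t - \<tau>, x - y)\<bar> * f (\<tau>, y)) \<partial>lborel)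
              \<le> (\<integral>\<^sup>+y. ennreal \<bar>G (t - \<tau>, x - y)\<bar> * ennreal (\<phi> \<tau>) \<partial>lborel)"
            using elim by (intro nn_integral_mono_AE) (auto elim!: eventually_mono intro!: mult_left_mono)
          also have "\<dots> = (\<integral>\<^sup>+y. ennreal \<bar>G (t - \<tau>, x - y)\<bar> \<partial>lborel) * ennreal (\<phi> \<tau>)"
            by (intro nn_integral_multc) measurable
          also have "(\<integral>\<^sup>+y. ennreal \<bar>G (t - \<tau>, x - y)\<bar> \<partial>lborel) = (\<integral>\<^sup>+y. ennreal \<bar>G (t - \<tau>, y)\<bar> \<partial>lborel)"
            by (rule nn_integral_reflect[where h = "\<lambda>y. ennreal \<bar>G (t - \<tau>, y)\<bar>"]) measurable
          also have "\<dots> * ennreal (\<phi> \<tau>) \<le> ennreal (\<kappa> (t - \<tau>)) * ennreal (\<phi> \<tau>)"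
            using True by (intro mult_right_mono Kt) auto
          also have "\<dots> = ennreal (\<kappa> (t - \<tau>) * \<phi> \<tau>)" using True Kt(2)[of "t - \<tau>"] \<phi>[of \<tau>] by (simp add: ennreal_mult)
          finally show ?thesis using True by simp
        next
          case False
          hence "\<tau> \<le> 0 \<or> (\<forall>y. G (t - \<tau>, x - y) = 0)" using G by (auto simp: causal_kernel_def)
          thus ?thesis by (auto split: split_indicator)
        qed
      qed
    qed
    also note W(1)
    finally show ?thesis .
  qed
  thus ?thesis using PInf by (simp add: Lq_le_infinity)
next
  case (real Q)
  have [measurable]: "G \<in> borel_measurable borel" using G by (simp add: causal_kernel_def)
  define m where "m = Q / p"
  define r where "r = 1 / (1 - (p - 1) / Q)"
  have Q: "Q \<ge> p" "Q \<ge> 1" using p real by auto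
  have m: "m \<ge> 1" using p Q by (simp add: m_def)
  have "(p - 1) / Q < 1" using Q p by simp
  hence r: "r > 0" "1 / r = 1 - (p - 1) / Q" by (auto simp: r_def)
  have Kt: "(\<integral>\<^sup>+y. ennreal (\<bar>G (\<tau>, y)\<bar> powr r) \<partial>lborel) \<le> ennreal (\<kappa> \<tau> powr r)" and K0: "0 < \<kappa> \<tau>" if "\<tau> > 0" for \<tau>
    using K real that by (auto simp: kernel_bound_def r_def Let_def)
  have f\<tau>: "AE \<tau> in lborel. 0 < \<tau> \<and> \<tau> < t \<longrightarrow> (\<integral>\<^sup>+y. epow (f (\<tau>, y)) m \<partial>lborel) \<le> ennreal (\<phi> \<tau> powr m)"
    using f p real by (simp add: Lq_le_ereal m_def)
  define D where "D z \<longleftrightarrow> 0 < fst z \<and> fst z < t" for z :: "real \<times> 'a"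
  have [measurable]: "Measurable.pred borel D" unfolding D_def by measurable
  define c where "c z = \<kappa> (t - fst z) * \<phi> (fst z)" for z :: "real \<times> 'a"
  have c: "c z > 0" if "D z" for z using that \<phi> K0 by (simp add: c_def D_def)
  have [measurable]: "c \<in> borel_measurable borel" unfolding c_def by measurable
  \<comment> \<open>Hoelder's inequality is stated for real functions. On the strip f is finite
    almost everywhere, because its slices have finite norms.\<close>
  define fr where "fr z = enn2real (f z)" for z
  have fr0: "0 \<le> fr z" for z by (simp add: fr_def)
  have [measurable]: "fr \<in> borel_measurable borel" unfolding fr_def by measurable
  have ffr: "AE z in lborel. D z \<longrightarrow> f z = ennreal (fr z)"
  proof (rule AE_lborel_pairI)
    show "AE \<tau> in lborel. AE y in lborel. D (\<tau>, y) \<longrightarrow> f (\<tau>, y) = ennreal (fr (\<tau>, y))"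
      using f\<tau>
    proof eventually_elim
      case (elim \<tau>)
      show ?case
      proof (cases "0 < \<tau> \<and> \<tau> < t")
        case True
        hence "Lq_le (ereal m) (\<phi> \<tau>) (\<lambda>y. f (\<tau>, y))" using elim by (simp add: Lq_le_ereal)
        hence "AE y in lborel. f (\<tau>, y) < \<top>" using m by (intro Lq_le_finite[of _ "ereal m"]) (auto simp: one_ereal_def)
        thus ?thesis by eventually_elim (simp add: fr_def)
      qed (auto simp: D_def)
    qed
  qed measurable
  define g where "g x z = \<bar>G ((t, x) - z)\<bar> / \<kappa> (t - fst z)" for x z
  define h where "h z = fr z / \<phi> (fst z)" for z
  have [measurable]: "(\<lambda>(x, z). g x z) \<in> borel_measurable (borel \<Otimes>\<^sub>M borel)" "h \<in> borel_measurable borel"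
    unfolding g_def h_def by measurable
  have g0: "0 \<le> g x z" "0 \<le> h z" if "D z" for x z
    using that K0[of "t - fst z"] \<phi>[of "fst z"] by (auto simp: g_def h_def fr_def D_def)
  define X where "X x z = (if D z then c z * g x z powr r * h z powr m else 0)" for x z
  define Y where "Y x z = (if D z then c z * g x z powr r else 0)" for x z
  define Z where "Z z = (if D z then c z * h z powr m else 0)" for z
  define H where "H x z = (if D z then \<bar>G ((t, x) - z)\<bar> * fr z else 0)" for x z
  have [measurable]: "(\<lambda>(x, z). X x z) \<in> borel_measurable (lborel \<Otimes>\<^sub>M lborel)" unfolding X_def by measurable
  have [measurable]: "(\<lambda>(x, z). Y x z) \<in> borel_measurable (lborel \<Otimes>\<^sub>M lborel)" unfolding Y_def by measurable
  have [measurable]: "Z \<in> borel_measurable borel" unfolding Z_def by measurable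
  have [measurable]: "(\<lambda>(x, z). H x z) \<in> borel_measurable (lborel \<Otimes>\<^sub>M lborel)" unfolding H_def by measurable
  have duhamel_H: "duhamel G f (t, x) = (\<integral>\<^sup>+z. ennreal (H x z) \<partial>lborel)" for x
    unfolding duhamel_def
  proof (rule nn_integral_cong_AE)
    show "AE z in lborel. indicator {0<..} (fst z) * (ennreal \<bar>G ((t, x) - z)\<bar> * f z) = ennreal (H x z)"
      using ffr
    proof eventually_elim
      case (elim z)
      show ?case
      proof (cases "D z")
        case True
        thus ?thesis using elim fr0 by (simp add: H_def D_def ennreal_mult)
      next
        case False
        hence "fst z \<le> 0 \<or> G ((t, x) - z) = 0"
          using G unfolding causal_kernel_def D_def by (metis fst_diff fst_conv diff_le_0_iff_le not_less)
        thus ?thesis using False by (auto simp: H_def split: split_indicator)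
      qed
    qed
  qed
  have gint: "(\<integral>\<^sup>+y. ennreal (g x (\<tau>, y) powr r) \<partial>lborel) \<le> 1" "(\<integral>\<^sup>+x. ennreal (g x (\<tau>, y) powr r) \<partial>lborel) \<le> 1" if "0 < \<tau>" "\<tau> < t" for \<tau> x y
  proof -
    have k: "\<kappa> (t - \<tau>) > 0" using K0 that by simp
    have "(\<integral>\<^sup>+y. ennreal (1 / \<kappa> (t - \<tau>) powr r * \<bar>G (t - \<tau>, y)\<bar> powr r) \<partial>lborel) = ennreal (1 / \<kappa> (t - \<tau>) powr r) * (\<integral>\<^sup>+y. ennreal (\<bar>G (t - \<tau>, y)\<bar> powr r) \<partial>lborel)"
      by (intro nn_integral_ennreal_cmult) auto
    also have "\<dots> \<le> ennreal (1 / \<kappa> (t - \<tau>) powr r) * ennreal (\<kappa> (t - \<tau>) powr r)"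
      using that by (intro mult_left_mono Kt) auto
    also have "\<dots> = 1" using k by (simp add: ennreal_mult[symmetric])
    finally have *: "(\<integral>\<^sup>+y. ennreal (1 / \<kappa> (t - \<tau>) powr r * \<bar>G (t - \<tau>, y)\<bar> powr r) \<partial>lborel) \<le> 1" .
    have geq: "g x (\<tau>, y) powr r = 1 / \<kappa> (t - \<tau>) powr r * \<bar>G (t - \<tau>, x - y)\<bar> powr r" for x y
      using k by (simp add: g_def powr_divide)
    have "(\<integral>\<^sup>+y. ennreal (g x (\<tau>, y) powr r) \<partial>lborel) = (\<integral>\<^sup>+y. ennreal (1 / \<kappa> (t - \<tau>) powr r * \<bar>G (t - \<tau>, y)\<bar> powr r) \<partial>lborel)"
      unfolding geq by (rule nn_integral_reflect[where h = "\<lambda>y. ennreal (1 / \<kappa> (t - \<tau>) powr r * \<bar>G (t - \<tau>, y)\<bar> powr r)"]) measurable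
    thus "(\<integral>\<^sup>+y. ennreal (g x (\<tau>, y) powr r) \<partial>lborel) \<le> 1" using * by simp
    have "(\<integral>\<^sup>+x. ennreal (1 / \<kappa> (t - \<tau>) powr r * \<bar>G (t - \<tau>, x)\<bar> powr r) \<partial>lborel) =
        (\<integral>\<^sup>+x. ennreal (1 / \<kappa> (t - \<tau>) powr r * \<bar>G (t - \<tau>, - x)\<bar> powr r) \<partial>lborel)"
      using nn_integral_reflect[where h = "\<lambda>x. ennreal (1 / \<kappa> (t - \<tau>) powr r * \<bar>G (t - \<tau>, x)\<bar> powr r)" and x = 0] by simp
    also have "\<dots> = (\<integral>\<^sup>+x. ennreal (1 / \<kappa> (t - \<tau>) powr r * \<bar>G (t - \<tau>, x - y)\<bar> powr r) \<partial>lborel)"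
      using nn_integral_reflect[where h = "\<lambda>x. ennreal (1 / \<kappa> (t - \<tau>) powr r * \<bar>G (t - \<tau>, - x)\<bar> powr r)" and x = y] by simp
    finally show "(\<integral>\<^sup>+x. ennreal (g x (\<tau>, y) powr r) \<partial>lborel) \<le> 1" unfolding geq using * by simp
  qed
  have hint: "AE \<tau> in lborel. 0 < \<tau> \<and> \<tau> < t \<longrightarrow> (\<integral>\<^sup>+y. ennreal (h (\<tau>, y) powr m) \<partial>lborel) \<le> 1"
    using f\<tau> AE_lborel_pairD[OF ffr]
  proof eventually_elim
    case (elim \<tau>)
    show ?case
    proof
      assume \<tau>: "0 < \<tau> \<and> \<tau> < t"
      hence f0: "\<phi> \<tau> > 0" using \<phi> by simp
      have "(\<integral>\<^sup>+y. ennreal (h (\<tau>, y) powr m) \<partial>lborel) = (\<integral>\<^sup>+y. ennreal (1 / \<phi> \<tau> powr m) * epow (f (\<tau>, y)) m \<partial>lborel)"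
      proof (rule nn_integral_cong_AE)
        show "AE y in lborel. ennreal (h (\<tau>, y) powr m) = ennreal (1 / \<phi> \<tau> powr m) * epow (f (\<tau>, y)) m"
          using elim(2) by eventually_elim
            (use \<tau> f0 fr0 in \<open>simp add: D_def h_def powr_divide epow_ennreal ennreal_mult[symmetric]\<close>)
      qed
      also have "\<dots> = ennreal (1 / \<phi> \<tau> powr m) * (\<integral>\<^sup>+y. epow (f (\<tau>, y)) m \<partial>lborel)"
        by (intro nn_integral_cmult) measurable
      also have "\<dots> \<le> ennreal (1 / \<phi> \<tau> powr m) * ennreal (\<phi> \<tau> powr m)"
        using elim \<tau> by (intro mult_left_mono) auto
      also have "\<dots> = 1" using f0 by (simp add: ennreal_mult[symmetric])
      finally show "(\<integral>\<^sup>+y. ennreal (h (\<tau>, y) powr m) \<partial>lborel) \<le> 1" .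
    qed
  qed
  \<comment> \<open>Used for both Y and Z: a factor whose slices have integral at most 1 leaves only
    the time weight.\<close>
  have cint: "(\<integral>\<^sup>+z. ennreal (if D z then c z * k z else 0) \<partial>lborel) \<le> ennreal W"
    if [measurable]: "k \<in> borel_measurable borel" and k0: "\<And>z. D z \<Longrightarrow> 0 \<le> k z"
      and k: "AE \<tau> in lborel. 0 < \<tau> \<and> \<tau> < t \<longrightarrow> (\<integral>\<^sup>+y. ennreal (k (\<tau>, y)) \<partial>lborel) \<le> 1" for k
  proof -
    have "(\<integral>\<^sup>+z. ennreal (if D z then c z * k z else 0) \<partial>lborel) = (\<integral>\<^sup>+\<tau>. \<integral>\<^sup>+y. ennreal (if D (\<tau>, y) then c (\<tau>, y) * k (\<tau>, y) else 0) \<partial>lborel \<partial>lborel)"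
      by (intro nn_integral_lborel_pair) measurable
    also have "\<dots> \<le> (\<integral>\<^sup>+\<tau>. ennreal (indicator {0<..<t} \<tau> * (\<kappa> (t - \<tau>) * \<phi> \<tau>)) \<partial>lborel)"
    proof (rule nn_integral_mono_AE)
      show "AE \<tau> in lborel. (\<integral>\<^sup>+y. ennreal (if D (\<tau>, y) then c (\<tau>, y) * k (\<tau>, y) else 0) \<partial>lborel) \<le> ennreal (indicator {0<..<t} \<tau> * (\<kappa> (t - \<tau>) * \<phi> \<tau>))"
        using k
      proof eventually_elim
        case (elim \<tau>)
        show ?case
        proof (cases "0 < \<tau> \<and> \<tau> < t")
          case True
          hence D: "D (\<tau>, y)" for y by (simp add: D_def)
          have cc: "0 \<le> \<kappa> (t - \<tau>) * \<phi> \<tau>" using True K0[of "t - \<tau>"] \<phi>[of \<tau>] by simp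
          have "(\<integral>\<^sup>+y. ennreal (if D (\<tau>, y) then c (\<tau>, y) * k (\<tau>, y) else 0) \<partial>lborel) = (\<integral>\<^sup>+y. ennreal (\<kappa> (t - \<tau>) * \<phi> \<tau>) * ennreal (k (\<tau>, y)) \<partial>lborel)"
            using D cc k0 by (intro nn_integral_cong) (simp add: c_def ennreal_mult)
          also have "\<dots> = ennreal (\<kappa> (t - \<tau>) * \<phi> \<tau>) * (\<integral>\<^sup>+y. ennreal (k (\<tau>, y)) \<partial>lborel)"
            by (intro nn_integral_cmult) measurable
          also have "\<dots> \<le> ennreal (\<kappa> (t - \<tau>) * \<phi> \<tau>) * 1" using elim True by (intro mult_left_mono) auto
          finally show ?thesis using True by simp
        qed (auto simp: D_def)
      qed
    qed
    also note W(1)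
    finally show ?thesis .
  qed
  have pw: "epow (duhamel G f (t, x)) Q \<le> ennreal (W powr (Q - 1)) * (\<integral>\<^sup>+z. ennreal (X x z) \<partial>lborel)" for x
    unfolding duhamel_H
  proof (rule holder3[where Y = "Y x" and Z = Z and b = "1 - 1 / m" and c = "1 - 1 / r"])
    show "AE z in lborel. H x z \<le> X x z powr (1 / Q) * Y x z powr (1 - 1 / m) * Z z powr (1 - 1 / r)"
    proof (rule AE_I2)
      fix z
      show "H x z \<le> X x z powr (1 / Q) * Y x z powr (1 - 1 / m) * Z z powr (1 - 1 / r)"
      proof (cases "D z")
        case True
        have cz: "c z > 0" by (rule c[OF True])
        have Hc: "H x z = c z * g x z * h z"
          using True K0[of "t - fst z"] \<phi>[of "fst z"] by (simp add: H_def c_def g_def h_def D_def)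
        show ?thesis
        proof (cases "g x z = 0 \<or> h z = 0")
          case True
          thus ?thesis unfolding Hc by auto
        next
          case False
          hence gh: "g x z > 0" "h z > 0" using g0[OF True] by (auto simp: less_le)
          have e1: "1 / Q + (1 - 1 / m) + (1 - 1 / r) = 1" using Q p by (simp add: r(2) m_def field_simps)
          have e2: "r * (1 / Q) + r * (1 - 1 / m) = 1"
          proof -
            have "1 / Q + (1 - 1 / m) = 1 / r" using e1 by simp
            thus ?thesis using r(1) by (metis distrib_left nonzero_mult_div_cancel_left order_less_irrefl times_divide_eq_right mult.right_neutral)
          qed
          have e3: "m * (1 / Q) + m * (1 - 1 / r) = 1"
          proof -
            have "1 / Q + (1 - 1 / r) = 1 / m" using e1 by simp
            thus ?thesis using m by (metis distrib_left nonzero_mult_div_cancel_left not_one_le_zero times_divide_eq_right mult.right_neutral)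
          qed
          have "X x z powr (1 / Q) * Y x z powr (1 - 1 / m) * Z z powr (1 - 1 / r) =
              (c z powr (1 / Q) * c z powr (1 - 1 / m) * c z powr (1 - 1 / r)) *
              (g x z powr (r * (1 / Q)) * g x z powr (r * (1 - 1 / m))) *
              (h z powr (m * (1 / Q)) * h z powr (m * (1 - 1 / r)))"
            using True by (simp only: X_def Y_def Z_def if_True powr_mult powr_powr mult_ac)
          also have "\<dots> = c z powr 1 * g x z powr 1 * h z powr 1"
            by (simp only: powr_add[symmetric] e1 e2 e3)
          also have "\<dots> = H x z" using cz gh by (simp add: Hc)
          finally show ?thesis by simp
        qed
      qed (simp add: H_def)
    qed
    show "(\<integral>\<^sup>+z. ennreal (Y x z) \<partial>lborel) \<le> ennreal W"
      unfolding Y_def using gint by (intro cint) auto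
    show "(\<integral>\<^sup>+z. ennreal (Z z) \<partial>lborel) \<le> ennreal W"
      unfolding Z_def using hint by (intro cint) auto
    show "0 \<le> X x z" "0 \<le> Y x z" "0 \<le> Z z" for z
      using c[of z] by (auto simp: X_def Y_def Z_def)
    show "0 \<le> 1 - 1 / m" "0 \<le> 1 - 1 / r" using m p Q by (auto simp: r(2))
    show "1 / Q + (1 - 1 / m) + (1 - 1 / r) = 1" using Q p by (simp add: r(2) m_def field_simps)
  qed (use Q W in auto)
  have "(\<integral>\<^sup>+x. epow (duhamel G f (t, x)) Q \<partial>lborel) \<le> (\<integral>\<^sup>+x. ennreal (W powr (Q - 1)) * (\<integral>\<^sup>+z. ennreal (X x z) \<partial>lborel) \<partial>lborel)"
    by (intro nn_integral_mono pw)
  also have "\<dots> = ennreal (W powr (Q - 1)) * (\<integral>\<^sup>+x. \<integral>\<^sup>+z. ennreal (X x z) \<partial>lborel \<partial>lborel)"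
    by (intro nn_integral_cmult) measurable
  also have "(\<integral>\<^sup>+x. \<integral>\<^sup>+z. ennreal (X x z) \<partial>lborel \<partial>lborel) = (\<integral>\<^sup>+z. \<integral>\<^sup>+x. ennreal (X x z) \<partial>lborel \<partial>lborel)"
    by (intro lborel_pair.Fubini') measurable
  \<comment> \<open>The normalised kernel is also bounded in L^r as a function of x, since the
    spatial integral is invariant under translations and reflections.\<close>
  also have "\<dots> \<le> (\<integral>\<^sup>+z. ennreal (Z z) \<partial>lborel)"
  proof (intro nn_integral_mono)
    fix z :: "real \<times> 'a"
    show "(\<integral>\<^sup>+x. ennreal (X x z) \<partial>lborel) \<le> ennreal (Z z)"
    proof (cases "D z")
      case True
      have "(\<integral>\<^sup>+x. ennreal (X x z) \<partial>lborel) = (\<integral>\<^sup>+x. ennreal (c z * h z powr m * g x z powr r) \<partial>lborel)"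
        using True by (simp add: X_def mult_ac)
      also have "\<dots> = ennreal (c z * h z powr m) * (\<integral>\<^sup>+x. ennreal (g x z powr r) \<partial>lborel)"
        using c[OF True] by (intro nn_integral_ennreal_cmult) auto
      also have "\<dots> \<le> ennreal (c z * h z powr m) * 1"
        using True gint(2)[of "fst z" "snd z"] by (intro mult_left_mono) (auto simp: D_def)
      finally show ?thesis using True by (simp add: Z_def)
    qed (simp add: X_def)
  qed
  also have "\<dots> \<le> ennreal W" unfolding Z_def using hint by (intro cint) auto
  finally have "(\<integral>\<^sup>+x. epow (duhamel G f (t, x)) Q \<partial>lborel) \<le> ennreal (W powr (Q - 1)) * ennreal W" by (simp add: mult_left_mono)
  also have "\<dots> = ennreal (W powr Q)" using W by (simp add: ennreal_mult[symmetric] powr_diff)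
  finally show ?thesis using real by (simp add: Lq_le_ereal)
qed

section \<open>The nonlinear integral equation\<close>

lemma Lq_le_0: "0 \<le> M \<Longrightarrow> Lq_le q M (\<lambda>_. 0)"
  by (simp add: Lq_le_def)

lemma epow_mult_self: "epow x (p - 1) * x = epow x p"
  using epow_add[of x "p - 1" 1] by simp

section \<open>Lipschitz bounds for the power nonlinearity\<close>

text \<open>The mean value theorem. The case x = 0 is done by hand, as the derivative of the power
  is used on a closed interval of positive numbers.\<close>

lemma abs_powr_diff_le:
  fixes x y p :: real
  assumes "0 \<le> x" "x \<le> y" "1 < p"
  shows "y powr p - x powr p \<le> p * y powr (p - 1) * (y - x)"
proof (cases "x = 0")
  case True
  have "y powr p = y powr (p - 1) * y" using assms by (cases "y = 0") (auto simp: powr_diff)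
  moreover have "1 * (y powr (p - 1) * y) \<le> p * (y powr (p - 1) * y)"
    using assms by (intro mult_right_mono) auto
  ultimately show ?thesis using True by (simp add: mult_ac)
next
  case False
  with assms have x: "x > 0" by simp
  show ?thesis
  proof (cases "x = y")
    case False
    with assms have xy: "x < y" by simp
    have "\<exists>z. x < z \<and> z < y \<and> y powr p - x powr p = (y - x) * (p * z powr (p - 1))"
      using x xy by (intro MVT2) (auto intro!: derivative_eq_intros has_real_derivative_powr)
    then obtain z where z: "x < z" "z < y" "y powr p - x powr p = (y - x) * (p * z powr (p - 1))" by blast
    have "(y - x) * (p * z powr (p - 1)) \<le> (y - x) * (p * y powr (p - 1))"
      using z x assms by (intro mult_left_mono powr_mono2) auto
    thus ?thesis using z by (simp add: mult_ac)
  qed simp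
qed

text \<open>The bound is proved with the real number m = max(|a|, |b|) and only then enlarged to U,
  which may be infinite.\<close>

lemma ennreal_abs_powr_diff_le:
  fixes a b p :: real
  assumes "ennreal \<bar>a\<bar> \<le> U" "ennreal \<bar>b\<bar> \<le> U" "1 < p"
  shows "ennreal \<bar>\<bar>a\<bar> powr p - \<bar>b\<bar> powr p\<bar> \<le> ennreal p * (epow U (p - 1) * ennreal \<bar>a - b\<bar>)"
proof -
  define m where "m = max \<bar>a\<bar> \<bar>b\<bar>"
  have "\<bar>\<bar>a\<bar> powr p - \<bar>b\<bar> powr p\<bar> \<le> p * (m powr (p - 1) * \<bar>\<bar>a\<bar> - \<bar>b\<bar>\<bar>)"
  proof (cases "\<bar>a\<bar> \<le> \<bar>b\<bar>")
    case True
    have "\<bar>a\<bar> powr p \<le> \<bar>b\<bar> powr p" using True assms by (intro powr_mono2) auto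
    thus ?thesis using abs_powr_diff_le[of "\<bar>a\<bar>" "\<bar>b\<bar>" p] True assms by (simp add: m_def mult_ac)
  next
    case False
    have "\<bar>b\<bar> powr p \<le> \<bar>a\<bar> powr p" using False assms by (intro powr_mono2) auto
    thus ?thesis using abs_powr_diff_le[of "\<bar>b\<bar>" "\<bar>a\<bar>" p] False assms by (simp add: m_def mult_ac max_def)
  qed
  also have "\<dots> \<le> p * (m powr (p - 1) * \<bar>a - b\<bar>)"
    using assms by (intro mult_left_mono) auto
  finally have "ennreal \<bar>\<bar>a\<bar> powr p - \<bar>b\<bar> powr p\<bar> \<le> ennreal (p * (m powr (p - 1) * \<bar>a - b\<bar>))" by (rule ennreal_leI)
  also have "\<dots> = ennreal p * (epow (ennreal m) (p - 1) * ennreal \<bar>a - b\<bar>)"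
    using assms by (simp add: ennreal_mult epow_ennreal m_def le_max_iff_disj)
  also have "\<dots> \<le> ennreal p * (epow U (p - 1) * ennreal \<bar>a - b\<bar>)"
    using assms by (intro mult_left_mono mult_right_mono epow_mono) (auto simp: m_def max_def)
  finally show ?thesis .
qed

lemma ennreal_abs_diff_mult: "ennreal \<bar>a * g - b * g\<bar> = ennreal \<bar>g\<bar> * ennreal \<bar>a - b\<bar>" for a b g :: real
proof -
  have "a * g - b * g = g * (a - b)" by (simp add: algebra_simps)
  thus ?thesis by (simp only: abs_mult ennreal_mult abs_ge_zero)
qed
lemma ennreal_abs_indicator_diff_mult:
  "ennreal \<bar>indicator A x * (a * g) - indicator A x * (b * g)\<bar> = indicator A x * (ennreal \<bar>g\<bar> * ennreal \<bar>a - b\<bar>)" for a b g :: real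
  by (cases "x \<in> A") (simp_all add: ennreal_abs_diff_mult)

text \<open>All that the nonlinear argument uses of the fractional problem: causality and a spatial
  norm of order t^(\<beta> - 1), which is integrable at t = 0.\<close>

locale nonlinear_kernel =
  fixes G :: "real \<times> 'a::euclidean_space \<Rightarrow> real" and p :: real and q :: ereal and C \<beta> :: real
  assumes G: "causal_kernel G" and p: "1 < p" and q: "ereal p \<le> q" and C: "0 < C" and \<beta>: "0 < \<beta>"
    and K: "kernel_bound p q G (\<lambda>t. C * t powr (\<beta> - 1))"
begin

lemma G_measurable [measurable]: "G \<in> borel_measurable borel"
  using G by (simp add: causal_kernel_def)

lemma duhamel_G_measurable [measurable]: "f \<in> borel_measurable borel \<Longrightarrow> duhamel G f \<in> borel_measurable borel"
  by (rule duhamel_measurable[OF G])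

lemma q1: "1 \<le> q"
  using p q by (metis less_imp_le ereal_less_eq(3) one_ereal_def order_trans)

text \<open>The exponential weight makes the Duhamel operator a contraction for large \<open>l\<close>.\<close>

lemma duhamel_weighted_Lq_le:
  fixes U d :: "real \<times> 'a \<Rightarrow> ennreal"
  assumes [measurable]: "U \<in> borel_measurable borel" "d \<in> borel_measurable borel"
    and l: "0 < l" and M: "0 < M" and \<delta>: "0 < \<delta>"
    and Ud: "AE \<tau> in lborel. 0 < \<tau> \<and> \<tau> < t \<longrightarrow> Lq_le q M (\<lambda>y. U (\<tau>, y)) \<and> Lq_le q (\<delta> * exp (l * \<tau>)) (\<lambda>y. d (\<tau>, y))"
  shows "Lq_le q (C * M powr (p - 1) * \<delta> * Gamma \<beta> * l powr (- \<beta>) * exp (l * t))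
    (\<lambda>x. duhamel G (\<lambda>z. epow (U z) (p - 1) * d z) (t, x))"
proof (rule duhamel_Lq_le[OF G _ _ _ K, where \<phi> = "\<lambda>\<tau>. M powr (p - 1) * (\<delta> * exp (l * \<tau>))"])
  show "AE \<tau> in lborel. 0 < \<tau> \<and> \<tau> < t \<longrightarrow>
      Lq_le (q / ereal p) (M powr (p - 1) * (\<delta> * exp (l * \<tau>))) (\<lambda>y. epow (U (\<tau>, y)) (p - 1) * d (\<tau>, y))"
    using Ud by eventually_elim (use M \<delta> p q in \<open>auto intro!: Lq_le_power_mult\<close>)
  define c where "c = C * M powr (p - 1) * \<delta> * exp (l * t)"
  have c: "c > 0" using C M \<delta> by (simp add: c_def)
  \<comment> \<open>Extended to all t - \<tau> \<ge> 0, the time integral becomes the Laplace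
    transform of the power \<beta> - 1 at l, that is Gamma(\<beta>) l^(-\<beta>).\<close>
  have "(\<integral>\<^sup>+\<tau>. ennreal (indicator {0<..<t} \<tau> * (C * (t - \<tau>) powr (\<beta> - 1) * (M powr (p - 1) * (\<delta> * exp (l * \<tau>))))) \<partial>lborel)
     \<le> (\<integral>\<^sup>+\<tau>. ennreal (c * (indicator {0..} (t - \<tau>) * (t - \<tau>) powr (\<beta> - 1) * exp (- ((t - \<tau>) * l)))) \<partial>lborel)"
  proof (intro nn_integral_mono ennreal_leI)
    fix \<tau> :: real
    have e: "exp (l * \<tau>) = exp (l * t) * exp (- ((t - \<tau>) * l))" by (simp add: exp_add[symmetric] algebra_simps)
    show "indicator {0<..<t} \<tau> * (C * (t - \<tau>) powr (\<beta> - 1) * (M powr (p - 1) * (\<delta> * exp (l * \<tau>))))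
       \<le> c * (indicator {0..} (t - \<tau>) * (t - \<tau>) powr (\<beta> - 1) * exp (- ((t - \<tau>) * l)))"
    proof (cases "0 < \<tau> \<and> \<tau> < t")
      case True
      thus ?thesis unfolding e by (simp add: c_def)
    next
      case False
      have "0 \<le> c * (indicator {0..} (t - \<tau>) * (t - \<tau>) powr (\<beta> - 1) * exp (- ((t - \<tau>) * l)))"
        using c by (intro mult_nonneg_nonneg) auto
      thus ?thesis using False by simp
    qed
  qed
  also have "\<dots> = (\<integral>\<^sup>+\<tau>. ennreal (c * (indicator {0..} \<tau> * \<tau> powr (\<beta> - 1) * exp (- (\<tau> * l)))) \<partial>lborel)"
    by (rule nn_integral_reflect[where h = "\<lambda>\<tau>. ennreal (c * (indicator {0..} \<tau> * \<tau> powr (\<beta> - 1) * exp (- (\<tau> * l))))"]) measurable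
  also have "\<dots> = ennreal c * ennreal (Gamma \<beta> * l powr (- \<beta>))"
    using c l \<beta> by (subst nn_integral_ennreal_cmult) (auto simp: nn_integral_Gamma_scale)
  also have "\<dots> = ennreal (C * M powr (p - 1) * \<delta> * Gamma \<beta> * l powr (- \<beta>) * exp (l * t))"
    using c \<beta> by (simp add: ennreal_mult[symmetric] c_def mult_ac less_imp_le)
  finally show "(\<integral>\<^sup>+\<tau>. ennreal (indicator {0<..<t} \<tau> * (C * (t - \<tau>) powr (\<beta> - 1) * (M powr (p - 1) * (\<delta> * exp (l * \<tau>))))) \<partial>lborel)
     \<le> ennreal (C * M powr (p - 1) * \<delta> * Gamma \<beta> * l powr (- \<beta>) * exp (l * t))" .
qed (use M \<delta> C \<beta> l p q in auto)

text \<open>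
  Constant sequences give a Gronwall inequality for uniqueness, the oscillations of the Picard
  iterates give existence.
\<close>

lemma gronwall_seq:
  fixes U :: "real \<times> 'a \<Rightarrow> ennreal" and d :: "nat \<Rightarrow> real \<times> 'a \<Rightarrow> ennreal"
  assumes [measurable]: "U \<in> borel_measurable borel" "\<And>n. d n \<in> borel_measurable borel"
    and M: "0 < M" and D: "0 < D"
    and U: "AE \<tau> in lborel. 0 < \<tau> \<and> \<tau> < T \<longrightarrow> Lq_le q M (\<lambda>y. U (\<tau>, y))"
    and d0: "AE \<tau> in lborel. 0 < \<tau> \<and> \<tau> < T \<longrightarrow> Lq_le q D (\<lambda>y. d 0 (\<tau>, y))"
    and dS: "\<And>n. AE w in lborel. 0 < fst w \<and> fst w < T \<longrightarrow> d (Suc n) w \<le> ennreal p * duhamel G (\<lambda>z. epow (U z) (p - 1) * d n z) w"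
  shows "AE w in lborel. 0 < fst w \<and> fst w < T \<longrightarrow> (INF n. d n w) = 0"
proof -
  \<comment> \<open>The weighted estimate carries the factor p C M^(p - 1) Gamma(\<beta>)
    l^(-\<beta>) = (k/2) l^(-\<beta>). The choice l^\<beta> = k makes it 1/2, whatever T is.\<close>
  define k where "k = 2 * (p * (C * M powr (p - 1) * Gamma \<beta>))"
  have k: "k > 0" using p C M \<beta> by (simp add: k_def)
  define l where "l = k powr (1 / \<beta>)"
  have l: "l > 0" using k by (simp add: l_def)
  have l\<beta>: "l powr (- \<beta>) = 1 / k" using k \<beta> by (simp add: l_def powr_powr powr_minus_divide)
  have dn: "AE \<tau> in lborel. 0 < \<tau> \<and> \<tau> < T \<longrightarrow> Lq_le q (D / 2 ^ n * exp (l * \<tau>)) (\<lambda>y. d n (\<tau>, y))" for n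
  proof (induction n)
    case 0
    show ?case using d0
    proof eventually_elim
      case (elim \<tau>)
      show ?case
      proof
        assume \<tau>: "0 < \<tau> \<and> \<tau> < T"
        have "D * 1 \<le> D * exp (l * \<tau>)" using D l \<tau> by (intro mult_left_mono) auto
        thus "Lq_le q (D / 2 ^ 0 * exp (l * \<tau>)) (\<lambda>y. d 0 (\<tau>, y))"
          by (intro Lq_le_mono[OF elim[rule_format, OF \<tau>]]) (use D q1 in auto)
      qed
    qed
  next
    case (Suc n)
    have Ud: "AE \<tau> in lborel. 0 < \<tau> \<and> \<tau> < T \<longrightarrow> Lq_le q M (\<lambda>y. U (\<tau>, y)) \<and> Lq_le q (D / 2 ^ n * exp (l * \<tau>)) (\<lambda>y. d n (\<tau>, y))"
      using U Suc by eventually_elim auto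
    show ?case
      using AE_lborel_pairD[OF dS[of n]]
    proof eventually_elim
      case (elim t)
      show ?case
      proof
        assume t: "0 < t \<and> t < T"
        let ?L = "C * M powr (p - 1) * (D / 2 ^ n) * Gamma \<beta> * l powr (- \<beta>) * exp (l * t)"
        have "Lq_le q ?L (\<lambda>x. duhamel G (\<lambda>z. epow (U z) (p - 1) * d n z) (t, x))"
          using l M D Ud t by (intro duhamel_weighted_Lq_le) (auto elim!: eventually_mono)
        moreover have L0: "?L \<ge> 0" using C M D \<beta> by (intro mult_nonneg_nonneg) (auto simp: less_imp_le)
        ultimately have "Lq_le q (p * ?L) (\<lambda>x. ennreal p * duhamel G (\<lambda>z. epow (U z) (p - 1) * d n z) (t, x))"
          using p q1 by (intro Lq_le_cmult) auto
        moreover have "p * ?L = D / 2 ^ Suc n * exp (l * t)"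
        proof -
          have "p * ?L = (p * (C * M powr (p - 1) * Gamma \<beta>)) * (1 / k) * (D / 2 ^ n) * exp (l * t)"
            by (simp only: l\<beta> mult_ac)
          also have "p * (C * M powr (p - 1) * Gamma \<beta>) = k / 2" by (simp add: k_def)
          finally show ?thesis using k by simp
        qed
        ultimately have "Lq_le q (D / 2 ^ Suc n * exp (l * t)) (\<lambda>x. ennreal p * duhamel G (\<lambda>z. epow (U z) (p - 1) * d n z) (t, x))"
          by simp
        thus "Lq_le q (D / 2 ^ Suc n * exp (l * t)) (\<lambda>y. d (Suc n) (t, y))"
          by (rule Lq_le_mono) (use elim t D q1 in auto)
      qed
    qed
  qed
  show ?thesis
  proof (rule AE_lborel_pairI)
    have "AE \<tau> in lborel. \<forall>n. 0 < \<tau> \<and> \<tau> < T \<longrightarrow> Lq_le q (D / 2 ^ n * exp (l * \<tau>)) (\<lambda>y. d n (\<tau>, y))"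
      using dn unfolding AE_all_countable by blast
    thus "AE \<tau> in lborel. AE y in lborel. 0 < fst (\<tau>, y) \<and> fst (\<tau>, y) < T \<longrightarrow> (INF n. d n (\<tau>, y)) = 0"
    proof eventually_elim
      case (elim \<tau>)
      show ?case
      proof (cases "0 < \<tau> \<and> \<tau> < T")
        case True
        have "(\<lambda>n. D / 2 ^ n * exp (l * \<tau>)) \<longlonglongrightarrow> 0 * exp (l * \<tau>)"
          by (intro tendsto_mult tendsto_const LIMSEQ_divide_realpow_zero) auto
        hence "AE y in lborel. (INF n. d n (\<tau>, y)) = 0"
          using elim True D q1 by (intro Lq_le_null_seq[where c = "\<lambda>n. D / 2 ^ n * exp (l * \<tau>)"]) auto
        thus ?thesis by simp
      qed auto
    qed
  qed measurable
qed

section \<open>Majorant, Picard iterates and fixed point\<close>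

text \<open>Monotone iteration from 0. The bound 8 A reproduces itself: under the smallness
  condition the Duhamel term is at most A, and adding \<Lambda> gives 4 (A + A). By monotone
  convergence the equation holds at every point, including those where U is infinite.\<close>

lemma ex_majorant:
  fixes \<Lambda> :: "real \<times> 'a \<Rightarrow> ennreal"
  assumes [measurable]: "\<Lambda> \<in> borel_measurable borel" and A: "0 < A" and T: "0 < T"
    and \<Lambda>: "\<And>t. 0 < t \<Longrightarrow> t < T \<Longrightarrow> Lq_le q A (\<lambda>x. \<Lambda> (t, x))"
    and small: "8 * (C * (8 * A) powr (p - 1) * Gamma \<beta> * T powr \<beta> * exp 1) \<le> 1"
  shows "\<exists>U. U \<in> borel_measurable borel \<and> (\<forall>w. U w = \<Lambda> w + duhamel G (\<lambda>z. epow (U z) p) w) \<and>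
    (\<forall>t. 0 < t \<and> t < T \<longrightarrow> Lq_le q (8 * A) (\<lambda>x. U (t, x)))"
proof -
  define V where "V = rec_nat (\<lambda>_. 0) (\<lambda>_ V w. \<Lambda> w + duhamel G (\<lambda>z. epow (V z) p) w)"
  have V0: "V 0 = (\<lambda>_. 0)" and VS: "V (Suc n) = (\<lambda>w. \<Lambda> w + duhamel G (\<lambda>z. epow (V n z) p) w)" for n
    by (simp_all add: V_def)
  have [measurable]: "V n \<in> borel_measurable borel" for n
    by (induction n) (simp_all add: V0 VS)
  have "V n \<le> V (Suc n)" for n
  proof (induction n)
    case (Suc n)
    thus ?case unfolding VS[of n] VS[of "Suc n"]
      using p by (auto simp: le_fun_def intro!: add_left_mono duhamel_mono_AE[OF G] epow_mono)
  qed (simp add: V0 le_fun_def)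
  hence inc: "incseq V" by (rule incseq_SucI)
  hence incw: "incseq (\<lambda>n. V n w)" for w unfolding incseq_def le_fun_def by blast
  have bound: "Lq_le q (8 * A) (\<lambda>x. V n (t, x))" if t: "0 < t" "t < T" for n t
    using t
  proof (induction n arbitrary: t)
    case 0
    thus ?case using A by (simp add: V0 Lq_le_0)
  next
    case (Suc n)
    \<comment> \<open>With l = 1/T the weighted estimate serves for an unweighted bound: the weight
      stays below exp 1 on (0, T), and l^(-\<beta>) = T^\<beta>. Both factors appear in
      \<open>small\<close>.\<close>
    let ?l = "1 / T"
    let ?L = "C * (8 * A) powr (p - 1) * (8 * A) * Gamma \<beta> * ?l powr (- \<beta>) * exp (?l * t)"
    have "Lq_le q ?L (\<lambda>x. duhamel G (\<lambda>z. epow (V n z) (p - 1) * V n z) (t, x))"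
    proof (intro duhamel_weighted_Lq_le AE_I2 impI conjI)
      fix \<tau> assume \<tau>: "0 < \<tau> \<and> \<tau> < t"
      show V: "Lq_le q (8 * A) (\<lambda>y. V n (\<tau>, y))" using Suc \<tau> by auto
      have "8 * A * 1 \<le> 8 * A * exp (?l * \<tau>)" using A T \<tau> by (intro mult_left_mono) auto
      thus "Lq_le q (8 * A * exp (?l * \<tau>)) (\<lambda>y. V n (\<tau>, y))"
        using A q1 by (intro Lq_le_mono[OF V]) auto
    qed (use A T in auto)
    moreover have "?L \<le> A"
    proof -
      have lT: "?l powr (- \<beta>) = T powr \<beta>" using T by (simp add: powr_divide powr_minus_divide)
      have "exp (?l * t) \<le> exp 1" using Suc T by simp
      hence "?L \<le> C * (8 * A) powr (p - 1) * (8 * A) * Gamma \<beta> * ?l powr (- \<beta>) * exp 1"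
        using C A \<beta> by (intro mult_left_mono) (auto simp: less_imp_le)
      also have "\<dots> = A * (8 * (C * (8 * A) powr (p - 1) * Gamma \<beta> * T powr \<beta> * exp 1))"
        unfolding lT by (simp only: mult_ac)
      also have "\<dots> \<le> A * 1" using small A by (intro mult_left_mono) auto
      finally show ?thesis by simp
    qed
    moreover have "0 \<le> ?L" using C A \<beta> by (intro mult_nonneg_nonneg) (auto simp: less_imp_le)
    ultimately have "Lq_le q A (\<lambda>x. duhamel G (\<lambda>z. epow (V n z) (p - 1) * V n z) (t, x))"
      using Lq_le_mono[OF _ _ _ _ q1, of ?L "\<lambda>x. duhamel G (\<lambda>z. epow (V n z) (p - 1) * V n z) (t, x)" "\<lambda>x. duhamel G (\<lambda>z. epow (V n z) (p - 1) * V n z) (t, x)" A]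
      by blast
    hence "Lq_le q (4 * (A + A)) (\<lambda>x. \<Lambda> (t, x) + duhamel G (\<lambda>z. epow (V n z) (p - 1) * V n z) (t, x))"
      using \<Lambda>[OF Suc.prems] A q1 by (intro Lq_le_add) auto
    thus ?case by (simp add: VS epow_mult_self)
  qed
  define U where "U w = (SUP n. V n w)" for w
  have [measurable]: "U \<in> borel_measurable borel" unfolding U_def by measurable
  have "U w = \<Lambda> w + duhamel G (\<lambda>z. epow (U z) p) w" for w
  proof -
    have "(SUP n. duhamel G (\<lambda>z. epow (V n z) p) w) = duhamel G (\<lambda>z. epow (U z) p) w"
    proof -
      have "(\<lambda>z. indicator {0<..} (fst z) * (ennreal \<bar>G (w - z)\<bar> * epow (U z) p)) =
          (\<lambda>z. SUP n. indicator {0<..} (fst z) * (ennreal \<bar>G (w - z)\<bar> * epow (V n z) p))"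
        using p by (simp add: U_def SUP_epow[OF incw, symmetric] SUP_mult_left_ennreal)
      thus ?thesis
        unfolding duhamel_def using p
        by (simp only:) (intro nn_integral_monotone_convergence_SUP[symmetric],
          use inc p in \<open>auto simp: incseq_def le_fun_def intro!: mult_left_mono epow_mono\<close>)
    qed
    moreover have "incseq (\<lambda>n. duhamel G (\<lambda>z. epow (V n z) p) w)"
      using inc p by (auto simp: incseq_def le_fun_def intro!: duhamel_mono_AE[OF G] epow_mono)
    ultimately have "(\<lambda>n. duhamel G (\<lambda>z. epow (V n z) p) w) \<longlonglongrightarrow> duhamel G (\<lambda>z. epow (U z) p) w"
      by (metis LIMSEQ_SUP)
    hence "(\<lambda>n. V (Suc n) w) \<longlonglongrightarrow> \<Lambda> w + duhamel G (\<lambda>z. epow (U z) p) w"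
      unfolding VS by (intro tendsto_add tendsto_const)
    moreover have "(\<lambda>n. V (Suc n) w) \<longlonglongrightarrow> U w"
      unfolding U_def by (intro LIMSEQ_Suc LIMSEQ_SUP incw)
    ultimately show ?thesis by (rule LIMSEQ_unique[rotated])
  qed
  moreover have "Lq_le q (8 * A) (\<lambda>x. U (t, x))" if "0 < t" "t < T" for t
    unfolding U_def using inc bound[OF that] q1
    by (intro Lq_le_SUP) (auto simp: incseq_def le_fun_def)
  ultimately show ?thesis using \<open>U \<in> borel_measurable borel\<close> by blast
qed

text \<open>As a Bochner integral this is 0 wherever the integrand is not integrable, so iterates
  can be defined and majorised at every point.\<close>

definition nonlin :: "(real \<times> 'a \<Rightarrow> real) \<Rightarrow> real \<times> 'a \<Rightarrow> real" where
  "nonlin v w = (\<integral>z. indicator {0<..} (fst z) * (\<bar>v z\<bar> powr p * G (w - z)) \<partial>lborel)"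

lemma nonlin_measurable [measurable]:
  assumes [measurable]: "v \<in> borel_measurable borel"
  shows "nonlin v \<in> borel_measurable borel"
  unfolding nonlin_def[abs_def] by measurable

lemma nonlin_integrand:
  "ennreal \<bar>indicator {0<..} (fst z) * (\<bar>v z\<bar> powr p * G (w - z))\<bar> =
    indicator {0<..} (fst z) * (ennreal \<bar>G (w - z)\<bar> * epow (ennreal \<bar>v z\<bar>) p)"
  by (cases "0 < fst z") (simp_all add: epow_ennreal abs_mult ennreal_mult mult.commute[of "ennreal \<bar>G (w - z)\<bar>"])

lemma nonlin_le: "ennreal \<bar>nonlin v w\<bar> \<le> duhamel G (\<lambda>z. epow (ennreal \<bar>v z\<bar>) p) w"
  unfolding nonlin_def duhamel_def nonlin_integrand[symmetric] by (rule ennreal_abs_integral_le)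

lemma nonlin_integrable:
  assumes [measurable]: "v \<in> borel_measurable borel" and v: "\<And>z. ennreal \<bar>v z\<bar> \<le> U z"
    and fin: "duhamel G (\<lambda>z. epow (U z) p) w < \<top>"
  shows "integrable lborel (\<lambda>z. indicator {0<..} (fst z) * (\<bar>v z\<bar> powr p * G (w - z)))"
proof (rule integrableI_bounded)
  have "duhamel G (\<lambda>z. epow (ennreal \<bar>v z\<bar>) p) w \<le> duhamel G (\<lambda>z. epow (U z) p) w"
    using v p by (intro duhamel_mono_AE[OF G]) (auto intro!: epow_mono)
  from le_less_trans[OF this fin]
  show "(\<integral>\<^sup>+z. ennreal (norm (indicator {0<..} (fst z) * (\<bar>v z\<bar> powr p * G (w - z)))) \<partial>lborel) < \<infinity>"
    by (simp only: real_norm_def nonlin_integrand duhamel_def infinity_ennreal_def)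
qed measurable

lemma nonlin_diff_le:
  assumes [measurable]: "u \<in> borel_measurable borel" "v \<in> borel_measurable borel" "U \<in> borel_measurable borel"
    and uv: "\<And>z. ennreal \<bar>u z\<bar> \<le> U z" "\<And>z. ennreal \<bar>v z\<bar> \<le> U z"
    and iu: "integrable lborel (\<lambda>z. indicator {0<..} (fst z) * (\<bar>u z\<bar> powr p * G (w - z)))"
    and iv: "integrable lborel (\<lambda>z. indicator {0<..} (fst z) * (\<bar>v z\<bar> powr p * G (w - z)))"
  shows "ennreal \<bar>nonlin u w - nonlin v w\<bar> \<le> ennreal p * duhamel G (\<lambda>z. epow (U z) (p - 1) * ennreal \<bar>u z - v z\<bar>) w"
proof -
  let ?I = "\<lambda>v z. indicator {0<..} (fst z) * (\<bar>v z\<bar> powr p * G (w - z))"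
  let ?E = "\<lambda>z. epow (U z) (p - 1) * ennreal \<bar>u z - v z\<bar>"
  have "nonlin u w - nonlin v w = (\<integral>z. ?I u z - ?I v z \<partial>lborel)"
    unfolding nonlin_def using iu iv by simp
  hence "ennreal \<bar>nonlin u w - nonlin v w\<bar> \<le> (\<integral>\<^sup>+z. ennreal (abs (?I u z - ?I v z)) \<partial>lborel)"
    using ennreal_abs_integral_le[of lborel "\<lambda>z. ?I u z - ?I v z"] by (simp only:)
  also have "\<dots> \<le> (\<integral>\<^sup>+z. ennreal p * (indicator {0<..} (fst z) * (ennreal \<bar>G (w - z)\<bar> * ?E z)) \<partial>lborel)"
  proof (intro nn_integral_mono)
    fix z :: "real \<times> 'a"
    have "ennreal (abs (?I u z - ?I v z)) = indicator {0<..} (fst z) * (ennreal \<bar>G (w - z)\<bar> * ennreal (abs (\<bar>u z\<bar> powr p - \<bar>v z\<bar> powr p)))"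
      by (rule ennreal_abs_indicator_diff_mult)
    also have "\<dots> \<le> indicator {0<..} (fst z) * (ennreal \<bar>G (w - z)\<bar> * (ennreal p * ?E z))"
      by (intro mult_left_mono ennreal_abs_powr_diff_le[OF uv(1)[of z] uv(2)[of z] p] zero_le)
    finally show "ennreal (abs (?I u z - ?I v z)) \<le> ennreal p * (indicator {0<..} (fst z) * (ennreal \<bar>G (w - z)\<bar> * ?E z))"
      by (simp only: mult.left_commute[of "ennreal p"])
  qed
  also have "\<dots> = ennreal p * duhamel G ?E w"
    unfolding duhamel_def by (intro nn_integral_cmult) measurable
  finally show ?thesis .
qed

text \<open>Picard iteration below the majorant. The bound |v n| \<le> U holds at every point, and
  the integrand of the Duhamel term of U dominates when the limit is taken in the nonlinear term,
  since that term is finite wherever U is.\<close>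

lemma ex_fixed_point:
  fixes \<Lambda> :: "real \<times> 'a \<Rightarrow> ennreal" and b :: "real \<times> 'a \<Rightarrow> real"
  assumes [measurable]: "U \<in> borel_measurable borel" "b \<in> borel_measurable borel"
    and b: "\<And>w. ennreal \<bar>b w\<bar> \<le> \<Lambda> w"
    and U: "\<And>w. U w = \<Lambda> w + duhamel G (\<lambda>z. epow (U z) p) w"
    and M: "0 < M" "\<And>t. 0 < t \<Longrightarrow> t < T \<Longrightarrow> Lq_le q M (\<lambda>x. U (t, x))"
  shows "\<exists>u. u \<in> borel_measurable borel \<and> (\<forall>w. ennreal \<bar>u w\<bar> \<le> U w) \<and>
    (AE w in lborel. 0 < fst w \<and> fst w < T \<longrightarrow> U w < \<top> \<and> u w = b w + nonlin u w)"
proof -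
  define v where "v = rec_nat (\<lambda>_. 0) (\<lambda>_ v w. b w + nonlin v w)"
  have v0: "v 0 = (\<lambda>_. 0)" and vS: "v (Suc n) = (\<lambda>w. b w + nonlin (v n) w)" for n
    by (simp_all add: v_def)
  have [measurable]: "v n \<in> borel_measurable borel" for n
    by (induction n) (simp_all add: v0 vS)
  have vU: "ennreal \<bar>v n w\<bar> \<le> U w" for n w
  proof (induction n arbitrary: w)
    case (Suc n)
    have "ennreal \<bar>v (Suc n) w\<bar> \<le> ennreal (\<bar>b w\<bar> + \<bar>nonlin (v n) w\<bar>)" unfolding vS by (intro ennreal_leI) auto
    also have "\<dots> = ennreal \<bar>b w\<bar> + ennreal \<bar>nonlin (v n) w\<bar>" by simp
    also have "\<dots> \<le> \<Lambda> w + duhamel G (\<lambda>z. epow (ennreal \<bar>v n z\<bar>) p) w" by (intro add_mono b nonlin_le)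
    also have "\<dots> \<le> \<Lambda> w + duhamel G (\<lambda>z. epow (U z) p) w"
      using Suc p by (intro add_mono duhamel_mono_AE[OF G]) (auto intro!: epow_mono)
    finally show ?case by (simp add: U[of w, symmetric])
  qed (simp add: v0)
  \<comment> \<open>Taking the supremum over all pairs of late iterates instead of consecutive ones
    yields the Cauchy property directly, without summing a series.\<close>
  define d where "d n w = (SUP m. SUP k. ennreal \<bar>v (n + m) w - v (n + k) w\<bar>)" for n w
  have [measurable]: "d n \<in> borel_measurable borel" for n unfolding d_def by measurable
  have d_upper: "ennreal \<bar>v i w - v j w\<bar> \<le> d n w" if "n \<le> i" "n \<le> j" for i j n w
  proof -
    have "ennreal \<bar>v (n + (i - n)) w - v (n + (j - n)) w\<bar> \<le> d n w"
      unfolding d_def by (rule SUP_upper2[of "i - n"], simp, rule SUP_upper2[of "j - n"]) auto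
    thus ?thesis using that by simp
  qed
  have d2U: "d n w \<le> ennreal 2 * U w" for n w
    unfolding d_def
  proof (intro SUP_least)
    fix m k
    have "ennreal (abs (v (n + m) w - v (n + k) w)) \<le> ennreal (\<bar>v (n + m) w\<bar> + \<bar>v (n + k) w\<bar>)" by (intro ennreal_leI) auto
    also have "\<dots> = ennreal \<bar>v (n + m) w\<bar> + ennreal \<bar>v (n + k) w\<bar>" by simp
    also have "\<dots> \<le> U w + U w" by (intro add_mono vU)
    finally show "ennreal \<bar>v (n + m) w - v (n + k) w\<bar> \<le> ennreal 2 * U w" by (simp add: mult_2)
  qed
  have Ufin: "AE w in lborel. 0 < fst w \<and> fst w < T \<longrightarrow> U w < \<top>"
  proof (rule AE_lborel_pairI)
    show "AE t in lborel. AE x in lborel. 0 < fst (t, x) \<and> fst (t, x) < T \<longrightarrow> U (t, x) < \<top>"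
    proof (rule AE_I2)
      fix t :: real
      show "AE x in lborel. 0 < fst (t, x) \<and> fst (t, x) < T \<longrightarrow> U (t, x) < \<top>"
      proof (cases "0 < t \<and> t < T")
        case True
        hence "AE x in lborel. U (t, x) < \<top>" using M q1 by (intro Lq_le_finite[of _ q M]) auto
        thus ?thesis by eventually_elim simp
      qed auto
    qed
  qed measurable
  have duhamel_fin: "duhamel G (\<lambda>z. epow (U z) p) w < \<top>" if "U w < \<top>" for w
    using that unfolding U[of w] by (simp add: less_top[symmetric])
  have "AE w in lborel. 0 < fst w \<and> fst w < T \<longrightarrow> (INF n. d n w) = 0"
  proof (rule gronwall_seq[where U = U and M = M and D = "2 * M"])
    show "AE \<tau> in lborel. 0 < \<tau> \<and> \<tau> < T \<longrightarrow> Lq_le q M (\<lambda>y. U (\<tau>, y))" using M by auto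
    show "AE \<tau> in lborel. 0 < \<tau> \<and> \<tau> < T \<longrightarrow> Lq_le q (2 * M) (\<lambda>y. d 0 (\<tau>, y))"
    proof (intro AE_I2 impI)
      fix \<tau> :: real assume \<tau>: "0 < \<tau> \<and> \<tau> < T"
      have "Lq_le q (2 * M) (\<lambda>y. ennreal 2 * U (\<tau>, y))" using M \<tau> q1 by (intro Lq_le_cmult) auto
      thus "Lq_le q (2 * M) (\<lambda>y. d 0 (\<tau>, y))" by (rule Lq_le_mono) (use d2U M q1 in auto)
    qed
    fix n
    show "AE w in lborel. 0 < fst w \<and> fst w < T \<longrightarrow> d (Suc n) w \<le> ennreal p * duhamel G (\<lambda>z. epow (U z) (p - 1) * d n z) w"
      using Ufin
    proof eventually_elim
      case (elim w)
      show ?case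
      proof
        assume "0 < fst w \<and> fst w < T"
        hence fin: "duhamel G (\<lambda>z. epow (U z) p) w < \<top>" using elim duhamel_fin by simp
        show "d (Suc n) w \<le> ennreal p * duhamel G (\<lambda>z. epow (U z) (p - 1) * d n z) w"
          unfolding d_def[of "Suc n"]
        proof (intro SUP_least)
          fix m k
          \<comment> \<open>The data b cancel; what remains compares iterates of index at least
            n.\<close>
          have eq: "v (Suc n + m) w - v (Suc n + k) w = nonlin (v (n + m)) w - nonlin (v (n + k)) w"
            by (simp add: vS)
          have "ennreal (abs (v (Suc n + m) w - v (Suc n + k) w)) \<le> ennreal p * duhamel G (\<lambda>z. epow (U z) (p - 1) * ennreal \<bar>v (n + m) z - v (n + k) z\<bar>) w"
            unfolding eq by (intro nonlin_diff_le vU nonlin_integrable[OF _ vU fin]) measurable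
          also have "\<dots> \<le> ennreal p * duhamel G (\<lambda>z. epow (U z) (p - 1) * d n z) w"
            by (intro mult_left_mono duhamel_mono_AE[OF G] AE_I2 impI d_upper) auto
          finally show "ennreal \<bar>v (Suc n + m) w - v (Suc n + k) w\<bar> \<le> ennreal p * duhamel G (\<lambda>z. epow (U z) (p - 1) * d n z) w" .
        qed
      qed
    qed
  qed (use M(1) in simp_all)
  hence conv: "AE w in lborel. 0 < fst w \<and> fst w < T \<longrightarrow> convergent (\<lambda>n. v n w)"
  proof eventually_elim
    case (elim w)
    show ?case
    proof
      assume "0 < fst w \<and> fst w < T"
      hence inf0: "(INF n. d n w) = 0" using elim by simp
      have "Cauchy (\<lambda>n. v n w)"
      proof (rule metric_CauchyI)
        fix e :: real assume e: "e > 0"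
        have "(INF n. d n w) < ennreal e" using inf0 e by simp
        then obtain n where n: "d n w < ennreal e" by (auto simp: INF_less_iff)
        have "dist (v i w) (v j w) < e" if "i \<ge> n" "j \<ge> n" for i j
        proof -
          have "ennreal \<bar>v i w - v j w\<bar> < ennreal e" using d_upper[OF that] n by (rule le_less_trans)
          thus ?thesis by (simp add: dist_real_def ennreal_less_iff)
        qed
        thus "\<exists>n. \<forall>i\<ge>n. \<forall>j\<ge>n. dist (v i w) (v j w) < e" by blast
      qed
      thus "convergent (\<lambda>n. v n w)" by (rule Cauchy_convergent)
    qed
  qed
  \<comment> \<open>The default 0 keeps u measurable and |u| \<le> U at every point.\<close>
  define u where "u w = (if convergent (\<lambda>n. v n w) then lim (\<lambda>n. v n w) else 0)" for w
  have [measurable]: "Measurable.pred borel (\<lambda>w. convergent (\<lambda>n. v n w))"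
    unfolding Cauchy_convergent_iff[symmetric] by measurable
  have [measurable]: "u \<in> borel_measurable borel" unfolding u_def by measurable
  have lim: "(\<lambda>n. v n w) \<longlonglongrightarrow> u w" if "convergent (\<lambda>n. v n w)" for w
    using that by (simp add: u_def convergent_LIMSEQ_iff)
  have uU: "ennreal \<bar>u w\<bar> \<le> U w" for w
  proof (cases "convergent (\<lambda>n. v n w)")
    case True
    have "(\<lambda>n. ennreal \<bar>v n w\<bar>) \<longlonglongrightarrow> ennreal \<bar>u w\<bar>" by (intro tendsto_ennrealI tendsto_rabs lim True)
    thus ?thesis by (rule tendsto_upperbound) (use vU in auto)
  qed (simp add: u_def)
  have "AE w in lborel. 0 < fst w \<and> fst w < T \<longrightarrow> U w < \<top> \<and> u w = b w + nonlin u w"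
    using Ufin conv
  proof eventually_elim
    case (elim w)
    show ?case
    proof
      assume w: "0 < fst w \<and> fst w < T"
      hence fin: "duhamel G (\<lambda>z. epow (U z) p) w < \<top>" using elim duhamel_fin by simp
      let ?B = "\<lambda>z. indicator {0<..} (fst z) * (ennreal \<bar>G (w - z)\<bar> * epow (U z) p)"
      have B: "AE z in lborel. ?B z \<noteq> \<infinity>"
        using fin unfolding duhamel_def by (intro nn_integral_PInf_AE) auto
      have "(\<lambda>n. nonlin (v n) w) \<longlonglongrightarrow> nonlin u w"
        unfolding nonlin_def
      proof (rule integral_dominated_convergence[where w = "\<lambda>z. enn2real (?B z)"])
        show "integrable lborel (\<lambda>z. enn2real (?B z))"
        proof (rule integrableI_nonneg)
          have "(\<integral>\<^sup>+z. ennreal (enn2real (?B z)) \<partial>lborel) \<le> (\<integral>\<^sup>+z. ?B z \<partial>lborel)"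
            by (intro nn_integral_mono) (simp add: ennreal_enn2real_if)
          thus "(\<integral>\<^sup>+z. ennreal (enn2real (?B z)) \<partial>lborel) < \<infinity>"
            using fin unfolding duhamel_def infinity_ennreal_def by (rule le_less_trans)
          show "(\<lambda>z. enn2real (?B z)) \<in> borel_measurable lborel" by measurable
          show "AE z in lborel. 0 \<le> enn2real (?B z)" by simp
        qed
        show "AE z in lborel. (\<lambda>n. indicator {0<..} (fst z) * (\<bar>v n z\<bar> powr p * G (w - z))) \<longlonglongrightarrow> indicator {0<..} (fst z) * (\<bar>u z\<bar> powr p * G (w - z))"
          using conv
        proof eventually_elim
          case (elim z)
          show ?case
          \<comment> \<open>Convergence is known only for times in (0, T); at all other times the
            indicator or the causality of G makes the integrand vanish.\<close>
          proof (cases "0 < fst z \<and> fst z < fst w")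
            case True
            hence "(\<lambda>n. v n z) \<longlonglongrightarrow> u z" using elim w by (intro lim) auto
            thus ?thesis using p by (intro tendsto_mult tendsto_const tendsto_powr' tendsto_rabs) auto
          next
            case False
            hence "fst z \<le> 0 \<or> G (w - z) = 0"
              using G unfolding causal_kernel_def by (metis fst_diff diff_le_0_iff_le not_less)
            thus ?thesis
            proof
              assume "fst z \<le> 0"
              thus ?thesis by simp
            next
              assume "G (w - z) = 0"
              thus ?thesis by simp
            qed
          qed
        qed
        fix n
        show "AE z in lborel. norm (indicator {0<..} (fst z) * (\<bar>v n z\<bar> powr p * G (w - z))) \<le> enn2real (?B z)"
          using B
        proof eventually_elim
          case (elim z)
          have "ennreal \<bar>indicator {0<..} (fst z) * (\<bar>v n z\<bar> powr p * G (w - z))\<bar> \<le> ?B z"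
            unfolding nonlin_integrand using vU p by (intro mult_left_mono epow_mono) auto
          thus ?case using elim by (metis enn2real_mono enn2real_ennreal abs_ge_zero real_norm_def less_top infinity_ennreal_def)
        qed
        show "(\<lambda>z. indicator {0<..} (fst z) * (\<bar>u z\<bar> powr p * G (w - z))) \<in> borel_measurable lborel" by measurable
        show "(\<lambda>z. indicator {0<..} (fst z) * (\<bar>v n z\<bar> powr p * G (w - z))) \<in> borel_measurable lborel" by measurable
      qed
      hence "(\<lambda>n. v (Suc n) w) \<longlonglongrightarrow> b w + nonlin u w" unfolding vS by (intro tendsto_intros)
      moreover have "(\<lambda>n. v (Suc n) w) \<longlonglongrightarrow> u w" using elim w by (intro LIMSEQ_Suc lim) auto
      ultimately have "u w = b w + nonlin u w" by (rule LIMSEQ_unique[rotated])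
      thus "U w < \<top> \<and> u w = b w + nonlin u w" using elim w by simp
    qed
  qed
  moreover have "u \<in> borel_measurable borel" by measurable
  ultimately show ?thesis
    using uU by blast
qed

end

section \<open>Mild solutions\<close>

text \<open>
  Extended by zero to negative times, the kernel turns the Duhamel integral into a convolution on
  $R \times R^N$.
\<close>

definition causal_ext :: "(real \<Rightarrow> 'a::euclidean_space \<Rightarrow> real) \<Rightarrow> real \<times> 'a \<Rightarrow> real" where
  "causal_ext K z = indicator {0<..} (fst z) * K (fst z) (snd z)"

lemma causal_kernel_ext:
  assumes "has_symbol K m"
  shows "causal_kernel (causal_ext K)"
proof -
  have "causal_ext K = (\<lambda>z. indicator ({0<..} \<times> UNIV) z *\<^sub>R (case z of (t, x) \<Rightarrow> K t x))"
    by (auto simp: causal_ext_def fun_eq_iff split: split_indicator)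
  thus ?thesis using assms
    by (auto simp: causal_kernel_def has_symbol_def set_borel_measurable_def causal_ext_def)
qed

lemma causal_ext_diff_integrand:
  "indicator ({0<..<t} \<times> UNIV) z *\<^sub>R (case z of (\<tau>, y) \<Rightarrow> f \<tau> y * K (t - \<tau>) (x - y)) =
    indicator {0<..} (fst z) * (f (fst z) (snd z) * causal_ext K ((t, x) - z))"
  by (cases z) (auto simp: causal_ext_def split: split_indicator)

lemma set_integrable_strip_iff:
  "set_integrable lborel ({0<..<t} \<times> UNIV) (\<lambda>(\<tau>, y). f \<tau> y * K (t - \<tau>) (x - y)) \<longleftrightarrow>
    integrable lborel (\<lambda>z. indicator {0<..} (fst z) * (f (fst z) (snd z) * causal_ext K ((t, x) - z)))"
  unfolding set_integrable_def causal_ext_diff_integrand ..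

text \<open>Mild solutions are defined by iterated integrals, the estimates use joint ones. Absolute
  convergence on the strip, which is part of the notion of solution, makes them equal by
  Fubini.\<close>

lemma set_integral_strip:
  fixes f :: "real \<Rightarrow> 'a::euclidean_space \<Rightarrow> real"
  assumes "set_integrable lborel ({0<..<t} \<times> UNIV) (\<lambda>(\<tau>, y). f \<tau> y * K (t - \<tau>) (x - y))"
  shows "(LINT \<tau>:{0<..<t}|lborel. LINT y|lborel. f \<tau> y * K (t - \<tau>) (x - y)) =
    (\<integral>z. indicator {0<..} (fst z) * (f (fst z) (snd z) * causal_ext K ((t, x) - z)) \<partial>lborel)"
proof -
  let ?F = "\<lambda>z. indicator ({0<..<t} \<times> UNIV) z *\<^sub>R (case z of (\<tau>, y) \<Rightarrow> f \<tau> y * K (t - \<tau>) (x - y))"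
  have "integrable (lborel \<Otimes>\<^sub>M lborel) ?F"
    using assms unfolding set_integrable_def by (simp only: lborel_prod)
  from lborel_pair.integral_fst'[OF this]
  have "(\<integral>\<tau>. \<integral>y. ?F (\<tau>, y) \<partial>lborel \<partial>lborel) = (\<integral>z. ?F z \<partial>lborel)" by (simp only: lborel_prod)
  moreover have "(\<integral>y. ?F (\<tau>, y) \<partial>lborel) = indicator {0<..<t} \<tau> *\<^sub>R (\<integral>y. f \<tau> y * K (t - \<tau>) (x - y) \<partial>lborel)" for \<tau>
    by (cases "\<tau> \<in> {0<..<t}") auto
  ultimately show ?thesis
    unfolding set_lebesgue_integral_def causal_ext_diff_integrand[symmetric] by simp
qed

section \<open>Bounds for the initial data, the forcing term and the kernels\<close>

text \<open>For finite q this is Minkowski's inequality, applied to the translates of f with the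
  weights |k|.\<close>

lemma convolution_Lq_le:
  fixes f k :: "'a::euclidean_space \<Rightarrow> real"
  assumes [measurable]: "f \<in> borel_measurable borel" "k \<in> borel_measurable borel"
    and k: "(\<integral>\<^sup>+x. ennreal \<bar>k x\<bar> \<partial>lborel) \<le> 1" and f: "Lq_le q A (\<lambda>x. ennreal \<bar>f x\<bar>)" and A: "0 < A" and q: "1 \<le> q"
  shows "Lq_le q A (\<lambda>x. \<integral>\<^sup>+y. ennreal (\<bar>f y\<bar> * \<bar>k (x - y)\<bar>) \<partial>lborel)"
  using q
proof (cases rule: ereal_ge1_cases)
  case 1
  have "(\<integral>\<^sup>+y. ennreal (\<bar>f y\<bar> * \<bar>k (x - y)\<bar>) \<partial>lborel) \<le> ennreal A" for x
  proof -
    have "AE y in lborel. ennreal \<bar>f y\<bar> \<le> ennreal A" using f 1 by (simp add: Lq_le_infinity)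
    hence "(\<integral>\<^sup>+y. ennreal (\<bar>f y\<bar> * \<bar>k (x - y)\<bar>) \<partial>lborel) \<le> (\<integral>\<^sup>+y. ennreal A * ennreal \<bar>k (x - y)\<bar> \<partial>lborel)"
      by (intro nn_integral_mono_AE) (auto simp: ennreal_mult elim!: eventually_mono intro!: mult_right_mono)
    also have "\<dots> = ennreal A * (\<integral>\<^sup>+y. ennreal \<bar>k (x - y)\<bar> \<partial>lborel)" by (intro nn_integral_cmult) measurable
    also have "(\<integral>\<^sup>+y. ennreal \<bar>k (x - y)\<bar> \<partial>lborel) = (\<integral>\<^sup>+y. ennreal \<bar>k y\<bar> \<partial>lborel)"
      by (rule nn_integral_reflect[where h = "\<lambda>y. ennreal \<bar>k y\<bar>"]) measurable
    also have "ennreal A * \<dots> \<le> ennreal A * 1" using k by (intro mult_left_mono) auto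
    finally show ?thesis by simp
  qed
  thus ?thesis using 1 by (simp add: Lq_le_infinity)
next
  case (2 r)
  have "(\<integral>\<^sup>+x. epow (\<integral>\<^sup>+y. ennreal (\<bar>f (x - y)\<bar> * \<bar>k y\<bar>) \<partial>lborel) r \<partial>lborel) \<le> ennreal (A powr r)"
  proof (rule minkowski_integral[where w = "\<lambda>e. A * \<bar>k e\<bar>"])
    show "AE e in lborel. (\<integral>\<^sup>+x. ennreal ((\<bar>f (x - e)\<bar> * \<bar>k e\<bar>) powr r) \<partial>lborel) \<le> ennreal ((A * \<bar>k e\<bar>) powr r)"
    proof (rule AE_I2)
      fix e :: 'a
      have "(\<integral>\<^sup>+x. ennreal ((\<bar>f (x - e)\<bar> * \<bar>k e\<bar>) powr r) \<partial>lborel) = (\<integral>\<^sup>+x. ennreal (\<bar>k e\<bar> powr r * \<bar>f (x - e)\<bar> powr r) \<partial>lborel)"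
        by (simp add: powr_mult mult.commute)
      also have "\<dots> = ennreal (\<bar>k e\<bar> powr r) * (\<integral>\<^sup>+x. ennreal (\<bar>f (x - e)\<bar> powr r) \<partial>lborel)"
        by (intro nn_integral_ennreal_cmult) auto
      also have "(\<integral>\<^sup>+x. ennreal (\<bar>f (x - e)\<bar> powr r) \<partial>lborel) = (\<integral>\<^sup>+x. ennreal (\<bar>f (- x)\<bar> powr r) \<partial>lborel)"
        using nn_integral_reflect[where h = "\<lambda>x. ennreal (\<bar>f (- x)\<bar> powr r)" and x = e] by simp
      also have "\<dots> = (\<integral>\<^sup>+x. ennreal (\<bar>f x\<bar> powr r) \<partial>lborel)"
        using nn_integral_reflect[where h = "\<lambda>x. ennreal (\<bar>f x\<bar> powr r)" and x = 0] by simp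
      also have "\<dots> \<le> ennreal (A powr r)" using f 2 by (simp add: Lq_le_ereal epow_ennreal)
      also have "ennreal (\<bar>k e\<bar> powr r) * ennreal (A powr r) = ennreal ((A * \<bar>k e\<bar>) powr r)"
        by (simp add: powr_mult ennreal_mult[symmetric] mult.commute)
      finally show "(\<integral>\<^sup>+x. ennreal ((\<bar>f (x - e)\<bar> * \<bar>k e\<bar>) powr r) \<partial>lborel) \<le> ennreal ((A * \<bar>k e\<bar>) powr r)"
        by (simp add: mult_left_mono)
    qed
    have "(\<integral>\<^sup>+e. ennreal (A * \<bar>k e\<bar>) \<partial>lborel) = ennreal A * (\<integral>\<^sup>+e. ennreal \<bar>k e\<bar> \<partial>lborel)"
      using A by (intro nn_integral_ennreal_cmult) auto
    also have "\<dots> \<le> ennreal A * 1" using k by (intro mult_left_mono) auto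
    finally show "(\<integral>\<^sup>+e. ennreal (A * \<bar>k e\<bar>) \<partial>lborel) \<le> ennreal A" by simp
    show "sigma_finite_measure (lborel :: 'a measure)" "sigma_finite_measure (lborel :: 'a measure)"
      by unfold_locales
  qed (use A 2 in auto)
  moreover have "(\<integral>\<^sup>+y. ennreal (\<bar>f (x - y)\<bar> * \<bar>k y\<bar>) \<partial>lborel) = (\<integral>\<^sup>+y. ennreal (\<bar>f y\<bar> * \<bar>k (x - y)\<bar>) \<partial>lborel)" for x
    using nn_integral_reflect[where h = "\<lambda>y. ennreal (\<bar>f (x - y)\<bar> * \<bar>k y\<bar>)" and x = x] by simp
  ultimately show ?thesis using 2 by (simp add: Lq_le_ereal)
qed

text \<open>Splitting at t/2 separates the two singularities. Both parts scale like t^(\<sigma> +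
  \<alpha>), which is at most 1 for t \<le> 1 because \<sigma> > -\<alpha>.\<close>

lemma beta_integral_bound:
  fixes \<alpha> \<sigma> t :: real
  assumes \<alpha>: "0 < \<alpha>" "\<alpha> < 1" and \<sigma>: "- \<alpha> < \<sigma>" and t: "0 < t" "t \<le> 1"
  shows "(\<integral>\<^sup>+\<tau>. ennreal (indicator {0<..<t} \<tau> * ((t - \<tau>) powr (\<alpha> - 1) * \<tau> powr \<sigma>)) \<partial>lborel)
    \<le> ennreal (2 powr (1 - \<alpha>) / (\<sigma> + 1) + 2 powr \<bar>\<sigma>\<bar> / \<alpha>)"
proof -
  have \<sigma>1: "\<sigma> + 1 > 0" using \<alpha> \<sigma> by simp
  \<comment> \<open>\<open>?a\<close> bounds the kernel on the first half of the interval,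
    \<open>?b\<close> bounds the power of \<tau> on the second; the absolute value in the exponent
    of 2 covers both signs of \<sigma>.\<close>
  let ?a = "(t / 2) powr (\<alpha> - 1)" and ?b = "2 powr \<bar>\<sigma>\<bar> * t powr \<sigma>"
  have pw: "indicator {0<..<t} \<tau> * ((t - \<tau>) powr (\<alpha> - 1) * \<tau> powr \<sigma>) \<le>
      ?a * (indicator {0..t} \<tau> * \<tau> powr (\<sigma> + 1 - 1)) + ?b * (indicator {0..t} (t - \<tau>) * (t - \<tau>) powr (\<alpha> - 1))" (is "?l \<le> ?r") for \<tau>
  proof (cases "0 < \<tau> \<and> \<tau> < t")
    case True
    show ?thesis
    proof (cases "\<tau> \<le> t / 2")
      case le: True
      have "(t - \<tau>) powr (\<alpha> - 1) \<le> ?a" using True le \<alpha> by (intro powr_mono2') auto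
      hence "(t - \<tau>) powr (\<alpha> - 1) * \<tau> powr \<sigma> \<le> ?a * \<tau> powr \<sigma>" by (intro mult_right_mono) auto
      also have "\<dots> \<le> ?a * \<tau> powr \<sigma> + ?b * (t - \<tau>) powr (\<alpha> - 1)" by simp
      finally show ?thesis using True by simp
    next
      case False
      have "\<tau> powr \<sigma> \<le> ?b"
      proof (cases "\<sigma> \<ge> 0")
        case True
        have "\<tau> powr \<sigma> \<le> t powr \<sigma>" using \<open>0 < \<tau> \<and> \<tau> < t\<close> True by (intro powr_mono2) auto
        also have "1 * t powr \<sigma> \<le> 2 powr \<bar>\<sigma>\<bar> * t powr \<sigma>" by (intro mult_right_mono ge_one_powr_ge_zero) auto
        finally show ?thesis by simp
      next
        case neg: False
        have "\<tau> powr \<sigma> \<le> (t / 2) powr \<sigma>" using False neg t by (intro powr_mono2') auto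
        also have "\<dots> = ?b" using neg t by (simp add: powr_divide powr_minus_divide)
        finally show ?thesis .
      qed
      hence "(t - \<tau>) powr (\<alpha> - 1) * \<tau> powr \<sigma> \<le> (t - \<tau>) powr (\<alpha> - 1) * ?b" by (intro mult_left_mono) auto
      also have "\<dots> \<le> ?a * \<tau> powr \<sigma> + ?b * (t - \<tau>) powr (\<alpha> - 1)" by simp
      finally show ?thesis using True by simp
    qed
  qed auto
  have "(\<integral>\<^sup>+\<tau>. ennreal (indicator {0<..<t} \<tau> * ((t - \<tau>) powr (\<alpha> - 1) * \<tau> powr \<sigma>)) \<partial>lborel) \<le>
     (\<integral>\<^sup>+\<tau>. ennreal (?a * (indicator {0..t} \<tau> * \<tau> powr (\<sigma> + 1 - 1))) + ennreal (?b * (indicator {0..t} (t - \<tau>) * (t - \<tau>) powr (\<alpha> - 1))) \<partial>lborel)"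
    by (intro nn_integral_mono) (subst ennreal_plus[symmetric], simp, simp, rule ennreal_leI[OF pw])
  also have "\<dots> = (\<integral>\<^sup>+\<tau>. ennreal (?a * (indicator {0..t} \<tau> * \<tau> powr (\<sigma> + 1 - 1))) \<partial>lborel) +
      (\<integral>\<^sup>+\<tau>. ennreal (?b * (indicator {0..t} (t - \<tau>) * (t - \<tau>) powr (\<alpha> - 1))) \<partial>lborel)"
    by (intro nn_integral_add) measurable
  also have "(\<integral>\<^sup>+\<tau>. ennreal (?b * (indicator {0..t} (t - \<tau>) * (t - \<tau>) powr (\<alpha> - 1))) \<partial>lborel)
      = (\<integral>\<^sup>+\<tau>. ennreal (?b * (indicator {0..t} \<tau> * \<tau> powr (\<alpha> - 1))) \<partial>lborel)"
    by (rule nn_integral_reflect[where h = "\<lambda>\<tau>. ennreal (?b * (indicator {0..t} \<tau> * \<tau> powr (\<alpha> - 1)))"]) measurable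
  also have "\<dots> = ennreal ?b * ennreal (t powr \<alpha> / \<alpha>)"
    by (subst nn_integral_ennreal_cmult) (use nn_integral_powr_from_0[OF \<alpha>(1), of t] t in auto)
  also have "(\<integral>\<^sup>+\<tau>. ennreal (?a * (indicator {0..t} \<tau> * \<tau> powr (\<sigma> + 1 - 1))) \<partial>lborel) = ennreal ?a * ennreal (t powr (\<sigma> + 1) / (\<sigma> + 1))"
    by (subst nn_integral_ennreal_cmult) (use nn_integral_powr_from_0[OF \<sigma>1, of t] t in auto)
  also have "ennreal ?a * ennreal (t powr (\<sigma> + 1) / (\<sigma> + 1)) + ennreal ?b * ennreal (t powr \<alpha> / \<alpha>)
      = ennreal (?a * (t powr (\<sigma> + 1) / (\<sigma> + 1)) + ?b * (t powr \<alpha> / \<alpha>))"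
    using \<sigma>1 \<alpha> by (simp add: ennreal_mult[symmetric] ennreal_plus[symmetric] del: ennreal_plus)
  also have "?a * (t powr (\<sigma> + 1) / (\<sigma> + 1)) + ?b * (t powr \<alpha> / \<alpha>) = (2 powr (1 - \<alpha>) / (\<sigma> + 1) + 2 powr \<bar>\<sigma>\<bar> / \<alpha>) * t powr (\<sigma> + \<alpha>)"
  proof -
    have "?a * t powr (\<sigma> + 1) = 2 powr (1 - \<alpha>) * t powr (\<sigma> + \<alpha>)"
    proof -
      have "?a = 2 powr (1 - \<alpha>) * t powr (\<alpha> - 1)" using t powr_minus[of 2 "\<alpha> - 1"] by (simp add: powr_divide field_simps)
      thus ?thesis by (simp add: mult.assoc powr_add[symmetric] add.commute)
    qed
    moreover have "?b * t powr \<alpha> = 2 powr \<bar>\<sigma>\<bar> * t powr (\<sigma> + \<alpha>)" by (simp add: mult.assoc powr_add)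
    ultimately show ?thesis by (simp add: distrib_right)
  qed
  also have "\<dots> \<le> (2 powr (1 - \<alpha>) / (\<sigma> + 1) + 2 powr \<bar>\<sigma>\<bar> / \<alpha>) * 1"
  proof (rule mult_left_mono)
    have "0 \<le> 2 powr (1 - \<alpha>) / (\<sigma> + 1)" "0 \<le> 2 powr \<bar>\<sigma>\<bar> / \<alpha>" using \<sigma>1 \<alpha> by simp_all
    thus "0 \<le> 2 powr (1 - \<alpha>) / (\<sigma> + 1) + 2 powr \<bar>\<sigma>\<bar> / \<alpha>" by linarith
    show "t powr (\<sigma> + \<alpha>) \<le> 1" using t \<sigma> by (intro powr_le1) auto
  qed
  finally show ?thesis by (simp add: ennreal_leI)
qed

text \<open>For finite q, the assumption q \<ge> p keeps (p - 1)/q below 1, so r is a finite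
  exponent, and q > N (p - 1)/(2s) turns into the condition N/2 (1 - 1/r) < s of the kernel
  estimate.\<close>

lemma ex_Y_kernel_bound:
  fixes \<alpha> s p :: real and q :: ereal
  assumes \<alpha>: "0 < \<alpha>" "\<alpha> < 1" and s: "0 < s" "s < 1" and p: "1 < p"
    and q: "ereal (real DIM('a::euclidean_space) * (p - 1) / (2 * s)) < q" "ereal p \<le> q"
  shows "\<exists>C>0. \<exists>\<beta>>0. kernel_bound p q (causal_ext (Y_kernel \<alpha> s :: real \<Rightarrow> 'a \<Rightarrow> real)) (\<lambda>t. C * t powr (\<beta> - 1))"
proof -
  define r where "r = (if q = \<infinity> then 1 else 1 / (1 - (p - 1) / real_of_ereal q))"
  have *: "1 \<le> r \<and> DIM('a) / 2 * (1 - 1 / r) < s"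
  proof (cases q)
    case (real Q)
    have Q: "Q \<ge> p" "real DIM('a) * (p - 1) / (2 * s) < Q" using q real by auto
    have "(p - 1) / Q < 1" "0 \<le> (p - 1) / Q" using Q p by auto
    moreover have "DIM('a) / 2 * ((p - 1) / Q) < s" using Q p s by (simp add: field_simps)
    ultimately show ?thesis using real by (simp add: r_def)
  qed (use q s in \<open>auto simp: r_def\<close>)
  define \<beta> where "\<beta> = \<alpha> - \<alpha> / s * (DIM('a) / 2 * (1 - 1 / r))"
  have "\<alpha> / s * (DIM('a) / 2 * (1 - 1 / r)) < \<alpha> / s * s" using * \<alpha> s by (intro mult_strict_left_mono) auto
  hence \<beta>: "\<beta> > 0" using s by (simp add: \<beta>_def)
  obtain C where C: "C > 0" "\<And>t. t > 0 \<Longrightarrow> (\<integral>\<^sup>+x. ennreal (\<bar>Y_kernel \<alpha> s t (x::'a)\<bar> powr r) \<partial>lborel) \<le> ennreal ((C * t powr (\<beta> - 1)) powr r)"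
    using nn_integral_Y_kernel[OF \<alpha> s, of r, where 'a = 'a] * unfolding \<beta>_def by blast
  have "kernel_bound p q (causal_ext (Y_kernel \<alpha> s :: real \<Rightarrow> 'a \<Rightarrow> real)) (\<lambda>t. C * t powr (\<beta> - 1))"
    unfolding kernel_bound_def r_def[symmetric] Let_def using C by (simp add: causal_ext_def)
  thus ?thesis using C \<beta> by blast
qed

text \<open>For p = 1 the exponent in \<open>kernel_bound\<close> is 1 whatever q is. This version
  serves the forcing term, which is mapped from L^q to L^q.\<close>

lemma ex_Y_kernel_bound_linear:
  fixes \<alpha> s :: real and q :: ereal
  assumes \<alpha>: "0 < \<alpha>" "\<alpha> < 1" and s: "0 < s" "s < 1"
  shows "\<exists>C>0. kernel_bound 1 q (causal_ext (Y_kernel \<alpha> s :: real \<Rightarrow> 'a::euclidean_space \<Rightarrow> real)) (\<lambda>t. C * t powr (\<alpha> - 1))"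
proof -
  obtain C where C: "C > 0" "\<And>t. t > 0 \<Longrightarrow> (\<integral>\<^sup>+x. ennreal (\<bar>Y_kernel \<alpha> s t (x::'a)\<bar> powr 1) \<partial>lborel) \<le> ennreal ((C * t powr (\<alpha> - 1)) powr 1)"
    using nn_integral_Y_kernel[OF \<alpha> s, of 1, where 'a = 'a] s by auto
  thus ?thesis by (intro exI[of _ C]) (auto simp: kernel_bound_def causal_ext_def)
qed

text \<open>The difference of the two solutions, taken as a constant sequence, satisfies the
  recursive bound with the weight U = |u| + |v|, and the infimum of a constant sequence is the
  difference itself.\<close>

lemma (in nonlinear_kernel) fixed_point_unique:
  fixes u v b :: "real \<times> 'a \<Rightarrow> real"
  assumes [measurable]: "u \<in> borel_measurable borel" "v \<in> borel_measurable borel"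
    and M: "0 < M" and u: "AE \<tau> in lborel. 0 < \<tau> \<and> \<tau> < T \<longrightarrow> Lq_le q M (\<lambda>y. ennreal \<bar>u (\<tau>, y)\<bar>)"
    and v: "AE \<tau> in lborel. 0 < \<tau> \<and> \<tau> < T \<longrightarrow> Lq_le q M (\<lambda>y. ennreal \<bar>v (\<tau>, y)\<bar>)"
    and equ: "AE w in lborel. 0 < fst w \<and> fst w < T \<longrightarrow>
      integrable lborel (\<lambda>z. indicator {0<..} (fst z) * (\<bar>u z\<bar> powr p * G (w - z))) \<and> u w = b w + nonlin u w"
    and eqv: "AE w in lborel. 0 < fst w \<and> fst w < T \<longrightarrow>
      integrable lborel (\<lambda>z. indicator {0<..} (fst z) * (\<bar>v z\<bar> powr p * G (w - z))) \<and> v w = b w + nonlin v w"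
  shows "AE w in lborel. 0 < fst w \<and> fst w < T \<longrightarrow> u w = v w"
proof -
  define U where "U w = ennreal \<bar>u w\<bar> + ennreal \<bar>v w\<bar>" for w
  define d where "d w = ennreal \<bar>u w - v w\<bar>" for w
  have [measurable]: "U \<in> borel_measurable borel" "d \<in> borel_measurable borel"
    unfolding U_def d_def by measurable
  have dU: "d w \<le> U w" for w
    by (auto simp: U_def d_def ennreal_plus[symmetric] intro!: ennreal_leI simp del: ennreal_plus)
  have U: "AE \<tau> in lborel. 0 < \<tau> \<and> \<tau> < T \<longrightarrow> Lq_le q (4 * (M + M)) (\<lambda>y. U (\<tau>, y))"
    using u v
  proof eventually_elim
    case (elim \<tau>)
    show ?case
    proof
      assume "0 < \<tau> \<and> \<tau> < T"
      hence "Lq_le q M (\<lambda>y. ennreal \<bar>u (\<tau>, y)\<bar>)" "Lq_le q M (\<lambda>y. ennreal \<bar>v (\<tau>, y)\<bar>)" using elim by auto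
      thus "Lq_le q (4 * (M + M)) (\<lambda>y. U (\<tau>, y))"
        unfolding U_def using M q1 by (intro Lq_le_add) auto
    qed
  qed
  have "AE w in lborel. 0 < fst w \<and> fst w < T \<longrightarrow> (INF n::nat. d w) = 0"
  proof (rule gronwall_seq[where U = U and M = "4 * (M + M)" and D = "4 * (M + M)"])
    show "AE \<tau> in lborel. 0 < \<tau> \<and> \<tau> < T \<longrightarrow> Lq_le q (4 * (M + M)) (\<lambda>y. d (\<tau>, y))"
      using U
    proof eventually_elim
      case (elim \<tau>)
      show ?case
      proof
        assume "0 < \<tau> \<and> \<tau> < T"
        hence "Lq_le q (4 * (M + M)) (\<lambda>y. U (\<tau>, y))" using elim by simp
        thus "Lq_le q (4 * (M + M)) (\<lambda>y. d (\<tau>, y))" by (rule Lq_le_mono) (use dU M q1 in auto)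
      qed
    qed
    show "AE w in lborel. 0 < fst w \<and> fst w < T \<longrightarrow> d w \<le> ennreal p * duhamel G (\<lambda>z. epow (U z) (p - 1) * d z) w"
      using equ eqv
    proof eventually_elim
      case (elim w)
      show ?case
      proof
        assume w: "0 < fst w \<and> fst w < T"
        hence eq: "u w - v w = nonlin u w - nonlin v w" using elim by simp
        show "d w \<le> ennreal p * duhamel G (\<lambda>z. epow (U z) (p - 1) * d z) w"
          unfolding d_def eq by (rule nonlin_diff_le) (use elim w in \<open>simp_all add: U_def\<close>)
      qed
    qed
  qed (use U M in simp_all)
  thus ?thesis by eventually_elim (simp add: d_def)
qed

lemma in_Lq_imp_Lq_le:
  assumes "in_Lq q f" "1 \<le> q"
  shows "\<exists>A>0. Lq_le q A (\<lambda>x. ennreal \<bar>f x\<bar>)"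
proof -
  have f: "f \<in> borel_measurable borel" "Lq_norm q f < \<infinity>" using assms by (auto simp: in_Lq_def)
  obtain A where A: "A > 0" "Lq_norm q f \<le> ereal A"
  proof (cases "Lq_norm q f")
    case (real c)
    thus ?thesis by (intro that[of "max 1 c"]) auto
  next
    case MInf
    thus ?thesis by (intro that[of 1]) auto
  qed (use f in auto)
  thus ?thesis using Lq_le_norm_iff[OF f(1), of A q] assms by auto
qed

theorem theorem1p1:
  fixes u0 w :: "'a::euclidean_space \<Rightarrow> real"
    and p \<alpha> s \<sigma> :: real and q :: ereal
  assumes "p > 1"
    and "0 < \<alpha>" "\<alpha> < 1"
    and "0 < s" "s < 1"
    and "\<sigma> > - \<alpha>"
    and "q > ereal (real DIM('a) * (p - 1) / (2 * s))"
    and "q \<ge> ereal p"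
    and "AE x in lborel. u0 x \<ge> 0"
    and "continuous_on UNIV w"
    and "in_Lq q u0"
    and "in_Lq q w"
  shows "\<exists>T>0.
    (\<exists>u. in_Linf_Lq T q u \<and> mild_solution \<alpha> s p \<sigma> u0 w T u) \<and>
    (\<forall>u v. in_Linf_Lq T q u \<and> mild_solution \<alpha> s p \<sigma> u0 w T u \<and>
           in_Linf_Lq T q v \<and> mild_solution \<alpha> s p \<sigma> u0 w T v \<longrightarrow>
           (AE (t, x) in lborel. t \<in> {0<..<T} \<longrightarrow> u t x = v t x))"
proof -
  note \<alpha> = assms(2,3) and s = assms(4,5)
  have q1: "1 \<le> q" using assms(1,8) by (metis less_imp_le ereal_less_eq(3) one_ereal_def order_trans)
  let ?Y = "Y_kernel \<alpha> s :: real \<Rightarrow> 'a \<Rightarrow> real" and ?Z = "Z_kernel \<alpha> s :: real \<Rightarrow> 'a \<Rightarrow> real"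
  define G where "G = causal_ext ?Y"
  define Z where "Z = causal_ext ?Z"
  obtain C \<beta> where C\<beta>: "C > 0" "\<beta> > 0" "kernel_bound p q G (\<lambda>t. C * t powr (\<beta> - 1))"
    using ex_Y_kernel_bound[OF \<alpha> s assms(1,7,8)] unfolding G_def by blast
  have G: "causal_kernel G" unfolding G_def by (rule causal_kernel_ext[OF has_symbol_Y_kernel[OF \<alpha> s]])
  have "causal_kernel Z" unfolding Z_def by (rule causal_kernel_ext[OF has_symbol_Z_kernel[OF \<alpha> s]])
  hence [measurable]: "Z \<in> borel_measurable borel" by (simp add: causal_kernel_def)
  interpret nonlinear_kernel G p q C \<beta>
    by unfold_locales (use G C\<beta> assms in auto)
  have [measurable]: "u0 \<in> borel_measurable borel" "w \<in> borel_measurable borel"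
    using assms by (auto simp: in_Lq_def)
  obtain A0 where A0: "A0 > 0" "Lq_le q A0 (\<lambda>x. ennreal \<bar>u0 x\<bar>)" using in_Lq_imp_Lq_le[OF assms(11) q1] by blast
  obtain A1 where A1: "A1 > 0" "Lq_le q A1 (\<lambda>x. ennreal \<bar>w x\<bar>)" using in_Lq_imp_Lq_le[OF assms(12) q1] by blast
  obtain C1 where C1: "C1 > 0" "kernel_bound 1 q G (\<lambda>t. C1 * t powr (\<alpha> - 1))"
    using ex_Y_kernel_bound_linear[OF \<alpha> s] unfolding G_def by blast

  \<comment> \<open>The linear terms with absolute values inside the integrals; the signed versions
    \<open>b1\<close> and \<open>b2\<close> below are dominated by them.\<close>
  define \<Lambda>1 where "\<Lambda>1 v = (\<integral>\<^sup>+y. ennreal (\<bar>u0 y\<bar> * \<bar>Z (fst v, snd v - y)\<bar>) \<partial>lborel)" for v :: "real \<times> 'a"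
  define g where "g z = fst z powr \<sigma> * w (snd z)" for z :: "real \<times> 'a"
  define \<Lambda>2 where "\<Lambda>2 = duhamel G (\<lambda>z. ennreal \<bar>g z\<bar>)"
  define \<Lambda> where "\<Lambda> v = \<Lambda>1 v + \<Lambda>2 v" for v
  have [measurable]: "g \<in> borel_measurable borel" unfolding g_def by measurable
  have [measurable]: "\<Lambda>1 \<in> borel_measurable borel" unfolding \<Lambda>1_def by measurable
  have [measurable]: "\<Lambda>2 \<in> borel_measurable borel" unfolding \<Lambda>2_def by measurable
  have [measurable]: "\<Lambda> \<in> borel_measurable borel" unfolding \<Lambda>_def by measurable
  \<comment> \<open>The L^1 constant of the kernel, the norm of w and the bound of the beta
    integral. The latter is valid for t \<le> 1, which is why T is capped at 1.\<close>
  define B where "B = C1 * A1 * (2 powr (1 - \<alpha>) / (\<sigma> + 1) + 2 powr \<bar>\<sigma>\<bar> / \<alpha>)"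
  have \<sigma>1: "\<sigma> + 1 > 0" using assms by linarith
  have "0 < 2 powr (1 - \<alpha>) / (\<sigma> + 1)" "0 < 2 powr \<bar>\<sigma>\<bar> / \<alpha>" using \<sigma>1 \<alpha> by simp_all
  hence B: "B > 0" unfolding B_def using C1 A1 by (intro mult_pos_pos) linarith+
  \<comment> \<open>The factor 4 is that of \<open>Lq_le_add\<close>.\<close>
  define A where "A = 4 * (A0 + B)"
  have A: "A > 0" using A0 B by (simp add: A_def)
  have \<Lambda>2_le: "Lq_le q B (\<lambda>x. \<Lambda>2 (t, x))" if t: "0 < t" "t \<le> 1" for t
    unfolding \<Lambda>2_def
  proof (rule duhamel_Lq_le[OF G _ _ _ C1(2), where \<phi> = "\<lambda>\<tau>. \<tau> powr \<sigma> * A1"])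
    show "AE \<tau> in lborel. 0 < \<tau> \<and> \<tau> < t \<longrightarrow> Lq_le (q / ereal 1) (\<tau> powr \<sigma> * A1) (\<lambda>y. ennreal \<bar>g (\<tau>, y)\<bar>)"
    proof (intro AE_I2 impI)
      fix \<tau> :: real
      have "Lq_le q (\<tau> powr \<sigma> * A1) (\<lambda>y. ennreal (\<tau> powr \<sigma>) * ennreal \<bar>w y\<bar>)"
        using A1 q1 by (intro Lq_le_cmult) auto
      moreover have "q / ereal 1 = q" by (cases q) auto
      ultimately show "Lq_le (q / ereal 1) (\<tau> powr \<sigma> * A1) (\<lambda>y. ennreal \<bar>g (\<tau>, y)\<bar>)"
        by (simp add: g_def abs_mult ennreal_mult)
    qed
    have "(\<integral>\<^sup>+\<tau>. ennreal (indicator {0<..<t} \<tau> * (C1 * (t - \<tau>) powr (\<alpha> - 1) * (\<tau> powr \<sigma> * A1))) \<partial>lborel)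
        = (\<integral>\<^sup>+\<tau>. ennreal ((C1 * A1) * (indicator {0<..<t} \<tau> * ((t - \<tau>) powr (\<alpha> - 1) * \<tau> powr \<sigma>))) \<partial>lborel)"
      by (simp add: mult_ac)
    also have "\<dots> = ennreal (C1 * A1) * (\<integral>\<^sup>+\<tau>. ennreal (indicator {0<..<t} \<tau> * ((t - \<tau>) powr (\<alpha> - 1) * \<tau> powr \<sigma>)) \<partial>lborel)"
      using C1 A1 by (intro nn_integral_ennreal_cmult) auto
    also have "\<dots> \<le> ennreal (C1 * A1) * ennreal (2 powr (1 - \<alpha>) / (\<sigma> + 1) + 2 powr \<bar>\<sigma>\<bar> / \<alpha>)"
      using assms(6) t by (intro mult_left_mono beta_integral_bound \<alpha>) auto
    also have "\<dots> = ennreal B" using C1 A1 by (simp add: B_def ennreal_mult')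
    finally show "(\<integral>\<^sup>+\<tau>. ennreal (indicator {0<..<t} \<tau> * (C1 * (t - \<tau>) powr (\<alpha> - 1) * (\<tau> powr \<sigma> * A1))) \<partial>lborel) \<le> ennreal B" .
  qed (use B A1 q1 in \<open>auto simp: one_ereal_def\<close>)
  have \<Lambda>1_le: "Lq_le q A0 (\<lambda>x. \<Lambda>1 (t, x))" if "0 < t" for t
    unfolding \<Lambda>1_def fst_conv snd_conv
  proof (rule convolution_Lq_le)
    show "(\<integral>\<^sup>+x. ennreal \<bar>Z (t, x)\<bar> \<partial>lborel) \<le> 1"
      using nn_integral_Z_kernel[OF \<alpha> s that, where 'a = 'a] that by (simp add: Z_def causal_ext_def)
  qed (use A0 q1 in measurable)
  have \<Lambda>_le: "Lq_le q A (\<lambda>x. \<Lambda> (t, x))" if "0 < t" "t \<le> 1" for t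
    unfolding \<Lambda>_def A_def using that \<Lambda>1_le \<Lambda>2_le A0 B q1 by (intro Lq_le_add) auto

  \<comment> \<open>The left side of the smallness condition is k T^\<beta>, so k^(-1/\<beta>) is
    the largest T that it admits.\<close>
  define k where "k = 8 * (C * (8 * A) powr (p - 1) * Gamma \<beta> * exp 1)"
  have k: "k > 0" unfolding k_def using C\<beta> A by (intro mult_pos_pos) auto
  define T where "T = min 1 (k powr (- (1 / \<beta>)))"
  have T: "0 < T" "T \<le> 1" using k by (auto simp: T_def)
  have small: "8 * (C * (8 * A) powr (p - 1) * Gamma \<beta> * T powr \<beta> * exp 1) \<le> 1"
  proof -
    have "T powr \<beta> \<le> (k powr (- (1 / \<beta>))) powr \<beta>" using T C\<beta> by (intro powr_mono2) (auto simp: T_def)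
    also have "\<dots> = k powr (- 1)" using C\<beta> by (simp only: powr_powr) simp
    also have "\<dots> = 1 / k" using k by (simp add: powr_minus_divide)
    finally have "k * T powr \<beta> \<le> 1" using k by (simp add: field_simps)
    thus ?thesis by (simp add: k_def mult_ac)
  qed
  have "\<exists>U. U \<in> borel_measurable borel \<and> (\<forall>v. U v = \<Lambda> v + duhamel G (\<lambda>z. epow (U z) p) v) \<and>
    (\<forall>t. 0 < t \<and> t < T \<longrightarrow> Lq_le q (8 * A) (\<lambda>x. U (t, x)))"
    using T small A by (intro ex_majorant \<Lambda>_le) auto
  then obtain U where U: "U \<in> borel_measurable borel" "\<And>v. U v = \<Lambda> v + duhamel G (\<lambda>z. epow (U z) p) v"
    "\<And>t. 0 < t \<Longrightarrow> t < T \<Longrightarrow> Lq_le q (8 * A) (\<lambda>x. U (t, x))" by blast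
  define b1 where "b1 v = (\<integral>y. u0 y * Z (fst v, snd v - y) \<partial>lborel)" for v :: "real \<times> 'a"
  define b2 where "b2 v = (\<integral>z. indicator {0<..} (fst z) * (g z * G (v - z)) \<partial>lborel)" for v
  define b where "b v = b1 v + b2 v" for v
  have [measurable]: "b1 \<in> borel_measurable borel" unfolding b1_def by measurable
  have [measurable]: "b2 \<in> borel_measurable borel" unfolding b2_def by measurable
  have [measurable]: "b \<in> borel_measurable borel" unfolding b_def by measurable
  have b1_int: "(\<integral>\<^sup>+y. ennreal \<bar>u0 y * Z (fst v, snd v - y)\<bar> \<partial>lborel) = \<Lambda>1 v" for v
    by (simp add: \<Lambda>1_def abs_mult)
  have b2_int: "(\<integral>\<^sup>+z. ennreal \<bar>indicator {0<..} (fst z) * (g z * G (v - z))\<bar> \<partial>lborel) = \<Lambda>2 v" for v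
    unfolding \<Lambda>2_def duhamel_def
    by (intro nn_integral_cong) (auto simp: abs_mult ennreal_mult mult.commute split: split_indicator)
  have b_le: "ennreal \<bar>b v\<bar> \<le> \<Lambda> v" for v
  proof -
    have "ennreal \<bar>b v\<bar> \<le> ennreal (\<bar>b1 v\<bar> + \<bar>b2 v\<bar>)" unfolding b_def by (intro ennreal_leI) auto
    also have "\<dots> = ennreal \<bar>b1 v\<bar> + ennreal \<bar>b2 v\<bar>" by simp
    also have "\<dots> \<le> \<Lambda>1 v + \<Lambda>2 v"
      unfolding b1_int[symmetric] b2_int[symmetric] b1_def b2_def by (intro add_mono ennreal_abs_integral_le)
    finally show ?thesis by (simp only: \<Lambda>_def)
  qed
  have fixp: "\<exists>u. u \<in> borel_measurable borel \<and> (\<forall>w. ennreal \<bar>u w\<bar> \<le> U w) \<and>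
    (AE w in lborel. 0 < fst w \<and> fst w < T \<longrightarrow> U w < \<top> \<and> u w = b w + nonlin u w)"
    by (rule ex_fixed_point[OF U(1) _ b_le U(2), of "8 * A"]) (use A U(3) in auto)

  \<comment> \<open>On (0, T) both Duhamel integrals become convolutions with the causal extension
    of Y, and the first three clauses express absolute convergence. Existence and uniqueness are
    then read off from the abstract equation.\<close>
  have mild_iff: "mild_solution \<alpha> s p \<sigma> u0 w T u \<longleftrightarrow> (AE v in lborel. 0 < fst v \<and> fst v < T \<longrightarrow>
      integrable lborel (\<lambda>y. u0 y * Z (fst v, snd v - y)) \<and>
      integrable lborel (\<lambda>z. indicator {0<..} (fst z) * (\<bar>u (fst z) (snd z)\<bar> powr p * G (v - z))) \<and>
      integrable lborel (\<lambda>z. indicator {0<..} (fst z) * (g z * G (v - z))) \<and>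
      u (fst v) (snd v) = b v + nonlin (\<lambda>z. u (fst z) (snd z)) v)" for u
    unfolding mild_solution_def
  proof (rule AE_cong)
    fix v :: "real \<times> 'a"
    obtain t x where v: "v = (t, x)" by (cases v)
    show "(case v of (t, x) \<Rightarrow> t \<in> {0<..<T} \<longrightarrow>
        integrable lborel (\<lambda>y. u0 y * ?Z t (x - y)) \<and>
        set_integrable lborel ({0<..<t} \<times> UNIV) (\<lambda>(\<tau>, y). \<bar>u \<tau> y\<bar> powr p * ?Y (t - \<tau>) (x - y)) \<and>
        set_integrable lborel ({0<..<t} \<times> UNIV) (\<lambda>(\<tau>, y). \<tau> powr \<sigma> * w y * ?Y (t - \<tau>) (x - y)) \<and>
        u t x = (LINT y|lborel. u0 y * ?Z t (x - y))
          + (LINT \<tau>:{0<..<t}|lborel. LINT y|lborel. \<bar>u \<tau> y\<bar> powr p * ?Y (t - \<tau>) (x - y))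
          + (LINT \<tau>:{0<..<t}|lborel. LINT y|lborel. \<tau> powr \<sigma> * w y * ?Y (t - \<tau>) (x - y))) \<longleftrightarrow>
      (0 < fst v \<and> fst v < T \<longrightarrow>
      integrable lborel (\<lambda>y. u0 y * Z (fst v, snd v - y)) \<and>
      integrable lborel (\<lambda>z. indicator {0<..} (fst z) * (\<bar>u (fst z) (snd z)\<bar> powr p * G (v - z))) \<and>
      integrable lborel (\<lambda>z. indicator {0<..} (fst z) * (g z * G (v - z))) \<and>
      u (fst v) (snd v) = b v + nonlin (\<lambda>z. u (fst z) (snd z)) v)"
    proof (cases "0 < t \<and> t < T")
      case True
      have Zt: "Z (t, y) = ?Z t y" for y using True by (simp add: Z_def causal_ext_def)
      note i1 = set_integrable_strip_iff[where t = t and x = x and f = "\<lambda>\<tau> y. \<bar>u \<tau> y\<bar> powr p" and K = ?Y, folded G_def]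
      note i2 = set_integrable_strip_iff[where t = t and x = x and f = "\<lambda>\<tau> y. \<tau> powr \<sigma> * w y" and K = ?Y, folded G_def g_def]
      note e1 = set_integral_strip[where t = t and x = x and f = "\<lambda>\<tau> y. \<bar>u \<tau> y\<bar> powr p" and K = ?Y, folded G_def]
      note e2 = set_integral_strip[where t = t and x = x and f = "\<lambda>\<tau> y. \<tau> powr \<sigma> * w y" and K = ?Y, folded G_def g_def]
      show ?thesis
        using True unfolding v prod.case fst_conv snd_conv Zt
        by (auto simp: i1[symmetric] i2[symmetric] e1 e2 b_def b1_def b2_def nonlin_def Zt)
    next
      case False
      thus ?thesis unfolding v by auto
    qed
  qed

  have "\<exists>u. in_Linf_Lq T q u \<and> mild_solution \<alpha> s p \<sigma> u0 w T u"
  proof -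
    obtain u where um[measurable]: "u \<in> borel_measurable borel" and uU: "\<And>v. ennreal \<bar>u v\<bar> \<le> U v"
      and ue: "AE v in lborel. 0 < fst v \<and> fst v < T \<longrightarrow> U v < \<top> \<and> u v = b v + nonlin u v"
      using fixp by blast
    have "in_Linf_Lq T q (\<lambda>t x. u (t, x))"
      unfolding in_Linf_Lq_def
    proof (intro conjI exI AE_I2 impI)
      have [measurable]: "{0<..<T} \<times> UNIV \<in> sets (borel :: (real \<times> 'a) measure)"
        by (intro borel_open open_Times) auto
      show "set_borel_measurable lborel ({0<..<T} \<times> UNIV) (\<lambda>(t, x). u (t, x))"
        unfolding set_borel_measurable_def by simp
      fix t :: real assume t: "t \<in> {0<..<T}"
      have "Lq_le q (8 * A) (\<lambda>x. ennreal \<bar>u (t, x)\<bar>)"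
        by (rule Lq_le_mono[OF U(3)[of t]]) (use t uU A q1 in auto)
      thus n: "Lq_norm q (\<lambda>x. u (t, x)) \<le> ereal (8 * A)"
        using A q1 by (subst Lq_le_norm_iff) auto
      show "in_Lq q (\<lambda>x. u (t, x))"
        unfolding in_Lq_def using n by (auto intro: le_less_trans)
    qed
    moreover have "mild_solution \<alpha> s p \<sigma> u0 w T (\<lambda>t x. u (t, x))"
      unfolding mild_iff using ue
    proof eventually_elim
      case (elim v)
      show ?case
      proof
        assume "0 < fst v \<and> fst v < T"
        hence fin: "U v < \<top>" and eq: "u v = b v + nonlin u v" using elim by auto
        \<comment> \<open>Where U is finite, each summand of its equation is finite, and this is the
          absolute convergence demanded of a mild solution.\<close>
        have "\<Lambda>1 v < \<top>" "\<Lambda>2 v < \<top>" "duhamel G (\<lambda>z. epow (U z) p) v < \<top>"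
          using fin unfolding U(2)[of v] \<Lambda>_def by (auto simp: less_top[symmetric])
        hence "integrable lborel (\<lambda>y. u0 y * Z (fst v, snd v - y))"
          "integrable lborel (\<lambda>z. indicator {0<..} (fst z) * (g z * G (v - z)))"
          "integrable lborel (\<lambda>z. indicator {0<..} (fst z) * (\<bar>u z\<bar> powr p * G (v - z)))"
          using nonlin_integrable[OF um uU, of v]
          by (auto intro!: integrableI_bounded simp: b1_int b2_int real_norm_def[abs_def])
        thus "integrable lborel (\<lambda>y. u0 y * Z (fst v, snd v - y)) \<and>
          integrable lborel (\<lambda>z. indicator {0<..} (fst z) * (\<bar>u (fst z, snd z)\<bar> powr p * G (v - z))) \<and>
          integrable lborel (\<lambda>z. indicator {0<..} (fst z) * (g z * G (v - z))) \<and>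
          u (fst v, snd v) = b v + nonlin (\<lambda>z. u (fst z, snd z)) v"
          using eq by simp
      qed
    qed
    ultimately show ?thesis by blast
  qed
  moreover have "AE (t, x) in lborel. t \<in> {0<..<T} \<longrightarrow> u t x = v t x"
    if u: "in_Linf_Lq T q u" "mild_solution \<alpha> s p \<sigma> u0 w T u"
      and v: "in_Linf_Lq T q v" "mild_solution \<alpha> s p \<sigma> u0 w T v" for u v
  proof -
    \<comment> \<open>Membership in the solution class says nothing about u outside (0, T), not even
      measurability. Extension by 0 gives a measurable function on all of space-time, and causality
      preserves the equation on (0, T).\<close>
    define cut where "cut f z = (if 0 < fst z \<and> fst z < T then f (fst z) (snd z) else 0)" for f :: "real \<Rightarrow> 'a \<Rightarrow> real" and z
    have cut_meas: "cut f \<in> borel_measurable borel" if "in_Linf_Lq T q f" for f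
    proof -
      have "cut f = (\<lambda>z. indicator ({0<..<T} \<times> UNIV) z *\<^sub>R (case z of (t, x) \<Rightarrow> f t x))"
        by (auto simp: cut_def fun_eq_iff split: split_indicator)
      thus ?thesis using that by (simp add: in_Linf_Lq_def set_borel_measurable_def)
    qed
    have cut_Lq: "\<exists>M>0. AE \<tau> in lborel. 0 < \<tau> \<and> \<tau> < T \<longrightarrow> Lq_le q M (\<lambda>y. ennreal \<bar>cut f (\<tau>, y)\<bar>)" if inL: "in_Linf_Lq T q f" for f
    proof -
      obtain M where M: "AE t in lborel. t \<in> {0<..<T} \<longrightarrow> in_Lq q (f t) \<and> Lq_norm q (f t) \<le> ereal M"
        using inL unfolding in_Linf_Lq_def by blast
      have "AE \<tau> in lborel. 0 < \<tau> \<and> \<tau> < T \<longrightarrow> Lq_le q (max 1 M) (\<lambda>y. ennreal \<bar>cut f (\<tau>, y)\<bar>)"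
        using M
      proof eventually_elim
        case (elim \<tau>)
        show ?case
        proof
          assume \<tau>: "0 < \<tau> \<and> \<tau> < T"
          hence f: "f \<tau> \<in> borel_measurable borel" "Lq_norm q (f \<tau>) \<le> ereal M" using elim by (auto simp: in_Lq_def)
          have "Lq_norm q (f \<tau>) \<le> ereal (max 1 M)" using f(2) by (rule order_trans) simp
          hence "Lq_le q (max 1 M) (\<lambda>y. ennreal \<bar>f \<tau> y\<bar>)" using Lq_le_norm_iff[OF f(1) _ q1, of "max 1 M"] by simp
          thus "Lq_le q (max 1 M) (\<lambda>y. ennreal \<bar>cut f (\<tau>, y)\<bar>)" using \<tau> by (simp add: cut_def)
        qed
      qed
      thus ?thesis by (intro exI[of _ "max 1 M"]) auto
    qed
    have cut_eq: "AE v in lborel. 0 < fst v \<and> fst v < T \<longrightarrow>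
      integrable lborel (\<lambda>z. indicator {0<..} (fst z) * (\<bar>cut f z\<bar> powr p * G (v - z))) \<and> cut f v = b v + nonlin (cut f) v"
      if "mild_solution \<alpha> s p \<sigma> u0 w T f" for f
      using that unfolding mild_iff
    proof eventually_elim
      case (elim v)
      show ?case
      proof
        assume v: "0 < fst v \<and> fst v < T"
        have "indicator {0<..} (fst z) * (\<bar>f (fst z) (snd z)\<bar> powr p * G (v - z)) = indicator {0<..} (fst z) * (\<bar>cut f z\<bar> powr p * G (v - z))" for z
        proof (cases "0 < fst z \<and> fst z < T")
          case False
          hence "fst z \<le> 0 \<or> fst (v - z) \<le> 0" using v by auto
          hence "fst z \<le> 0 \<or> G (v - z) = 0" using G unfolding causal_kernel_def by blast
          thus ?thesis by auto
        qed (simp add: cut_def)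
        hence eq: "(\<lambda>z. indicator {0<..} (fst z) * (\<bar>f (fst z) (snd z)\<bar> powr p * G (v - z))) = (\<lambda>z. indicator {0<..} (fst z) * (\<bar>cut f z\<bar> powr p * G (v - z)))"
          by blast
        hence "nonlin (\<lambda>z. f (fst z) (snd z)) v = nonlin (cut f) v" unfolding nonlin_def by (rule arg_cong)
        moreover have "cut f v = f (fst v) (snd v)" using v by (simp add: cut_def)
        ultimately show "integrable lborel (\<lambda>z. indicator {0<..} (fst z) * (\<bar>cut f z\<bar> powr p * G (v - z))) \<and> cut f v = b v + nonlin (cut f) v"
          using elim v eq by simp
      qed
    qed
    obtain M1 where M1: "M1 > 0" "AE \<tau> in lborel. 0 < \<tau> \<and> \<tau> < T \<longrightarrow> Lq_le q M1 (\<lambda>y. ennreal \<bar>cut u (\<tau>, y)\<bar>)"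
      using cut_Lq[OF u(1)] by blast
    obtain M2 where M2: "M2 > 0" "AE \<tau> in lborel. 0 < \<tau> \<and> \<tau> < T \<longrightarrow> Lq_le q M2 (\<lambda>y. ennreal \<bar>cut v (\<tau>, y)\<bar>)"
      using cut_Lq[OF v(1)] by blast
    have "AE z in lborel. 0 < fst z \<and> fst z < T \<longrightarrow> cut u z = cut v z"
    proof (rule fixed_point_unique[OF cut_meas[OF u(1)] cut_meas[OF v(1)] _ _ _ cut_eq[OF u(2)] cut_eq[OF v(2)], where M = "max M1 M2"])
      show "AE \<tau> in lborel. 0 < \<tau> \<and> \<tau> < T \<longrightarrow> Lq_le q (max M1 M2) (\<lambda>y. ennreal \<bar>cut u (\<tau>, y)\<bar>)"
        using M1(2) by eventually_elim (use M1(1) q1 in \<open>auto intro: Lq_le_mono[where M = M1]\<close>)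
      show "AE \<tau> in lborel. 0 < \<tau> \<and> \<tau> < T \<longrightarrow> Lq_le q (max M1 M2) (\<lambda>y. ennreal \<bar>cut v (\<tau>, y)\<bar>)"
        using M2(2) by eventually_elim (use M2(1) q1 in \<open>auto intro: Lq_le_mono[where M = M2]\<close>)
    qed (use M1 in auto)
    thus ?thesis by eventually_elim (auto simp: cut_def)
  qed
  ultimately show ?thesis using T(1) by blast
qed

end
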